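(* Let $E\subset\mathbb{R}^k$, $f$, $K_1$, $K_2$, $\lambda>0$, $\rho>0$ satisfy conditions (A), (B), (C), (D) stated in the context, let $\mathbb{Z}_\rho\subset L_2(E;\mathbb{R}^n)$ be the set of trajectories of the control system $$x(\xi)=f(\xi,x(\xi))+\lambda\int_E\left[K_1(\xi,s,x(s))+K_2(\xi,s,x(s))u(s)\right]ds$$ generated by all $u(\cdot)\in V_\rho$, and let $$c_*=\left[\frac{16\lambda^2\rho^2\left[(\kappa_2+1)^2\mu(E)+1\right]}{(1-\kappa_0)^2-4\lambda^2\left[\kappa_1^2+\rho^2\kappa_2^2\mu(E)\right]}\right]^{\frac12}.$$ Then for every $\varepsilon>0$ there exist $\alpha_*(\varepsilon)>0$, $\Delta_*(\varepsilon)>0$, $\delta_*(\varepsilon)>0$ and $\sigma_*(\varepsilon,\alpha_*(\varepsilon))>0$ such that for any $\Delta\in(0,\Delta_*(\varepsilon)]$, $\delta\in(0,\delta_*(\varepsilon)]$ and $\sigma\in(0,\sigma_*(\varepsilon,\alpha_*(\varepsilon))]$, for every finite $\Delta$-partition $\Gamma=\{E_1,\ldots,E_N\}$ of $E$, every uniform partition $\Lambda=\{0=r_0,r_1,\ldots,r_q=\alpha_*(\varepsilon)\}$ of $[0,\alpha_*(\varepsilon)]$ with diameter $\delta=r_{j+1}-r_j$, $j=0,1,\ldots,q-1$, and every finite $\sigma$-net $S_\sigma$ on the unit sphere $S\subset\mathbb{R}^m$, the inequality $$h_2\left(\mathbb{Z}_\rho,\ \mathbb{Z}_\rho^{\alpha_*(\varepsilon),\Gamma,\Lambda,\sigma}\right)\le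 (c_*+1)\,\varepsilon$$ is satisfied, where $h_2(\cdot,\cdot)$ is the Hausdorff distance between subsets of $L_2(E;\mathbb{R}^n)$.
   Context: Setting. $E\subset\mathbb{R}^k$ is a compact set, $\mu$ is Lebesgue measure, $\|\cdot\|$ is the Euclidean norm, $\lambda>0$ and $\rho>0$ are given numbers. $L_2(E;\mathbb{R}^m)$ has norm $\|u(\cdot)\|_2=\left(\int_E\|u(s)\|^2ds\right)^{1/2}$, and $\|\cdot\|_\infty$ is the essential supremum norm. The set of admissible controls is $V_\rho=\{u(\cdot)\in L_2(E;\mathbb{R}^m):\|u(\cdot)\|_2\le\rho\}$. Conditions. (A) $f(\cdot,x):E\to\mathbb{R}^n$ is Lebesgue measurable for every fixed $x\in\mathbb{R}^n$, $f(\cdot,0)\in L_2(E;\mathbb{R}^n)$, and there is $\gamma_0(\cdot)\in L_\infty(E;\mathbb{R}^1)$ such that for almost all $\xi\in E$, $\|f(\xi,x_1)-f(\xi,x_2)\|\le\gamma_0(\xi)\|x_1-x_2\|$ for all $x_1,x_2\in\mathbb{R}^n$. (B) $K_1(\cdot,\cdot,x):E\times E\to\mathbb{R}^n$ is Lebesgue measurable for every fixed $x\in\mathbb{R}^n$, $K_1(\cdot,\cdot,0)\in L_2(E\times E;\mathbb{R}^n)$, and there is $\gamma_1(\cdot,\cdot)\in L_2(E\times E;\mathbb{R}^1)$ such that for almost all $(\xi,s)\in E\times E$, $\|K_1(\xi,s,x_1)-K_1(\xi,s,x_2)\|\le\gamma_1(\xi,s)\|x_1-x_2\|$ for all $x_1,x_2\in\mathbb{R}^n$.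 (C) $K_2(\cdot,\cdot,x):E\times E\to\mathbb{R}^{n\times m}$ is Lebesgue measurable for every fixed $x\in\mathbb{R}^n$, $K_2(\cdot,\cdot,0)\in L_2(E\times E;\mathbb{R}^{n\times m})$, and there is $\gamma_2(\cdot,\cdot)\in L_\infty(E\times E;\mathbb{R}^1)$ such that for almost all $(\xi,s)\in E\times E$, $\|K_2(\xi,s,x_1)-K_2(\xi,s,x_2)\|\le\gamma_2(\xi,s)\|x_1-x_2\|$ for all $x_1,x_2\in\mathbb{R}^n$. (D) $6\left[\kappa_0^2+\lambda^2\kappa_1^2+\lambda^2\rho^2\kappa_2^2\mu(E)\right]<1$, where $\kappa_0=\|\gamma_0(\cdot)\|_\infty$, $\kappa_1=\|\gamma_1(\cdot,\cdot)\|_2=\left(\int_E\int_E\gamma_1(\xi,s)^2ds\,d\xi\right)^{1/2}$, $\kappa_2=\|\gamma_2(\cdot,\cdot)\|_\infty$. Trajectories. A trajectory generated by $u(\cdot)\in V_\rho$ is a function $x(\cdot)\in L_2(E;\mathbb{R}^n)$ satisfying the integral equation $x(\xi)=f(\xi,x(\xi))+\lambda\int_E\left[K_1(\xi,s,x(s))+K_2(\xi,s,x(s))u(s)\right]ds$ for almost all $\xi\in E$. It is known that under (A)-(D) every $u(\cdot)\in V_\rho$ generates a unique trajectory, and that $\mathbb{Z}_\rho$ is a compact (in particular bounded) subset of $L_2(E;\mathbb{R}^n)$. Partitions and nets. A finite $\Delta$-partition of $E$ is a finite system $\Gamma=\{E_1,\ldots,E_N\}$ of pairwise disjoint Lebesgue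 measurable subsets of $E$ with $E=\bigcup_{i=1}^N E_i$ and $\mathrm{diam}(E_i)\le\Delta$ for every $i$. A uniform partition of $[0,\alpha]$ with diameter $\delta$ is a set $\Lambda=\{0=r_0,r_1,\ldots,r_q=\alpha\}$ with $r_{j+1}-r_j=\delta$ for $j=0,\ldots,q-1$. $S=\{x\in\mathbb{R}^m:\|x\|=1\}$; a finite $\sigma$-net on $S$ is a finite set $S_\sigma=\{b_1,\ldots,b_c\}\subset S$ such that every $g\in S$ satisfies $\|g-b_l\|\le\sigma$ for some $l$. Finite set of controls. For $\alpha>0$, a finite $\Delta$-partition $\Gamma=\{E_1,\ldots,E_N\}$ of $E$, a uniform partition $\Lambda=\{0=r_0,r_1,\ldots,r_q=\alpha\}$ of $[0,\alpha]$, and a finite $\sigma$-net $S_\sigma=\{b_1,\ldots,b_c\}$ on $S$, $$V_\rho^{\alpha,\Gamma,\Lambda,\sigma}=\Big\{u(\cdot)\in L_2(E;\mathbb{R}^m): u(s)=r_{j_i}b_{l_i}\ \text{for every } s\in E_i,\ r_{j_i}\in\Lambda,\ b_{l_i}\in S_\sigma,\ i=1,\ldots,N,\ \sum_{i=1}^N\mu(E_i)r_{j_i}^2\le\rho^2\Big\},$$ and $\mathbb{Z}_\rho^{\alpha,\Gamma,\Lambda,\sigma}$ is the set of trajectories generated by all $u(\cdot)\in V_\rho^{\alpha,\Gamma,\Lambda,\sigma}$. *)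

theory Defs
  imports "HOL-Probability.Essential_Supremum"
begin

text \<open>
  Elements of $L_2$ and $L_\infty$ are represented by functions rather than by equivalence
  classes modulo almost-everywhere equality; values outside the domain are irrelevant.
  On \<open>real ^ 'm ^ 'n\<close> (matrices with \<open>n\<close> rows and \<open>m\<close> columns) \<open>norm\<close> is the
  Euclidean norm of the tuple of entries.
\<close>

definition L2 :: "'a::euclidean_space set \<Rightarrow> ('a \<Rightarrow> 'b::euclidean_space) set" where
  "L2 D = {u \<in> borel_measurable (lebesgue_on D).
             integrable (lebesgue_on D) (\<lambda>s. (norm (u s))\<^sup>2)}"

definition L2_norm :: "'a::euclidean_space set \<Rightarrow> ('a \<Rightarrow> 'b::euclidean_space) \<Rightarrow> real" where
  "L2_norm D u = sqrt (LINT s|lebesgue_on D. (norm (u s))\<^sup>2)"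

definition Linf :: "'a::euclidean_space set \<Rightarrow> ('a \<Rightarrow> real) set" where
  "Linf D = {g \<in> borel_measurable (lebesgue_on D).
               esssup (lebesgue_on D) (\<lambda>s. ennreal \<bar>g s\<bar>) < \<infinity>}"

text \<open>The essential supremum is taken in \<open>ennreal\<close>, so the norm is 0 on a null set.\<close>

definition Linf_norm :: "'a::euclidean_space set \<Rightarrow> ('a \<Rightarrow> real) \<Rightarrow> real" where
  "Linf_norm D g = enn2real (esssup (lebesgue_on D) (\<lambda>s. ennreal \<bar>g s\<bar>))"

definition condition_A ::
  "(real ^ 'k) set \<Rightarrow> (real ^ 'k \<Rightarrow> real ^ 'n \<Rightarrow> real ^ 'n) \<Rightarrow> (real ^ 'k \<Rightarrow> real) \<Rightarrow> bool" where
  "condition_A E f \<gamma>0 \<longleftrightarrow>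
     (\<forall>x. (\<lambda>\<xi>. f \<xi> x) \<in> borel_measurable (lebesgue_on E)) \<and>
     (\<lambda>\<xi>. f \<xi> 0) \<in> L2 E \<and>
     \<gamma>0 \<in> Linf E \<and>
     (AE \<xi> in lebesgue_on E. \<forall>x1 x2.
        norm (f \<xi> x1 - f \<xi> x2) \<le> \<gamma>0 \<xi> * norm (x1 - x2))"

definition condition_B ::
  "(real ^ 'k) set \<Rightarrow> (real ^ 'k \<Rightarrow> real ^ 'k \<Rightarrow> real ^ 'n \<Rightarrow> real ^ 'n)
    \<Rightarrow> ((real ^ 'k) \<times> (real ^ 'k) \<Rightarrow> real) \<Rightarrow> bool" where
  "condition_B E K1 \<gamma>1 \<longleftrightarrow>
     (\<forall>x. (\<lambda>(\<xi>, s). K1 \<xi> s x) \<in> borel_measurable (lebesgue_on (E \<times> E))) \<and>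
     (\<lambda>(\<xi>, s). K1 \<xi> s 0) \<in> L2 (E \<times> E) \<and>
     \<gamma>1 \<in> L2 (E \<times> E) \<and>
     (AE (\<xi>, s) in lebesgue_on (E \<times> E). \<forall>x1 x2.
        norm (K1 \<xi> s x1 - K1 \<xi> s x2) \<le> \<gamma>1 (\<xi>, s) * norm (x1 - x2))"

definition condition_C ::
  "(real ^ 'k) set \<Rightarrow> (real ^ 'k \<Rightarrow> real ^ 'k \<Rightarrow> real ^ 'n \<Rightarrow> real ^ 'm ^ 'n)
    \<Rightarrow> ((real ^ 'k) \<times> (real ^ 'k) \<Rightarrow> real) \<Rightarrow> bool" where
  "condition_C E K2 \<gamma>2 \<longleftrightarrow>
     (\<forall>x. (\<lambda>(\<xi>, s). K2 \<xi> s x) \<in> borel_measurable (lebesgue_on (E \<times> E))) \<and>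
     (\<lambda>(\<xi>, s). K2 \<xi> s 0) \<in> L2 (E \<times> E) \<and>
     \<gamma>2 \<in> Linf (E \<times> E) \<and>
     (AE (\<xi>, s) in lebesgue_on (E \<times> E). \<forall>x1 x2.
        norm (K2 \<xi> s x1 - K2 \<xi> s x2) \<le> \<gamma>2 (\<xi>, s) * norm (x1 - x2))"

text \<open>In the next two definitions \<open>M\<close> stands for $\mu(E)$.\<close>

definition condition_D :: "real \<Rightarrow> real \<Rightarrow> real \<Rightarrow> real \<Rightarrow> real \<Rightarrow> real \<Rightarrow> bool" where
  "condition_D M lam \<rho> \<kappa>0 \<kappa>1 \<kappa>2 \<longleftrightarrow>
     6 * (\<kappa>0\<^sup>2 + lam\<^sup>2 * \<kappa>1\<^sup>2 + lam\<^sup>2 * \<rho>\<^sup>2 * \<kappa>2\<^sup>2 * M) < 1"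

definition c_star :: "real \<Rightarrow> real \<Rightarrow> real \<Rightarrow> real \<Rightarrow> real \<Rightarrow> real \<Rightarrow> real" where
  "c_star M lam \<rho> \<kappa>0 \<kappa>1 \<kappa>2 =
     sqrt (16 * lam\<^sup>2 * \<rho>\<^sup>2 * ((\<kappa>2 + 1)\<^sup>2 * M + 1) /
           ((1 - \<kappa>0)\<^sup>2 - 4 * lam\<^sup>2 * (\<kappa>1\<^sup>2 + \<rho>\<^sup>2 * \<kappa>2\<^sup>2 * M)))"

definition admissible_controls ::
  "(real ^ 'k) set \<Rightarrow> real \<Rightarrow> (real ^ 'k \<Rightarrow> real ^ 'm) set" where
  "admissible_controls E \<rho> = {u \<in> L2 E. L2_norm E u \<le> \<rho>}"

text \<open>
  Integrability is required explicitly because the Bochner integral of a non-integrable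
  function is 0 by convention.
\<close>

definition is_trajectory ::
  "(real ^ 'k) set \<Rightarrow> (real ^ 'k \<Rightarrow> real ^ 'n \<Rightarrow> real ^ 'n)
    \<Rightarrow> (real ^ 'k \<Rightarrow> real ^ 'k \<Rightarrow> real ^ 'n \<Rightarrow> real ^ 'n)
    \<Rightarrow> (real ^ 'k \<Rightarrow> real ^ 'k \<Rightarrow> real ^ 'n \<Rightarrow> real ^ 'm ^ 'n) \<Rightarrow> real
    \<Rightarrow> (real ^ 'k \<Rightarrow> real ^ 'm) \<Rightarrow> (real ^ 'k \<Rightarrow> real ^ 'n) \<Rightarrow> bool" where
  "is_trajectory E f K1 K2 lam u x \<longleftrightarrow>
     x \<in> L2 E \<and>
     (AE \<xi> in lebesgue_on E.
        integrable (lebesgue_on E) (\<lambda>s. K1 \<xi> s (x s) + K2 \<xi> s (x s) *v u s) \<and>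
        x \<xi> = f \<xi> (x \<xi>)
          + lam *\<^sub>R (LINT s|lebesgue_on E. K1 \<xi> s (x s) + K2 \<xi> s (x s) *v u s))"

definition trajectories ::
  "(real ^ 'k) set \<Rightarrow> (real ^ 'k \<Rightarrow> real ^ 'n \<Rightarrow> real ^ 'n)
    \<Rightarrow> (real ^ 'k \<Rightarrow> real ^ 'k \<Rightarrow> real ^ 'n \<Rightarrow> real ^ 'n)
    \<Rightarrow> (real ^ 'k \<Rightarrow> real ^ 'k \<Rightarrow> real ^ 'n \<Rightarrow> real ^ 'm ^ 'n) \<Rightarrow> real
    \<Rightarrow> (real ^ 'k \<Rightarrow> real ^ 'm) set \<Rightarrow> (real ^ 'k \<Rightarrow> real ^ 'n) set" where
  "trajectories E f K1 K2 lam V = {x. \<exists>u\<in>V. is_trajectory E f K1 K2 lam u x}"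

definition finite_partition :: "real \<Rightarrow> (real ^ 'k) set \<Rightarrow> (real ^ 'k) set set \<Rightarrow> bool" where
  "finite_partition \<Delta> E \<Gamma> \<longleftrightarrow>
     finite \<Gamma> \<and> disjoint \<Gamma> \<and> \<Union>\<Gamma> = E \<and>
     (\<forall>A\<in>\<Gamma>. A \<in> sets lebesgue \<and> diameter A \<le> \<Delta>)"

definition uniform_partition :: "real \<Rightarrow> real \<Rightarrow> real set \<Rightarrow> bool" where
  "uniform_partition \<delta> \<alpha> \<Lambda> \<longleftrightarrow>
     (\<exists>(r :: nat \<Rightarrow> real) q. \<Lambda> = r ` {..q} \<and> r 0 = 0 \<and> r q = \<alpha> \<and>
        (\<forall>j<q. r (Suc j) - r j = \<delta>))"

definition finite_sphere_net :: "real \<Rightarrow> (real ^ 'm) set \<Rightarrow> bool" where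
  "finite_sphere_net \<sigma> B \<longleftrightarrow>
     finite B \<and> B \<subseteq> sphere 0 1 \<and> (\<forall>g\<in>sphere 0 1. \<exists>b\<in>B. norm (g - b) \<le> \<sigma>)"

text \<open>The number $\alpha$ enters only as the last point of the partition \<open>\<Lambda>\<close>.\<close>

definition discrete_controls ::
  "(real ^ 'k) set \<Rightarrow> real \<Rightarrow> (real ^ 'k) set set \<Rightarrow> real set \<Rightarrow> (real ^ 'm) set
    \<Rightarrow> (real ^ 'k \<Rightarrow> real ^ 'm) set" where
  "discrete_controls E \<rho> \<Gamma> \<Lambda> B =
     {u \<in> L2 E. \<exists>r b.
        (\<forall>A\<in>\<Gamma>. r A \<in> \<Lambda> \<and> b A \<in> B \<and> (\<forall>s\<in>A. u s = r A *\<^sub>R b A)) \<and>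
        (\<Sum>A\<in>\<Gamma>. measure lebesgue A * (r A)\<^sup>2) \<le> \<rho>\<^sup>2}"

text \<open>
  The Hausdorff distance is taken in \<open>ennreal\<close>, so that suprema of unbounded sets and
  distances to the empty set are \<open>\<infinity>\<close> instead of unspecified real numbers.
\<close>

definition hausdorff_L2 ::
  "'a::euclidean_space set \<Rightarrow> ('a \<Rightarrow> 'b::euclidean_space) set \<Rightarrow> ('a \<Rightarrow> 'b) set \<Rightarrow> ennreal" where
  "hausdorff_L2 D X Y =
     max (SUP x\<in>X. INF y\<in>Y. ennreal (L2_norm D (\<lambda>s. x s - y s)))
         (SUP y\<in>Y. INF x\<in>X. ennreal (L2_norm D (\<lambda>s. x s - y s)))"

end

theory Submission
  imports Defs "HOL-Probability.Conditional_Expectation"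
begin

text \<open>Every discrete control is admissible, because the vectors of the net have norm one. So only one
half of the Hausdorff distance matters: each trajectory \<open>x\<close> of an admissible control \<open>u\<close> must have a
trajectory \<open>y\<close> of a discrete control \<open>v\<close> nearby. A fixed partition cannot follow an arbitrary \<open>u\<close>
in the $L_2$ norm, since \<open>u\<close> may oscillate inside the cells. What a fine partition does reproduce is
the family of integrals of \<open>u\<close> over finitely many fixed sets, and the control enters the equation
only through an integral. The proof therefore has two independent halves.

\<^item> The trajectory map is uniformly continuous from the weak to the strong topology: for each
  \<open>\<epsilon>\<close> there are finitely many sets \<open>B\<close> and a number \<open>d > 0\<close> such that two controls whose integrals over
  every \<open>B\<close> differ by at most \<open>d\<close> have trajectories at distance at most \<open>\<epsilon>\<close>
  (\<open>traj_modulus_exists\<close>). For one fixed square-integrable matrix kernel this is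
  \<open>weak_to_strong_sq_integrable\<close>: indicators of rectangles have the property, and it is stable under
  sums and $L_2$ limits. The kernel \<open>K2 \<xi> s (x s)\<close> depends on the unknown trajectory, though. To deal
  with that, suppose a modulus is known at precision \<open>\<eta>\<close>. The controls then fall into finitely many weak
  classes, and all trajectories in one class lie within \<open>\<eta>\<close> of one representative \<open>z\<close>; freezing the
  kernel at \<open>z\<close> costs a multiple of \<open>\<eta>\<close>. The outcome is a modulus at precision \<open>p * \<eta> + t\<close> for
  every \<open>t > 0\<close>, where \<open>p\<close> is the sum of the Lipschitz constants of the state, \<open>K1\<close> and control terms, the last
  one counted twice (\<open>traj_modulus_improve\<close>). The hypothesis \<open>condition_D\<close> says exactly enough for \<open>p < 1\<close>: by
  Cauchy-Schwarz the square of \<open>a + b + 2 c\<close> is at most \<open>6 (a\<^sup>2 + b\<^sup>2 + c\<^sup>2)\<close>. Iteration from the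
  trivial modulus given by boundedness reaches every precision.

\<^item> Discrete controls are weakly dense, uniformly over all fine partitions
  (\<open>discrete_controls_weakly_dense\<close>). Truncate \<open>u\<close> at level \<open>\<alpha>\<close>, average it over the cells, round
  the averages to the radial grid and to the net. Averaging is exact on unions of cells, and up to small
  measure every fixed set is such a union, by inner and outer regularity of Lebesgue measure.

Existence of the trajectory of \<open>v\<close> comes from Picard iteration and a Riesz-Fischer argument. All of
this is carried out for data that are Lipschitz everywhere and measurable for the product
sigma-algebra; \<open>regular_representative\<close> alters the given data on null sets to reach this situation
without changing trajectories. The resulting distance is at most \<open>\<epsilon>\<close>, which is within the claimed
bound because the constant \<open>c_star\<close> is nonnegative.\<close>

section \<open>Square-integrable functions\<close>

text \<open>The notions of this section make sense on an arbitrary measure space, so that they apply both to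
\<open>lebesgue_on E\<close> and to the product measure that carries the kernels.\<close>

definition sq_integrable :: "'a measure \<Rightarrow> ('a \<Rightarrow> 'b::euclidean_space) \<Rightarrow> bool" where
  "sq_integrable M u \<longleftrightarrow> u \<in> borel_measurable M \<and> integrable M (\<lambda>s. (norm (u s))\<^sup>2)"

definition l2norm :: "'a measure \<Rightarrow> ('a \<Rightarrow> 'b::euclidean_space) \<Rightarrow> real" where
  "l2norm M u = sqrt (LINT s|M. (norm (u s))\<^sup>2)"

lemma sq_integrable_measurable[measurable_dest]: "sq_integrable M u \<Longrightarrow> u \<in> borel_measurable M"
  by (simp add: sq_integrable_def)

lemma sq_integrableD: "sq_integrable M u \<Longrightarrow> integrable M (\<lambda>s. (norm (u s))\<^sup>2)"
  by (simp add: sq_integrable_def)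

lemma l2norm_nonneg[simp]: "0 \<le> l2norm M u"
  by (simp add: l2norm_def)

lemma l2norm_power2: "(l2norm M u)\<^sup>2 = (LINT s|M. (norm (u s))\<^sup>2)"
  by (simp add: l2norm_def)

lemma l2norm_leI:
  assumes "0 \<le> c" "(LINT s|M. (norm (u s))\<^sup>2) \<le> c\<^sup>2"
  shows "l2norm M u \<le> c"
  unfolding l2norm_def using assms by (simp add: real_le_lsqrt)

lemma sq_integrable_norm: "sq_integrable M u \<Longrightarrow> sq_integrable M (\<lambda>s. norm (u s))"
  by (auto simp: sq_integrable_def)

lemma sq_integrable_bound:
  fixes g :: "'a \<Rightarrow> 'b::euclidean_space" and h :: "'a \<Rightarrow> 'c::euclidean_space"
  assumes h: "sq_integrable M h" and g: "g \<in> borel_measurable M"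
    and le: "AE s in M. norm (g s) \<le> norm (h s)"
  shows "sq_integrable M g" "l2norm M g \<le> l2norm M h"
proof -
  have le2: "AE s in M. (norm (g s))\<^sup>2 \<le> (norm (h s))\<^sup>2"
    using le by eventually_elim (simp add: power_mono)
  have i: "integrable M (\<lambda>s. (norm (g s))\<^sup>2)"
  proof (rule Bochner_Integration.integrable_bound[OF sq_integrableD[OF h]])
    show "(\<lambda>s. (norm (g s))\<^sup>2) \<in> borel_measurable M" using g by measurable
  qed (use le2 in auto)
  then show "sq_integrable M g" using g by (simp add: sq_integrable_def)
  show "l2norm M g \<le> l2norm M h"
    unfolding l2norm_def
    by (intro real_sqrt_le_mono integral_mono_AE i sq_integrableD[OF h] le2)
qed

lemma l2norm_cong_AE:
  fixes u v :: "'a \<Rightarrow> 'b::euclidean_space"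
  assumes "u \<in> borel_measurable M" "v \<in> borel_measurable M" "AE s in M. u s = v s"
  shows "l2norm M u = l2norm M v"
  unfolding l2norm_def
  by (rule arg_cong[where f = sqrt], rule integral_cong_AE) (use assms in auto)

lemma sq_integrable_scaleR:
  assumes "sq_integrable M u" shows "sq_integrable M (\<lambda>s. c *\<^sub>R u s)"
  using assms by (auto simp: sq_integrable_def power_mult_distrib)

lemma l2norm_scaleR: "l2norm M (\<lambda>s. c *\<^sub>R u s) = \<bar>c\<bar> * l2norm M u"
  by (simp add: l2norm_def power_mult_distrib real_sqrt_mult)

lemma sq_integrable_add:
  assumes u: "sq_integrable M u" and v: "sq_integrable M v"
  shows "sq_integrable M (\<lambda>s. u s + v s)"
proof -
  have "integrable M (\<lambda>s. (norm (u s + v s))\<^sup>2)"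
  proof (rule Bochner_Integration.integrable_bound)
    show "integrable M (\<lambda>s. 2 * (norm (u s))\<^sup>2 + 2 * (norm (v s))\<^sup>2)"
      using sq_integrableD[OF u] sq_integrableD[OF v] by simp
    show "(\<lambda>s. (norm (u s + v s))\<^sup>2) \<in> borel_measurable M"
      using u v by (auto simp: sq_integrable_def)
    have "(norm (u s + v s))\<^sup>2 \<le> 2 * (norm (u s))\<^sup>2 + 2 * (norm (v s))\<^sup>2" for s
    proof -
      have "(norm (u s + v s))\<^sup>2 \<le> (norm (u s) + norm (v s))\<^sup>2"
        by (intro power_mono norm_triangle_ineq) simp
      also have "\<dots> \<le> 2 * (norm (u s))\<^sup>2 + 2 * (norm (v s))\<^sup>2"
        using sum_squares_bound[of "norm (u s)" "norm (v s)"] by (simp add: power2_sum)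
      finally show ?thesis .
    qed
    then show "AE s in M. norm ((norm (u s + v s))\<^sup>2) \<le> norm (2 * (norm (u s))\<^sup>2 + 2 * (norm (v s))\<^sup>2)"
      by auto
  qed
  then show ?thesis using u v by (auto simp: sq_integrable_def)
qed

lemma sq_integrable_diff:
  assumes u: "sq_integrable M u" and v: "sq_integrable M v"
  shows "sq_integrable M (\<lambda>s. u s - v s)"
  using sq_integrable_add[OF u sq_integrable_scaleR[OF v, of "-1"]] by simp

lemma l2norm_minus_commute: "l2norm M (\<lambda>s. u s - v s) = l2norm M (\<lambda>s. v s - u s)"
  by (simp add: l2norm_def norm_minus_commute)

lemma sq_integrable_const:
  assumes "finite_measure M" shows "sq_integrable M (\<lambda>_. c)"
  using finite_measure.integrable_const[OF assms] by (auto simp: sq_integrable_def)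

lemma l2norm_const: "l2norm M (\<lambda>_. c) = norm c * sqrt (measure M (space M))"
  by (simp add: l2norm_def real_sqrt_mult)

text \<open>The quadratic polynomial \<open>t \<mapsto> \<integral>(t |u| - |v|)\<^sup>2\<close> is nonnegative, so its discriminant is not positive.\<close>

lemma cauchy_schwarz_l2:
  fixes u :: "'a \<Rightarrow> 'b::euclidean_space" and v :: "'a \<Rightarrow> 'c::euclidean_space"
  assumes u: "sq_integrable M u" and v: "sq_integrable M v"
  shows "integrable M (\<lambda>s. norm (u s) * norm (v s))"
    and "(LINT s|M. norm (u s) * norm (v s)) \<le> l2norm M u * l2norm M v"
proof -
  note [measurable] = sq_integrable_measurable[OF u] sq_integrable_measurable[OF v]
  show i: "integrable M (\<lambda>s. norm (u s) * norm (v s))"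
  proof (rule Bochner_Integration.integrable_bound)
    show "integrable M (\<lambda>s. (norm (u s))\<^sup>2 + (norm (v s))\<^sup>2)"
      using u v by (auto dest: sq_integrableD)
    have "norm (u s) * norm (v s) \<le> (norm (u s))\<^sup>2 + (norm (v s))\<^sup>2" for s
    proof -
      have "2 * (norm (u s) * norm (v s)) \<le> (norm (u s))\<^sup>2 + (norm (v s))\<^sup>2"
        using sum_squares_bound[of "norm (u s)" "norm (v s)"] by (simp add: mult.assoc)
      moreover have "0 \<le> norm (u s) * norm (v s)" by simp
      ultimately show ?thesis by linarith
    qed
    then show "AE s in M. norm (norm (u s) * norm (v s)) \<le> norm ((norm (u s))\<^sup>2 + (norm (v s))\<^sup>2)"
      by auto
  qed measurable
  define a b c where "a = (LINT s|M. (norm (u s))\<^sup>2)" and "b = (LINT s|M. norm (u s) * norm (v s))"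
    and "c = (LINT s|M. (norm (v s))\<^sup>2)"
  have pos: "0 \<le> a" "0 \<le> c" "0 \<le> b" by (auto simp: a_def c_def b_def)
  have q: "0 \<le> a * t\<^sup>2 - 2 * b * t + c" for t
  proof -
    have "0 \<le> (LINT s|M. (t * norm (u s) - norm (v s))\<^sup>2)" by simp
    also have "\<dots> = (LINT s|M. t\<^sup>2 * (norm (u s))\<^sup>2 - (2 * t) * (norm (u s) * norm (v s)) + (norm (v s))\<^sup>2)"
      by (rule Bochner_Integration.integral_cong) (auto simp: power2_diff power_mult_distrib)
    also have "\<dots> = t\<^sup>2 * a - 2 * t * b + c"
      using i sq_integrableD[OF u] sq_integrableD[OF v] by (simp add: a_def b_def c_def)
    finally show ?thesis by (simp add: algebra_simps)
  qed
  have "b\<^sup>2 \<le> a * c"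
  proof (cases "a = 0")
    case True
    have "b = 0"
    proof (rule ccontr)
      assume "b \<noteq> 0"
      then have "b > 0" using pos by simp
      \<comment> \<open>With \<open>a = 0\<close> the polynomial is affine with negative slope; at this point its value is \<open>-1\<close>.\<close>
      then show False using q[of "(c + 1) / (2 * b)"] True pos by (simp add: field_simps)
    qed
    then show ?thesis using True by simp
  next
    case False
    then have "a > 0" using pos by simp
    then show ?thesis using q[of "b / a"] by (simp add: field_simps power2_eq_square)
  qed
  then have "b \<le> sqrt (a * c)" by (rule real_le_rsqrt)
  then show "(LINT s|M. norm (u s) * norm (v s)) \<le> l2norm M u * l2norm M v"
    by (simp add: l2norm_def real_sqrt_mult a_def b_def c_def)
qed

lemma l2norm_triangle:
  assumes u: "sq_integrable M u" and v: "sq_integrable M v"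
  shows "l2norm M (\<lambda>s. u s + v s) \<le> l2norm M u + l2norm M v"
proof (rule l2norm_leI)
  note i = cauchy_schwarz_l2[OF u v] sq_integrableD[OF u] sq_integrableD[OF v]
  have "(LINT s|M. (norm (u s + v s))\<^sup>2)
      \<le> (LINT s|M. (norm (u s))\<^sup>2 + 2 * (norm (u s) * norm (v s)) + (norm (v s))\<^sup>2)"
  proof (rule integral_mono)
    show "(norm (u s + v s))\<^sup>2 \<le> (norm (u s))\<^sup>2 + 2 * (norm (u s) * norm (v s)) + (norm (v s))\<^sup>2" for s
      using power_mono[OF norm_triangle_ineq[of "u s" "v s"], of 2] by (simp add: power2_sum algebra_simps)
  qed (use i sq_integrableD[OF sq_integrable_add[OF u v]] in auto)
  also have "\<dots> = (l2norm M u)\<^sup>2 + 2 * (LINT s|M. norm (u s) * norm (v s)) + (l2norm M v)\<^sup>2"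
    using i by (simp add: l2norm_power2)
  also have "\<dots> \<le> (l2norm M u + l2norm M v)\<^sup>2"
    using i(2) by (simp add: power2_sum)
  finally show "(LINT s|M. (norm (u s + v s))\<^sup>2) \<le> (l2norm M u + l2norm M v)\<^sup>2" .
qed simp

lemma l2norm_triangle_diff:
  assumes u: "sq_integrable M u" and v: "sq_integrable M v"
  shows "l2norm M (\<lambda>s. u s - v s) \<le> l2norm M u + l2norm M v"
  using l2norm_triangle[OF u sq_integrable_scaleR[OF v, of "-1"]] l2norm_scaleR[of M "-1" v] by simp

lemma l2norm_triangle_via:
  assumes u: "sq_integrable M u" and v: "sq_integrable M v" and w: "sq_integrable M w"
  shows "l2norm M (\<lambda>s. u s - w s) \<le> l2norm M (\<lambda>s. u s - v s) + l2norm M (\<lambda>s. v s - w s)"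
  using l2norm_triangle[OF sq_integrable_diff[OF u v] sq_integrable_diff[OF v w]] by simp

lemma l2norm_eq_0_AE:
  assumes u: "sq_integrable M u" and z: "l2norm M u = 0"
  shows "AE s in M. u s = 0"
proof -
  have "(LINT s|M. (norm (u s))\<^sup>2) = 0" using z by (simp add: l2norm_def)
  then have "AE s in M. (norm (u s))\<^sup>2 = 0"
    using integral_nonneg_eq_0_iff_AE[OF sq_integrableD[OF u]] by simp
  then show ?thesis by simp
qed

lemma (in finite_measure) sq_integrable_integrable:
  assumes u: "sq_integrable M u"
  shows "integrable M u" "(LINT s|M. norm (u s)) \<le> l2norm M u * sqrt (measure M (space M))"
proof -
  have c: "sq_integrable M (\<lambda>_. 1::real)" by (rule sq_integrable_const) unfold_locales
  note * = cauchy_schwarz_l2[OF u c]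
  from *(2) show "(LINT s|M. norm (u s)) \<le> l2norm M u * sqrt (measure M (space M))"
    by (simp add: l2norm_const)
  from *(1) show "integrable M u"
    using sq_integrable_measurable[OF u] by (simp add: integrable_norm_iff)
qed

text \<open>Completeness of $L_2$ in the form needed for Picard iteration. Since the measure is finite, the
increments are also summable in $L_1$, which forces convergence almost everywhere; Fatou's lemma then
turns the geometric Cauchy estimate into an estimate of the distance to the limit.\<close>

lemma (in finite_measure) l2_geometric_limit:
  fixes X :: "nat \<Rightarrow> 'a \<Rightarrow> 'b::euclidean_space"
  assumes X: "\<And>n. sq_integrable M (X n)"
    and q: "0 \<le> q" "q < 1" and C: "0 \<le> C"
    and step: "\<And>n. l2norm M (\<lambda>s. X (Suc n) s - X n s) \<le> C * q ^ n"
  obtains x where "sq_integrable M x" "(\<lambda>n. l2norm M (\<lambda>s. X n s - x s)) \<longlonglongrightarrow> 0"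
proof -
  note [measurable] = sq_integrable_measurable[OF X]
  define m where "m = sqrt (measure M (space M))"
  define Y where "Y n s = X (Suc n) s - X n s" for n s
  have Y: "sq_integrable M (Y n)" for n
    unfolding Y_def using X by (intro sq_integrable_diff)
  note [measurable] = sq_integrable_measurable[OF Y]
  have nnY: "(\<integral>\<^sup>+ s. ennreal (norm (Y n s)) \<partial>M) \<le> ennreal (C * m * q ^ n)" for n
  proof -
    have "(\<integral>\<^sup>+ s. ennreal (norm (Y n s)) \<partial>M) = ennreal (LINT s|M. norm (Y n s))"
      using sq_integrable_integrable(1)[OF Y] by (intro nn_integral_eq_integral) auto
    also have "\<dots> \<le> ennreal (C * m * q ^ n)"
    proof (rule ennreal_leI)
      have "(LINT s|M. norm (Y n s)) \<le> l2norm M (Y n) * m"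
        using sq_integrable_integrable(2)[OF Y] by (simp add: m_def)
      also have "\<dots> \<le> (C * q ^ n) * m"
        using step[of n] by (intro mult_right_mono) (auto simp: Y_def[abs_def] m_def)
      finally show "(LINT s|M. norm (Y n s)) \<le> C * m * q ^ n" by (simp add: mult_ac)
    qed
    finally show ?thesis .
  qed
  have "(\<integral>\<^sup>+ s. (\<Sum>n. ennreal (norm (Y n s))) \<partial>M) = (\<Sum>n. \<integral>\<^sup>+ s. ennreal (norm (Y n s)) \<partial>M)"
    by (rule nn_integral_suminf) auto
  also have "\<dots> \<le> (\<Sum>n. ennreal (C * m * q ^ n))"
    by (intro suminf_le nnY summableI)
  also have "\<dots> = ennreal (\<Sum>n. C * m * q ^ n)"
    using q C by (intro suminf_ennreal2 summable_mult summable_geometric) (auto simp: m_def)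
  also have "\<dots> < \<infinity>" by simp
  finally have fin: "(\<integral>\<^sup>+ s. (\<Sum>n. ennreal (norm (Y n s))) \<partial>M) \<noteq> \<infinity>" by simp
  have "AE s in M. (\<Sum>n. ennreal (norm (Y n s))) \<noteq> \<infinity>"
    by (rule nn_integral_PInf_AE[OF _ fin]) auto
  then have conv: "AE s in M. convergent (\<lambda>n. X n s)"
  proof eventually_elim
    case (elim s)
    have "summable (\<lambda>n. norm (Y n s))"
      using elim by (intro summable_suminf_not_top) auto
    then have "summable (\<lambda>n. Y n s)" by (rule summable_norm_cancel)
    then have "summable (\<lambda>n. X (Suc n) s - X n s)" by (simp add: Y_def)
    then have "convergent (\<lambda>n. X n s - X 0 s)"
      by (simp add: summable_iff_convergent sum_lessThan_telescope[of "\<lambda>n. X n s"])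
    then have "convergent (\<lambda>n. (X n s - X 0 s) + X 0 s)"
      by (intro convergent_add convergent_const)
    then show ?case by simp
  qed
  define x where "x s = lim (\<lambda>n. X n s)" for s
  have [measurable]: "x \<in> borel_measurable M" unfolding x_def by measurable
  define D where "D n = C * q ^ n / (1 - q)" for n
  have D0: "0 \<le> D n" for n using q C by (auto simp: D_def)
  have XX: "l2norm M (\<lambda>s. X (n + k) s - X n s) \<le> D n" for n k
  proof -
    have "l2norm M (\<lambda>s. X (n + k) s - X n s) \<le> (\<Sum>i<k. C * q ^ (n + i))"
    proof (induction k)
      case 0 then show ?case by (simp add: l2norm_def)
    next
      case (Suc k)
      show ?case
        using l2norm_triangle_via[OF X[of "n + Suc k"] X[of "n + k"] X[of n]] step[of "n + k"] Suc by simp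
    qed
    also have "\<dots> = C * q ^ n * (\<Sum>i<k. q ^ i)" by (simp add: power_add sum_distrib_left mult_ac)
    also have "\<dots> \<le> C * q ^ n * (1 / (1 - q))"
    proof (rule mult_left_mono)
      have "(\<Sum>i<k. q ^ i) \<le> (\<Sum>i. q ^ i)" using q by (intro sum_le_suminf summable_geometric) auto
      then show "(\<Sum>i<k. q ^ i) \<le> 1 / (1 - q)" using q by (simp add: suminf_geometric)
    qed (use q C in auto)
    finally show ?thesis by (simp add: D_def)
  qed
  have nn: "(\<integral>\<^sup>+ s. ennreal ((norm (X n s - x s))\<^sup>2) \<partial>M) \<le> ennreal ((D n)\<^sup>2)" for n
  proof -
    have "AE s in M. ennreal ((norm (X n s - x s))\<^sup>2)
        = liminf (\<lambda>k. ennreal ((norm (X (n + k) s - X n s))\<^sup>2))"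
      using conv
    proof eventually_elim
      case (elim s)
      then have "(\<lambda>k. X k s) \<longlonglongrightarrow> x s" unfolding x_def by (simp add: convergent_LIMSEQ_iff)
      then have "(\<lambda>k. X (k + n) s) \<longlonglongrightarrow> x s" by (rule LIMSEQ_ignore_initial_segment)
      then have "(\<lambda>k. ennreal ((norm (X (n + k) s - X n s))\<^sup>2)) \<longlonglongrightarrow> ennreal ((norm (x s - X n s))\<^sup>2)"
        by (intro tendsto_intros) (simp add: add.commute)
      from lim_imp_Liminf[OF sequentially_bot this] show ?case
        by (simp add: norm_minus_commute)
    qed
    then have "(\<integral>\<^sup>+ s. ennreal ((norm (X n s - x s))\<^sup>2) \<partial>M)
        = (\<integral>\<^sup>+ s. liminf (\<lambda>k. ennreal ((norm (X (n + k) s - X n s))\<^sup>2)) \<partial>M)"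
      by (rule nn_integral_cong_AE)
    also have "\<dots> \<le> liminf (\<lambda>k. \<integral>\<^sup>+ s. ennreal ((norm (X (n + k) s - X n s))\<^sup>2) \<partial>M)"
      by (rule nn_integral_liminf) measurable
    also have "\<dots> \<le> liminf (\<lambda>k::nat. ennreal ((D n)\<^sup>2))"
    proof (rule Liminf_mono, rule always_eventually, rule allI)
      fix k
      have "(\<integral>\<^sup>+ s. ennreal ((norm (X (n + k) s - X n s))\<^sup>2) \<partial>M)
          = ennreal ((l2norm M (\<lambda>s. X (n + k) s - X n s))\<^sup>2)"
        unfolding l2norm_power2
        using sq_integrableD[OF sq_integrable_diff[OF X X]] by (intro nn_integral_eq_integral) auto
      also have "\<dots> \<le> ennreal ((D n)\<^sup>2)"
        using XX[of n k] by (intro ennreal_leI power_mono) auto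
      finally show "(\<integral>\<^sup>+ s. ennreal ((norm (X (n + k) s - X n s))\<^sup>2) \<partial>M) \<le> ennreal ((D n)\<^sup>2)" .
    qed
    finally show ?thesis by (simp add: Liminf_const)
  qed
  have sq: "sq_integrable M (\<lambda>s. X n s - x s)" for n
    unfolding sq_integrable_def integrable_iff_bounded using nn[of n]
    by (auto intro: le_less_trans)
  have bd: "l2norm M (\<lambda>s. X n s - x s) \<le> D n" for n
  proof (rule l2norm_leI[OF D0])
    have "ennreal (LINT s|M. (norm (X n s - x s))\<^sup>2) \<le> ennreal ((D n)\<^sup>2)"
      using nn[of n] sq_integrableD[OF sq[of n]] by (subst (asm) nn_integral_eq_integral) auto
    then show "(LINT s|M. (norm (X n s - x s))\<^sup>2) \<le> (D n)\<^sup>2" by simp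
  qed
  show thesis
  proof
    show "sq_integrable M x" using sq_integrable_diff[OF X[of 0] sq[of 0]] by simp
    have "D \<longlonglongrightarrow> C * 0 / (1 - q)"
      unfolding D_def using q by (intro tendsto_intros LIMSEQ_power_zero) auto
    then have "D \<longlonglongrightarrow> 0" by simp
    then show "(\<lambda>n. l2norm M (\<lambda>s. X n s - x s)) \<longlonglongrightarrow> 0"
      by (rule tendsto_sandwich[OF _ _ tendsto_const, rotated -1]) (use bd in auto)
  qed
qed

section \<open>Integral operators with square-integrable kernels\<close>

text \<open>A function that is measurable in its first and continuous in its second argument may be composed
with a measurable function: approximate the latter by functions with finite range.\<close>

lemma measurable_caratheodory:
  fixes F :: "'a \<Rightarrow> 'x::euclidean_space \<Rightarrow> 'c::euclidean_space"
  assumes F: "\<And>x. (\<lambda>a. F a x) \<in> borel_measurable M"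
    and cont: "\<And>a. a \<in> space M \<Longrightarrow> continuous_on UNIV (F a)"
    and g: "g \<in> borel_measurable M"
  shows "(\<lambda>a. F a (g a)) \<in> borel_measurable M"
proof -
  obtain S where S: "\<And>i. simple_function M (S i)"
    and lim: "\<And>a. a \<in> space M \<Longrightarrow> (\<lambda>i. S i a) \<longlonglongrightarrow> g a"
    using borel_measurable_implies_sequence_metric[OF g, of 0] by metis
  show ?thesis
  proof (rule borel_measurable_LIMSEQ_metric)
    fix i
    show "(\<lambda>a. F a (S i a)) \<in> borel_measurable M"
    proof (rule measurable_compose_countable'[where I = "S i ` space M" and f = "\<lambda>x a. F a x"])
      show "S i \<in> measurable M (count_space (S i ` space M))"
        using measurable_simple_function[OF S] by (auto simp: measurable_count_space_eq1 measurable_def)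
      show "countable (S i ` space M)"
        using S by (auto simp: simple_function_def intro: countable_finite)
    qed (rule F)
  next
    fix a assume a: "a \<in> space M"
    show "(\<lambda>i. F a (S i a)) \<longlonglongrightarrow> F a (g a)"
      by (rule continuous_on_tendsto_compose[OF cont[OF a] lim[OF a]]) auto
  qed
qed

lemma lipschitz_continuous_on_UNIV:
  fixes F :: "'x::real_normed_vector \<Rightarrow> 'c::real_normed_vector"
  assumes "\<And>x y. norm (F x - F y) \<le> C * norm (x - y)"
  shows "continuous_on UNIV F"
proof (rule lipschitz_on_continuous_on)
  show "\<bar>C\<bar>-lipschitz_on UNIV F"
  proof (rule lipschitz_onI)
    show "dist (F x) (F y) \<le> \<bar>C\<bar> * dist x y" for x y
      using assms[of x y] mult_right_mono[OF abs_ge_self[of C], of "norm (x - y)"]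
      by (simp add: dist_norm)
  qed simp
qed

definition kint :: "'a measure \<Rightarrow> ('a \<Rightarrow> 'a \<Rightarrow> 'c::euclidean_space) \<Rightarrow> 'a \<Rightarrow> 'c" where
  "kint M k \<xi> = (LINT s|M. k \<xi> s)"

text \<open>One predicate for all that a kernel needs: joint measurability, integrable sections, and a bound \<open>c\<close>
on the $L_2$ norm of the function obtained by integrating out the second variable. Estimates
of sums of kernels then reduce to adding the bounds.\<close>

definition l2_kernel :: "'a measure \<Rightarrow> ('a \<Rightarrow> 'a \<Rightarrow> 'c::euclidean_space) \<Rightarrow> real \<Rightarrow> bool" where
  "l2_kernel M k c \<longleftrightarrow>
     (\<lambda>p. k (fst p) (snd p)) \<in> borel_measurable (M \<Otimes>\<^sub>M M) \<and>
     (AE \<xi> in M. integrable M (k \<xi>)) \<and> sq_integrable M (kint M k) \<and> l2norm M (kint M k) \<le> c"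

lemma l2_kernelD:
  assumes "l2_kernel M k c"
  shows "(\<lambda>p. k (fst p) (snd p)) \<in> borel_measurable (M \<Otimes>\<^sub>M M)" "AE \<xi> in M. integrable M (k \<xi>)"
    "sq_integrable M (kint M k)" "l2norm M (kint M k) \<le> c"
  using assms by (auto simp: l2_kernel_def)

lemma (in sigma_finite_measure) kint_measurable:
  fixes k :: "'b \<Rightarrow> 'a \<Rightarrow> 'c::euclidean_space"
  assumes "(\<lambda>p. k (fst p) (snd p)) \<in> borel_measurable (N \<Otimes>\<^sub>M M)"
  shows "(\<lambda>\<xi>. LINT s|M. k \<xi> s) \<in> borel_measurable N"
proof (rule borel_measurable_lebesgue_integral)
  show "(\<lambda>(x, y). k x y) \<in> borel_measurable (N \<Otimes>\<^sub>M M)" using assms by (simp add: split_beta')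
qed

lemma kint_scaleR_add_AE:
  assumes k: "l2_kernel M k c" and h: "l2_kernel M h d"
  shows "AE \<xi> in M. kint M (\<lambda>\<xi> s. k \<xi> s + r *\<^sub>R h \<xi> s) \<xi> = kint M k \<xi> + r *\<^sub>R kint M h \<xi>"
  using l2_kernelD(2)[OF k] l2_kernelD(2)[OF h]
  by eventually_elim (simp add: kint_def)

lemma (in finite_measure) l2_kernel_scaleR_add:
  assumes k: "l2_kernel M k c" and h: "l2_kernel M h d"
  shows "l2_kernel M (\<lambda>\<xi> s. k \<xi> s + r *\<^sub>R h \<xi> s) (c + \<bar>r\<bar> * d)"
proof -
  note [measurable] = l2_kernelD(1)[OF k] l2_kernelD(1)[OF h]
  have m: "(\<lambda>p. k (fst p) (snd p) + r *\<^sub>R h (fst p) (snd p)) \<in> borel_measurable (M \<Otimes>\<^sub>M M)"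
    by measurable
  have i: "AE \<xi> in M. integrable M (\<lambda>s. k \<xi> s + r *\<^sub>R h \<xi> s)"
    using l2_kernelD(2)[OF k] l2_kernelD(2)[OF h] by eventually_elim simp
  note sk = l2_kernelD(3)[OF k] and sh = sq_integrable_scaleR[OF l2_kernelD(3)[OF h], of r]
  have km: "kint M (\<lambda>\<xi> s. k \<xi> s + r *\<^sub>R h \<xi> s) \<in> borel_measurable M"
    unfolding kint_def[abs_def] by (rule kint_measurable) (rule m)
  have ae: "AE \<xi> in M. norm (kint M (\<lambda>\<xi> s. k \<xi> s + r *\<^sub>R h \<xi> s) \<xi>) \<le> norm (kint M k \<xi> + r *\<^sub>R kint M h \<xi>)"
    using kint_scaleR_add_AE[OF k h, of r] by eventually_elim simp
  note b = sq_integrable_bound[OF sq_integrable_add[OF sk sh] km ae]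
  have "l2norm M (\<lambda>\<xi>. kint M k \<xi> + r *\<^sub>R kint M h \<xi>) \<le> c + \<bar>r\<bar> * d"
    using l2norm_triangle[OF sk sh] l2_kernelD(4)[OF k] mult_left_mono[OF l2_kernelD(4)[OF h], of "\<bar>r\<bar>"]
    by (simp add: l2norm_scaleR)
  with b m i show ?thesis unfolding l2_kernel_def by auto
qed

lemma (in finite_measure) l2_kernel_add:
  "l2_kernel M k c \<Longrightarrow> l2_kernel M h d \<Longrightarrow> l2_kernel M (\<lambda>\<xi> s. k \<xi> s + h \<xi> s) (c + d)"
  using l2_kernel_scaleR_add[of k c h d 1] by simp

lemma kint_diff_AE:
  assumes k: "l2_kernel M k c" and h: "l2_kernel M h d"
  shows "AE \<xi> in M. kint M (\<lambda>\<xi> s. k \<xi> s - h \<xi> s) \<xi> = kint M k \<xi> - kint M h \<xi>"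
  using kint_scaleR_add_AE[OF k h, of "-1"] by simp

text \<open>The Hilbert-Schmidt estimate, in a form that allows for kernels that are merely dominated by a product.
The estimates of the individual terms of the equation differ only in the choice of \<open>a\<close> and \<open>g\<close>.\<close>

lemma (in finite_measure) l2_kernel_dominated:
  fixes k :: "'a \<Rightarrow> 'a \<Rightarrow> 'c::euclidean_space" and g :: "'a \<Rightarrow> 'd::euclidean_space"
    and a :: "'a \<Rightarrow> 'a \<Rightarrow> 'e::euclidean_space"
  assumes k[measurable]: "(\<lambda>p. k (fst p) (snd p)) \<in> borel_measurable (M \<Otimes>\<^sub>M M)"
    and a: "sq_integrable (M \<Otimes>\<^sub>M M) (\<lambda>p. a (fst p) (snd p))"
    and g: "sq_integrable M g"
    and le: "\<And>\<xi> s. \<xi> \<in> space M \<Longrightarrow> s \<in> space M \<Longrightarrow> norm (k \<xi> s) \<le> norm (a \<xi> s) * norm (g s)"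
  shows "l2_kernel M k (l2norm (M \<Otimes>\<^sub>M M) (\<lambda>p. a (fst p) (snd p)) * l2norm M g)"
proof -
  interpret P: pair_sigma_finite M M ..
  note [measurable] = sq_integrable_measurable[OF a] sq_integrable_measurable[OF g]
  define A where "A \<xi> = (LINT s|M. (norm (a \<xi> s))\<^sup>2)" for \<xi>
  have sec: "AE \<xi> in M. integrable M (\<lambda>s. (norm (a \<xi> s))\<^sup>2)"
    using P.AE_integrable_fst'[OF sq_integrableD[OF a]] by simp
  have Ai: "integrable M A"
    using P.integrable_fst'[OF sq_integrableD[OF a]] by (simp add: A_def[abs_def])
  have AI: "(LINT \<xi>|M. A \<xi>) = (l2norm (M \<Otimes>\<^sub>M M) (\<lambda>p. a (fst p) (snd p)))\<^sup>2"
    using P.integral_fst'[OF sq_integrableD[OF a]] by (simp add: A_def l2norm_power2)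
  have A0: "0 \<le> A \<xi>" for \<xi> by (simp add: A_def)
  have *: "AE \<xi> in M. integrable M (k \<xi>) \<and> (norm (kint M k \<xi>))\<^sup>2 \<le> A \<xi> * (l2norm M g)\<^sup>2"
    using sec AE_space
  proof eventually_elim
    case (elim \<xi>)
    have ma: "a \<xi> \<in> borel_measurable M" 
      using measurable_compose[OF measurable_Pair1'[OF elim(2)] sq_integrable_measurable[OF a]] by simp
    have mk: "k \<xi> \<in> borel_measurable M"
      using measurable_compose[OF measurable_Pair1'[OF elim(2)] k] by simp
    have sa: "sq_integrable M (a \<xi>)" using elim ma by (simp add: sq_integrable_def)
    note cs = cauchy_schwarz_l2[OF sa g]
    have ik: "integrable M (k \<xi>)"
      by (rule Bochner_Integration.integrable_bound[OF cs(1) mk]) (use le elim in auto)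
    have "norm (kint M k \<xi>) \<le> (LINT s|M. norm (k \<xi> s))"
      unfolding kint_def by (rule integral_norm_bound)
    also have "\<dots> \<le> (LINT s|M. norm (a \<xi> s) * norm (g s))"
      by (rule integral_mono[OF integrable_norm[OF ik] cs(1)]) (use le elim in auto)
    also have "\<dots> \<le> l2norm M (a \<xi>) * l2norm M g" by (rule cs)
    finally have "(norm (kint M k \<xi>))\<^sup>2 \<le> (l2norm M (a \<xi>) * l2norm M g)\<^sup>2"
      by (rule power_mono) simp
    also have "\<dots> = A \<xi> * (l2norm M g)\<^sup>2"
      by (simp add: power_mult_distrib l2norm_power2[of M "a \<xi>"] A_def)
    finally show ?case using ik by blast
  qed
  have km: "kint M k \<in> borel_measurable M"
    unfolding kint_def[abs_def] by (rule kint_measurable) (rule k)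
  have i2: "integrable M (\<lambda>\<xi>. A \<xi> * (l2norm M g)\<^sup>2)" using Ai by simp
  have ii: "integrable M (\<lambda>\<xi>. (norm (kint M k \<xi>))\<^sup>2)"
    by (rule Bochner_Integration.integrable_bound[OF i2]) (use km * A0 in \<open>auto simp: abs_mult\<close>)
  have "l2norm M (kint M k) \<le> l2norm (M \<Otimes>\<^sub>M M) (\<lambda>p. a (fst p) (snd p)) * l2norm M g"
  proof (rule l2norm_leI)
    have "(LINT \<xi>|M. (norm (kint M k \<xi>))\<^sup>2) \<le> (LINT \<xi>|M. A \<xi> * (l2norm M g)\<^sup>2)"
      by (rule integral_mono_AE[OF ii i2]) (use * in auto)
    then show "(LINT \<xi>|M. (norm (kint M k \<xi>))\<^sup>2)
        \<le> (l2norm (M \<Otimes>\<^sub>M M) (\<lambda>p. a (fst p) (snd p)) * l2norm M g)\<^sup>2"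
      by (simp add: AI power_mult_distrib)
  qed simp
  then show ?thesis unfolding l2_kernel_def sq_integrable_def using k km ii * by auto
qed

lemma l2_kernel_mono: "l2_kernel M k c \<Longrightarrow> c \<le> d \<Longrightarrow> l2_kernel M k d"
  by (auto simp: l2_kernel_def)

text \<open>Cauchy-Schwarz in every row; the norm of a matrix is its Frobenius norm.\<close>

lemma norm_matrix_vector_mult_le:
  fixes A :: "real ^ 'm ^ 'n" and v :: "real ^ 'm"
  shows "norm (A *v v) \<le> norm A * norm v"
proof -
  have "norm (A *v v) = L2_set (\<lambda>i. \<bar>(A *v v) $ i\<bar>) UNIV"
    by (simp add: norm_vec_def)
  also have "\<dots> \<le> L2_set (\<lambda>i. norm (A $ i) * norm v) UNIV"
  proof (rule L2_set_mono)
    show "\<bar>(A *v v) $ i\<bar> \<le> norm (A $ i) * norm v" for i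
      using Cauchy_Schwarz_ineq2[of "A $ i" v] by (simp add: matrix_vector_mul_component)
  qed simp
  also have "\<dots> = norm A * norm v"
    unfolding norm_vec_def[of A] by (simp add: L2_set_left_distrib)
  finally show ?thesis .
qed

lemma measurable_matrix_vector_mult[measurable (raw)]:
  fixes A :: "'a \<Rightarrow> real ^ 'm ^ 'n" and v :: "'a \<Rightarrow> real ^ 'm"
  assumes "A \<in> borel_measurable M" "v \<in> borel_measurable M"
  shows "(\<lambda>a. A a *v v a) \<in> borel_measurable M"
proof -
  have "continuous_on UNIV (\<lambda>p :: (real ^ 'm ^ 'n) \<times> (real ^ 'm). fst p *v snd p)"
    unfolding matrix_vector_mult_def by (intro continuous_intros continuous_on_vec_lambda)
  from borel_measurable_continuous_on[OF this borel_measurable_Pair[OF assms]] show ?thesis by simp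
qed

lemma (in finite_measure) matrix_kernel:
  fixes A :: "'a \<Rightarrow> 'a \<Rightarrow> real ^ 'm ^ 'n"
  assumes A: "sq_integrable (M \<Otimes>\<^sub>M M) (\<lambda>p. A (fst p) (snd p))" and u: "sq_integrable M u"
  shows "l2_kernel M (\<lambda>\<xi> s. A \<xi> s *v u s) (l2norm (M \<Otimes>\<^sub>M M) (\<lambda>p. A (fst p) (snd p)) * l2norm M u)"
proof (rule l2_kernel_dominated[OF _ A u])
  note [measurable] = sq_integrable_measurable[OF A] sq_integrable_measurable[OF u]
  show "(\<lambda>p. A (fst p) (snd p) *v u (snd p)) \<in> borel_measurable (M \<Otimes>\<^sub>M M)" by measurable
qed (rule norm_matrix_vector_mult_le)

lemma (in finite_measure) sq_integrable_snd:
  fixes g :: "'a \<Rightarrow> 'b::euclidean_space"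
  assumes g: "sq_integrable M g"
  shows "sq_integrable (M \<Otimes>\<^sub>M M) (\<lambda>p. g (snd p))"
    and "l2norm (M \<Otimes>\<^sub>M M) (\<lambda>p. g (snd p)) = sqrt (measure M (space M)) * l2norm M g"
proof -
  interpret P: pair_sigma_finite M M ..
  note [measurable] = sq_integrable_measurable[OF g]
  have i: "integrable (M \<Otimes>\<^sub>M M) (\<lambda>(\<xi>, s). (norm (g s))\<^sup>2)"
    by (rule P.Fubini_integrable) (use sq_integrableD[OF g] in \<open>auto simp: integrable_const\<close>)
  then show "sq_integrable (M \<Otimes>\<^sub>M M) (\<lambda>p. g (snd p))"
    by (auto simp: sq_integrable_def split_beta')
  show "l2norm (M \<Otimes>\<^sub>M M) (\<lambda>p. g (snd p)) = sqrt (measure M (space M)) * l2norm M g"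
    using P.integral_fst'[OF i] by (simp add: l2norm_def split_beta' flip: real_sqrt_mult)
qed

section \<open>Trajectories of a Lipschitz system\<close>

text \<open>The setting of the theorem after regularisation: the Lipschitz estimates hold everywhere on the space
and the kernels are measurable for the product sigma-algebra, which, unlike the Lebesgue
sigma-algebra of the product space, has measurable sections.\<close>

locale lipschitz_system = finite_measure M for M :: "'a measure" +
  fixes f :: "'a \<Rightarrow> real ^ 'n \<Rightarrow> real ^ 'n"
    and K1 :: "'a \<Rightarrow> 'a \<Rightarrow> real ^ 'n \<Rightarrow> real ^ 'n"
    and K2 :: "'a \<Rightarrow> 'a \<Rightarrow> real ^ 'n \<Rightarrow> real ^ 'm ^ 'n"
    and \<gamma>1 :: "'a \<Rightarrow> 'a \<Rightarrow> real"
    and lam \<rho> \<kappa>0 \<kappa>1 \<kappa>2 :: real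
  assumes lam: "0 < lam" and \<rho>: "0 \<le> \<rho>" and \<kappa>: "0 \<le> \<kappa>0" "0 \<le> \<kappa>1" "0 \<le> \<kappa>2"
    and f_meas: "\<And>x. (\<lambda>\<xi>. f \<xi> x) \<in> borel_measurable M"
    and f_0: "sq_integrable M (\<lambda>\<xi>. f \<xi> 0)"
    and f_lip: "\<And>\<xi> x y. \<xi> \<in> space M \<Longrightarrow> norm (f \<xi> x - f \<xi> y) \<le> \<kappa>0 * norm (x - y)"
    and K1_meas: "\<And>x. (\<lambda>p. K1 (fst p) (snd p) x) \<in> borel_measurable (M \<Otimes>\<^sub>M M)"
    and K1_0: "sq_integrable (M \<Otimes>\<^sub>M M) (\<lambda>p. K1 (fst p) (snd p) 0)"
    and \<gamma>1: "sq_integrable (M \<Otimes>\<^sub>M M) (\<lambda>p. \<gamma>1 (fst p) (snd p))"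
    and \<gamma>1_le: "l2norm (M \<Otimes>\<^sub>M M) (\<lambda>p. \<gamma>1 (fst p) (snd p)) \<le> \<kappa>1"
    and K1_lip: "\<And>\<xi> s x y. \<xi> \<in> space M \<Longrightarrow> s \<in> space M \<Longrightarrow>
                   norm (K1 \<xi> s x - K1 \<xi> s y) \<le> \<gamma>1 \<xi> s * norm (x - y)"
    and K2_meas: "\<And>x. (\<lambda>p. K2 (fst p) (snd p) x) \<in> borel_measurable (M \<Otimes>\<^sub>M M)"
    and K2_0: "sq_integrable (M \<Otimes>\<^sub>M M) (\<lambda>p. K2 (fst p) (snd p) 0)"
    and K2_lip: "\<And>\<xi> s x y. \<xi> \<in> space M \<Longrightarrow> s \<in> space M \<Longrightarrow>
                   norm (K2 \<xi> s x - K2 \<xi> s y) \<le> \<kappa>2 * norm (x - y)"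
    and small: "6 * (\<kappa>0\<^sup>2 + lam\<^sup>2 * \<kappa>1\<^sup>2 + lam\<^sup>2 * \<rho>\<^sup>2 * \<kappa>2\<^sup>2 * measure M (space M)) < 1"
begin

definition ctrl :: "('a \<Rightarrow> real ^ 'm) \<Rightarrow> bool" where
  "ctrl u \<longleftrightarrow> sq_integrable M u \<and> l2norm M u \<le> \<rho>"

definition kern :: "('a \<Rightarrow> real ^ 'm) \<Rightarrow> ('a \<Rightarrow> real ^ 'n) \<Rightarrow> 'a \<Rightarrow> 'a \<Rightarrow> real ^ 'n" where
  "kern u x \<xi> s = K1 \<xi> s (x s) + K2 \<xi> s (x s) *v u s"

definition traj_map :: "('a \<Rightarrow> real ^ 'm) \<Rightarrow> ('a \<Rightarrow> real ^ 'n) \<Rightarrow> 'a \<Rightarrow> real ^ 'n" where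
  "traj_map u x \<xi> = f \<xi> (x \<xi>) + lam *\<^sub>R kint M (kern u x) \<xi>"

definition sol :: "('a \<Rightarrow> real ^ 'm) \<Rightarrow> ('a \<Rightarrow> real ^ 'n) \<Rightarrow> bool" where
  "sol u x \<longleftrightarrow> sq_integrable M x \<and> (AE \<xi> in M. x \<xi> = traj_map u x \<xi>)"

text \<open>The Lipschitz constant in \<open>x\<close> of the integrated control term \<open>K2 \<xi> s (x s) *v u s\<close>, uniformly in
controls of norm at most \<open>\<rho>\<close>.\<close>

definition lip_control :: real where "lip_control = \<kappa>2 * sqrt (measure M (space M)) * \<rho>"

lemma lip_control_nonneg: "0 \<le> lip_control" using \<kappa> \<rho> by (simp add: lip_control_def)

text \<open>Cauchy-Schwarz with weights \<open>(1, 1, 2)\<close>, whose squares add up to the factor 6 of the smallness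
condition. The weight 2 of the control term pays for comparing two trajectories with a third one in
\<open>traj_modulus_improve\<close>.\<close>

lemma weighted_sum_less_1: "\<kappa>0 + lam * \<kappa>1 + 2 * (lam * lip_control) < 1"
proof -
  define a b c where "a = \<kappa>0" and "b = lam * \<kappa>1" and "c = lam * lip_control"
  have "6 * (a\<^sup>2 + b\<^sup>2 + c\<^sup>2) < 1"
    using small by (simp add: a_def b_def c_def lip_control_def power_mult_distrib mult_ac)
  moreover have "(a + b + 2 * c)\<^sup>2 \<le> 6 * (a\<^sup>2 + b\<^sup>2 + c\<^sup>2)"
  proof -
    have "6 * (a\<^sup>2 + b\<^sup>2 + c\<^sup>2) - (a + b + 2 * c)\<^sup>2 = (a - b)\<^sup>2 + (2 * a - c)\<^sup>2 + (2 * b - c)\<^sup>2"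
      by (simp add: power2_eq_square algebra_simps)
    then show ?thesis by (smt (verit) zero_le_power2)
  qed
  ultimately have "(a + b + 2 * c)\<^sup>2 < 1\<^sup>2" by simp
  then have "a + b + 2 * c < 1" by (rule power_less_imp_less_base) simp
  then show ?thesis by (simp add: a_def b_def c_def)
qed

lemma f_comp_meas:
  assumes "x \<in> borel_measurable M" shows "(\<lambda>\<xi>. f \<xi> (x \<xi>)) \<in> borel_measurable M"
  by (rule measurable_caratheodory[OF f_meas _ assms]) (blast intro: lipschitz_continuous_on_UNIV f_lip)

lemma K1_comp_meas:
  assumes [measurable]: "x \<in> borel_measurable M"
  shows "(\<lambda>p. K1 (fst p) (snd p) (x (snd p))) \<in> borel_measurable (M \<Otimes>\<^sub>M M)"
proof (rule measurable_caratheodory[OF K1_meas])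
  show "continuous_on UNIV (K1 (fst p) (snd p))" if "p \<in> space (M \<Otimes>\<^sub>M M)" for p
    using that by (intro lipschitz_continuous_on_UNIV[of _ "\<gamma>1 (fst p) (snd p)"] K1_lip) (auto simp: space_pair_measure)
qed measurable

lemma K2_comp_meas:
  assumes [measurable]: "x \<in> borel_measurable M"
  shows "(\<lambda>p. K2 (fst p) (snd p) (x (snd p))) \<in> borel_measurable (M \<Otimes>\<^sub>M M)"
proof (rule measurable_caratheodory[OF K2_meas])
  show "continuous_on UNIV (K2 (fst p) (snd p))" if "p \<in> space (M \<Otimes>\<^sub>M M)" for p
    using that by (intro lipschitz_continuous_on_UNIV[of _ "\<kappa>2"] K2_lip) (auto simp: space_pair_measure)
qed measurable

lemma f_comp_diff:
  assumes x: "sq_integrable M x" and y: "sq_integrable M y"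
  shows "sq_integrable M (\<lambda>\<xi>. f \<xi> (x \<xi>) - f \<xi> (y \<xi>))"
    and "l2norm M (\<lambda>\<xi>. f \<xi> (x \<xi>) - f \<xi> (y \<xi>)) \<le> \<kappa>0 * l2norm M (\<lambda>\<xi>. x \<xi> - y \<xi>)"
proof -
  note [measurable] = f_comp_meas[OF sq_integrable_measurable[OF x]]
    f_comp_meas[OF sq_integrable_measurable[OF y]]
  have d: "sq_integrable M (\<lambda>\<xi>. \<kappa>0 *\<^sub>R (x \<xi> - y \<xi>))"
    by (intro sq_integrable_scaleR sq_integrable_diff x y)
  have le: "AE \<xi> in M. norm (f \<xi> (x \<xi>) - f \<xi> (y \<xi>)) \<le> norm (\<kappa>0 *\<^sub>R (x \<xi> - y \<xi>))"
    using AE_space by eventually_elim (use f_lip \<kappa> in auto)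
  have m: "(\<lambda>\<xi>. f \<xi> (x \<xi>) - f \<xi> (y \<xi>)) \<in> borel_measurable M" by measurable
  note b = sq_integrable_bound[OF d m le]
  show "sq_integrable M (\<lambda>\<xi>. f \<xi> (x \<xi>) - f \<xi> (y \<xi>))" by (rule b)
  show "l2norm M (\<lambda>\<xi>. f \<xi> (x \<xi>) - f \<xi> (y \<xi>)) \<le> \<kappa>0 * l2norm M (\<lambda>\<xi>. x \<xi> - y \<xi>)"
    using b(2) \<kappa> by (simp add: l2norm_scaleR)
qed

lemma K1_diff_kernel:
  assumes x: "sq_integrable M x" and y: "sq_integrable M y"
  shows "l2_kernel M (\<lambda>\<xi> s. K1 \<xi> s (x s) - K1 \<xi> s (y s)) (\<kappa>1 * l2norm M (\<lambda>s. x s - y s))"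
proof -
  note [measurable] = K1_comp_meas[OF sq_integrable_measurable[OF x]]
    K1_comp_meas[OF sq_integrable_measurable[OF y]]
  have "l2_kernel M (\<lambda>\<xi> s. K1 \<xi> s (x s) - K1 \<xi> s (y s))
      (l2norm (M \<Otimes>\<^sub>M M) (\<lambda>p. \<gamma>1 (fst p) (snd p)) * l2norm M (\<lambda>s. x s - y s))"
  proof (rule l2_kernel_dominated[OF _ \<gamma>1 sq_integrable_diff[OF x y]])
    fix \<xi> s assume "\<xi> \<in> space M" "s \<in> space M"
    from K1_lip[OF this] show "norm (K1 \<xi> s (x s) - K1 \<xi> s (y s)) \<le> norm (\<gamma>1 \<xi> s) * norm (x s - y s)"
      by (rule order_trans) (auto intro: mult_right_mono)
  qed measurable
  then show ?thesis
    by (rule l2_kernel_mono) (intro mult_right_mono \<gamma>1_le, simp)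
qed

text \<open>The kernel frozen along a square-integrable function is square-integrable; this makes
\<open>weak_to_strong_sq_integrable\<close> applicable to it.\<close>

lemma K2_comp_sq_integrable:
  assumes w: "sq_integrable M w"
  shows "sq_integrable (M \<Otimes>\<^sub>M M) (\<lambda>p. K2 (fst p) (snd p) (w (snd p)))"
proof (rule sq_integrable_bound(1))
  let ?h = "\<lambda>p. norm (K2 (fst p) (snd p) 0) + \<kappa>2 *\<^sub>R norm (w (snd p))"
  show "sq_integrable (M \<Otimes>\<^sub>M M) ?h"
    by (intro sq_integrable_add sq_integrable_scaleR sq_integrable_norm K2_0 sq_integrable_snd w)
  show "(\<lambda>p. K2 (fst p) (snd p) (w (snd p))) \<in> borel_measurable (M \<Otimes>\<^sub>M M)"
    by (rule K2_comp_meas[OF sq_integrable_measurable[OF w]])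
  show "AE p in M \<Otimes>\<^sub>M M. norm (K2 (fst p) (snd p) (w (snd p))) \<le> norm (?h p)"
    using AE_space
  proof eventually_elim
    case (elim p)
    then have "norm (K2 (fst p) (snd p) (w (snd p)) - K2 (fst p) (snd p) 0) \<le> \<kappa>2 * norm (w (snd p))"
      using K2_lip[of "fst p" "snd p" "w (snd p)" 0] by (auto simp: space_pair_measure)
    then show ?case
      using norm_triangle_sub[of "K2 (fst p) (snd p) (w (snd p))" "K2 (fst p) (snd p) 0"] by simp
  qed
qed

text \<open>Here the roles in the Hilbert-Schmidt estimate are \<open>a = K2 \<xi> s (x s) - K2 \<xi> s (y s)\<close> and \<open>g = u\<close>:
the Lipschitz bound by a constant makes \<open>a\<close> square-integrable on the product, at the price of the factor
\<open>sqrt (measure M (space M))\<close>.\<close>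

lemma K2_diff_kernel:
  assumes x: "sq_integrable M x" and y: "sq_integrable M y" and u: "ctrl u"
  shows "l2_kernel M (\<lambda>\<xi> s. K2 \<xi> s (x s) *v u s - K2 \<xi> s (y s) *v u s) (lip_control * l2norm M (\<lambda>s. x s - y s))"
proof -
  let ?A = "\<lambda>\<xi> s. K2 \<xi> s (x s) - K2 \<xi> s (y s)" and ?d = "\<lambda>s. x s - y s"
  have us: "sq_integrable M u" "l2norm M u \<le> \<rho>" using u by (auto simp: ctrl_def)
  have A: "sq_integrable (M \<Otimes>\<^sub>M M) (\<lambda>p. ?A (fst p) (snd p))"
    by (intro sq_integrable_diff K2_comp_sq_integrable x y)
  note d = sq_integrable_diff[OF x y]
  have "l2norm (M \<Otimes>\<^sub>M M) (\<lambda>p. ?A (fst p) (snd p)) \<le> l2norm (M \<Otimes>\<^sub>M M) (\<lambda>p. \<kappa>2 *\<^sub>R ?d (snd p))"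
  proof (rule sq_integrable_bound(2))
    show "sq_integrable (M \<Otimes>\<^sub>M M) (\<lambda>p. \<kappa>2 *\<^sub>R ?d (snd p))"
      by (intro sq_integrable_scaleR sq_integrable_snd d)
    show "AE p in M \<Otimes>\<^sub>M M. norm (?A (fst p) (snd p)) \<le> norm (\<kappa>2 *\<^sub>R ?d (snd p))"
      using AE_space
    proof eventually_elim
      case (elim p)
      then show ?case using K2_lip[of "fst p" "snd p"] \<kappa> by (auto simp: space_pair_measure)
    qed
  qed (rule sq_integrable_measurable[OF A])
  also have "\<dots> = \<kappa>2 * (sqrt (measure M (space M)) * l2norm M ?d)"
    using \<kappa> sq_integrable_snd(2)[OF d] by (simp add: l2norm_scaleR)
  finally have "l2norm (M \<Otimes>\<^sub>M M) (\<lambda>p. ?A (fst p) (snd p)) * l2norm M u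
      \<le> \<kappa>2 * (sqrt (measure M (space M)) * l2norm M ?d) * \<rho>"
    by (rule mult_mono) (use us \<kappa> in auto)
  also have "\<dots> = lip_control * l2norm M ?d" by (simp add: lip_control_def mult_ac)
  finally have "l2_kernel M (\<lambda>\<xi> s. ?A \<xi> s *v u s) (lip_control * l2norm M ?d)"
    by (rule l2_kernel_mono[OF matrix_kernel[OF A us(1)]])
  then show ?thesis by (simp add: matrix_vector_mult_diff_rdistrib)
qed

lemma kern_0_kernel:
  assumes u: "ctrl u"
  shows "l2_kernel M (kern u (\<lambda>_. 0))
    (l2norm (M \<Otimes>\<^sub>M M) (\<lambda>p. K1 (fst p) (snd p) 0) * sqrt (measure M (space M))
      + l2norm (M \<Otimes>\<^sub>M M) (\<lambda>p. K2 (fst p) (snd p) 0) * \<rho>)"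
proof -
  have us: "sq_integrable M u" "l2norm M u \<le> \<rho>" using u by (auto simp: ctrl_def)
  have one: "sq_integrable M (\<lambda>_. 1::real)" by (rule sq_integrable_const) unfold_locales
  have "l2_kernel M (\<lambda>\<xi> s. K1 \<xi> s 0)
      (l2norm (M \<Otimes>\<^sub>M M) (\<lambda>p. K1 (fst p) (snd p) 0) * l2norm M (\<lambda>_. 1::real))"
    by (rule l2_kernel_dominated[OF _ K1_0 one]) (use K1_meas in auto)
  then have 1: "l2_kernel M (\<lambda>\<xi> s. K1 \<xi> s 0)
      (l2norm (M \<Otimes>\<^sub>M M) (\<lambda>p. K1 (fst p) (snd p) 0) * sqrt (measure M (space M)))"
    by (simp add: l2norm_const)
  have 2: "l2_kernel M (\<lambda>\<xi> s. K2 \<xi> s 0 *v u s) (l2norm (M \<Otimes>\<^sub>M M) (\<lambda>p. K2 (fst p) (snd p) 0) * \<rho>)"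
    by (rule l2_kernel_mono[OF matrix_kernel[OF K2_0 us(1)]]) (use us in \<open>auto intro: mult_left_mono\<close>)
  from l2_kernel_add[OF 1 2] show ?thesis by (simp add: kern_def[abs_def])
qed

lemma kern_diff_kernel:
  assumes x: "sq_integrable M x" and y: "sq_integrable M y" and u: "ctrl u"
  shows "l2_kernel M (\<lambda>\<xi> s. kern u x \<xi> s - kern u y \<xi> s) ((\<kappa>1 + lip_control) * l2norm M (\<lambda>s. x s - y s))"
  using l2_kernel_add[OF K1_diff_kernel[OF x y] K2_diff_kernel[OF x y u]]
  by (simp add: kern_def[abs_def] algebra_simps)

lemma kern_kernel:
  assumes x: "sq_integrable M x" and u: "ctrl u"
  obtains c where "l2_kernel M (kern u x) c"
proof -
  have z: "sq_integrable M (\<lambda>_. 0::real ^ 'n)" by (rule sq_integrable_const) unfold_locales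
  from l2_kernel_add[OF kern_diff_kernel[OF x z u] kern_0_kernel[OF u]] show thesis
    by (intro that) simp
qed

lemma traj_map_sq_integrable:
  assumes x: "sq_integrable M x" and u: "ctrl u"
  shows "sq_integrable M (traj_map u x)"
proof -
  have z: "sq_integrable M (\<lambda>_. 0::real ^ 'n)" by (rule sq_integrable_const) unfold_locales
  obtain c where c: "l2_kernel M (kern u x) c" by (rule kern_kernel[OF x u])
  from sq_integrable_add[OF sq_integrable_add[OF f_comp_diff(1)[OF x z] f_0]
      sq_integrable_scaleR[OF l2_kernelD(3)[OF c], of lam]]
  show ?thesis by (simp add: traj_map_def[abs_def])
qed

text \<open>Used twice: with equal controls it yields the contraction property, with different controls it
drives the improvement of the modulus.\<close>

lemma traj_map_diff_le:
  assumes x: "sq_integrable M x" and y: "sq_integrable M y" and u: "ctrl u" and v: "ctrl v"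
    and d: "l2_kernel M (\<lambda>\<xi> s. kern u x \<xi> s - kern v y \<xi> s) c"
  shows "l2norm M (\<lambda>\<xi>. traj_map u x \<xi> - traj_map v y \<xi>) \<le> \<kappa>0 * l2norm M (\<lambda>s. x s - y s) + lam * c"
proof -
  let ?D = "\<lambda>\<xi> s. kern u x \<xi> s - kern v y \<xi> s"
  obtain cx where cx: "l2_kernel M (kern u x) cx" by (rule kern_kernel[OF x u])
  obtain cy where cy: "l2_kernel M (kern v y) cy" by (rule kern_kernel[OF y v])
  note sk = sq_integrable_scaleR[OF l2_kernelD(3)[OF d], of lam]
  have "l2norm M (\<lambda>\<xi>. traj_map u x \<xi> - traj_map v y \<xi>)
      = l2norm M (\<lambda>\<xi>. (f \<xi> (x \<xi>) - f \<xi> (y \<xi>)) + lam *\<^sub>R kint M ?D \<xi>)"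
  proof (rule l2norm_cong_AE)
    show "(\<lambda>\<xi>. traj_map u x \<xi> - traj_map v y \<xi>) \<in> borel_measurable M"
      by (intro sq_integrable_measurable sq_integrable_diff traj_map_sq_integrable x y u v)
    show "(\<lambda>\<xi>. (f \<xi> (x \<xi>) - f \<xi> (y \<xi>)) + lam *\<^sub>R kint M ?D \<xi>) \<in> borel_measurable M"
      by (intro sq_integrable_measurable sq_integrable_add f_comp_diff(1) x y sk)
    show "AE \<xi> in M. traj_map u x \<xi> - traj_map v y \<xi> = (f \<xi> (x \<xi>) - f \<xi> (y \<xi>)) + lam *\<^sub>R kint M ?D \<xi>"
      using kint_diff_AE[OF cx cy] by eventually_elim (simp add: traj_map_def scaleR_diff_right)
  qed
  also have "\<dots> \<le> l2norm M (\<lambda>\<xi>. f \<xi> (x \<xi>) - f \<xi> (y \<xi>)) + l2norm M (\<lambda>\<xi>. lam *\<^sub>R kint M ?D \<xi>)"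
    by (rule l2norm_triangle[OF f_comp_diff(1)[OF x y] sk])
  also have "\<dots> \<le> \<kappa>0 * l2norm M (\<lambda>s. x s - y s) + lam * c"
    using f_comp_diff(2)[OF x y] l2_kernelD(4)[OF d] lam by (simp add: l2norm_scaleR mult_left_mono add_mono)
  finally show ?thesis .
qed

definition lip_traj :: real where "lip_traj = \<kappa>0 + lam * (\<kappa>1 + lip_control)"

lemma lip_traj_bounds: "0 \<le> lip_traj" "lip_traj < 1"
proof -
  have "0 \<le> lam * lip_control" "0 \<le> lam * \<kappa>1" using lip_control_nonneg \<kappa> lam by simp_all
  then show "0 \<le> lip_traj" "lip_traj < 1"
    using weighted_sum_less_1 \<kappa> by (simp_all add: lip_traj_def distrib_left)
qed

lemma traj_map_contraction:
  assumes x: "sq_integrable M x" and y: "sq_integrable M y" and u: "ctrl u"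
  shows "l2norm M (\<lambda>\<xi>. traj_map u x \<xi> - traj_map u y \<xi>) \<le> lip_traj * l2norm M (\<lambda>s. x s - y s)"
  using traj_map_diff_le[OF x y u u kern_diff_kernel[OF x y u]] by (simp add: lip_traj_def algebra_simps)

lemma sol_diff_eq:
  assumes "sol u x" "sol v y" "ctrl u" "ctrl v"
  shows "l2norm M (\<lambda>\<xi>. x \<xi> - y \<xi>) = l2norm M (\<lambda>\<xi>. traj_map u x \<xi> - traj_map v y \<xi>)"
proof (rule l2norm_cong_AE)
  note s = assms[unfolded sol_def]
  show "(\<lambda>\<xi>. x \<xi> - y \<xi>) \<in> borel_measurable M"
    using s by (intro sq_integrable_measurable sq_integrable_diff) auto
  show "(\<lambda>\<xi>. traj_map u x \<xi> - traj_map v y \<xi>) \<in> borel_measurable M"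
    using s assms by (intro sq_integrable_measurable sq_integrable_diff traj_map_sq_integrable) auto
  from s(1,2) have "AE \<xi> in M. x \<xi> = traj_map u x \<xi>" "AE \<xi> in M. y \<xi> = traj_map v y \<xi>" by auto
  then show "AE \<xi> in M. x \<xi> - y \<xi> = traj_map u x \<xi> - traj_map v y \<xi>" by eventually_elim simp
qed

text \<open>Picard iteration from zero; the limit is a fixed point because the trajectory map is a contraction.\<close>

lemma sol_exists:
  assumes u: "ctrl u"
  obtains x where "sol u x"
proof -
  define X where "X = rec_nat (\<lambda>_. 0 :: real ^ 'n) (\<lambda>_. traj_map u)"
  have X_0: "X 0 = (\<lambda>_. 0)" and X_Suc: "X (Suc n) = traj_map u (X n)" for n by (simp_all add: X_def)
  have X: "sq_integrable M (X n)" for n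
  proof (induction n)
    case 0 show ?case unfolding X_0 by (rule sq_integrable_const) unfold_locales
  next
    case (Suc n) then show ?case unfolding X_Suc by (rule traj_map_sq_integrable[OF _ u])
  qed
  define C where "C = l2norm M (\<lambda>s. X 1 s - X 0 s)"
  have step: "l2norm M (\<lambda>s. X (Suc n) s - X n s) \<le> C * lip_traj ^ n" for n
  proof (induction n)
    case 0 show ?case by (simp add: C_def)
  next
    case (Suc n)
    have "l2norm M (\<lambda>s. X (Suc (Suc n)) s - X (Suc n) s) \<le> lip_traj * l2norm M (\<lambda>s. X (Suc n) s - X n s)"
      using traj_map_contraction[OF X X u, of "Suc n" n] by (simp add: X_Suc)
    also have "\<dots> \<le> lip_traj * (C * lip_traj ^ n)" by (rule mult_left_mono[OF Suc lip_traj_bounds(1)])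
    finally show ?case by (simp add: mult_ac)
  qed
  have "0 \<le> C" by (simp add: C_def)
  from l2_geometric_limit[OF X lip_traj_bounds this step]
  obtain x where x: "sq_integrable M x" and lim: "(\<lambda>n. l2norm M (\<lambda>s. X n s - x s)) \<longlonglongrightarrow> 0" .
  note Tx = traj_map_sq_integrable[OF x u]
  have le: "l2norm M (\<lambda>s. x s - traj_map u x s) \<le> l2norm M (\<lambda>s. X (Suc n) s - x s) + lip_traj * l2norm M (\<lambda>s. X n s - x s)" for n
  proof -
    have "l2norm M (\<lambda>s. x s - traj_map u x s) \<le> l2norm M (\<lambda>s. x s - X (Suc n) s) + l2norm M (\<lambda>s. X (Suc n) s - traj_map u x s)"
      by (rule l2norm_triangle_via[OF x X Tx])
    then show ?thesis
      using traj_map_contraction[OF X x u, of n] l2norm_minus_commute[of M x "X (Suc n)"] by (simp add: X_Suc)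
  qed
  have "(\<lambda>n. l2norm M (\<lambda>s. X (Suc n) s - x s) + lip_traj * l2norm M (\<lambda>s. X n s - x s)) \<longlonglongrightarrow> 0 + lip_traj * 0"
    by (intro tendsto_intros lim LIMSEQ_Suc[OF lim])
  then have "l2norm M (\<lambda>s. x s - traj_map u x s) \<le> 0 + lip_traj * 0"
    by (rule LIMSEQ_le_const) (use le in auto)
  then have "l2norm M (\<lambda>s. x s - traj_map u x s) = 0" using l2norm_nonneg[of M "\<lambda>s. x s - traj_map u x s"] by simp
  from l2norm_eq_0_AE[OF sq_integrable_diff[OF x Tx] this]
  have "sol u x" unfolding sol_def using x by simp
  then show thesis by (rule that)
qed

text \<open>A fixed point of a contraction is no further from zero than \<open>1 / (1 - lip_traj)\<close> times the norm of
the image of zero, which is bounded independently of the control.\<close>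

lemma sol_bounded:
  obtains R where "0 \<le> R" "\<And>u x. ctrl u \<Longrightarrow> sol u x \<Longrightarrow> l2norm M x \<le> R"
proof -
  define c where "c = l2norm (M \<Otimes>\<^sub>M M) (\<lambda>p. K1 (fst p) (snd p) 0) * sqrt (measure M (space M))
      + l2norm (M \<Otimes>\<^sub>M M) (\<lambda>p. K2 (fst p) (snd p) 0) * \<rho>"
  define R where "R = (l2norm M (\<lambda>\<xi>. f \<xi> 0) + lam * c) / (1 - lip_traj)"
  have c: "0 \<le> c" using \<rho> by (simp add: c_def)
  have z: "sq_integrable M (\<lambda>_. 0::real ^ 'n)" by (rule sq_integrable_const) unfold_locales
  have "l2norm M x \<le> R" if u: "ctrl u" and s: "sol u x" for u x
  proof -
    have x: "sq_integrable M x" and ae: "AE \<xi> in M. x \<xi> = traj_map u x \<xi>" using s by (auto simp: sol_def)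
    note k0 = kern_0_kernel[OF u, folded c_def]
    note T0 = traj_map_sq_integrable[OF z u]
    have "l2norm M (traj_map u (\<lambda>_. 0)) \<le> l2norm M (\<lambda>\<xi>. f \<xi> 0) + lam * l2norm M (kint M (kern u (\<lambda>_. 0)))"
      using l2norm_triangle[OF f_0 sq_integrable_scaleR[OF l2_kernelD(3)[OF k0], of lam]] lam
      by (simp add: traj_map_def[abs_def] l2norm_scaleR)
    also have "\<dots> \<le> l2norm M (\<lambda>\<xi>. f \<xi> 0) + lam * c"
      using l2_kernelD(4)[OF k0] lam by simp
    finally have t0: "l2norm M (traj_map u (\<lambda>_. 0)) \<le> l2norm M (\<lambda>\<xi>. f \<xi> 0) + lam * c" .
    have "l2norm M x = l2norm M (traj_map u x)"
      by (rule l2norm_cong_AE) (use x ae sq_integrable_measurable traj_map_sq_integrable[OF x u] in blast)+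
    also have "\<dots> \<le> l2norm M (\<lambda>\<xi>. traj_map u x \<xi> - traj_map u (\<lambda>_. 0) \<xi>) + l2norm M (traj_map u (\<lambda>_. 0))"
      using l2norm_triangle[OF sq_integrable_diff[OF traj_map_sq_integrable[OF x u] T0] T0] by simp
    also have "\<dots> \<le> lip_traj * l2norm M x + (l2norm M (\<lambda>\<xi>. f \<xi> 0) + lam * c)"
      using traj_map_contraction[OF x z u] t0 by simp
    finally show ?thesis using lip_traj_bounds by (simp add: R_def field_simps)
  qed
  moreover have "0 \<le> R" using lip_traj_bounds c lam by (simp add: R_def)
  ultimately show thesis by (intro that)
qed

end

section \<open>Kernels that turn weak closeness of controls into strong closeness\<close>

text \<open>Closeness with respect to finitely many test functions, namely indicators of sets.\<close>

definition weakly_close ::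
  "'a measure \<Rightarrow> 'a set set \<Rightarrow> real \<Rightarrow> ('a \<Rightarrow> 'b::euclidean_space) \<Rightarrow> ('a \<Rightarrow> 'b) \<Rightarrow> bool" where
  "weakly_close M \<B> d u v \<longleftrightarrow> (\<forall>B\<in>\<B>. norm ((LINT s:B|M. u s) - (LINT s:B|M. v s)) \<le> d)"

lemma weakly_close_sym: "weakly_close M \<B> d u v \<Longrightarrow> weakly_close M \<B> d v u"
  by (simp add: weakly_close_def norm_minus_commute)

lemma weakly_close_mono:
  "weakly_close M \<B> d u v \<Longrightarrow> \<A> \<subseteq> \<B> \<Longrightarrow> d \<le> e \<Longrightarrow> weakly_close M \<A> e u v"
  by (force simp: weakly_close_def)

lemma weakly_close_trans:
  assumes "weakly_close M \<B> d u v" "weakly_close M \<B> e v w"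
  shows "weakly_close M \<B> (d + e) u w"
  unfolding weakly_close_def
proof
  fix B assume "B \<in> \<B>"
  then show "norm ((LINT s:B|M. u s) - (LINT s:B|M. w s)) \<le> d + e"
    using assms norm_triangle_le[of "(LINT s:B|M. u s) - (LINT s:B|M. v s)" "(LINT s:B|M. v s) - (LINT s:B|M. w s)" "d + e"]
    by (force simp: weakly_close_def)
qed

text \<open>Weakly close controls in the ball of radius \<open>\<rho>\<close> have images under the integral operator with
kernel \<open>G\<close> that are close in norm. For controls in a ball this expresses compactness of the operator,
phrased so that it passes to sums and limits directly.\<close>

definition weak_to_strong :: "'a measure \<Rightarrow> real \<Rightarrow> ('a \<times> 'a \<Rightarrow> real ^ 'm ^ 'n) \<Rightarrow> bool" where
  "weak_to_strong M \<rho> G \<longleftrightarrow> sq_integrable (M \<Otimes>\<^sub>M M) G \<and>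
     (\<forall>\<eta>>0. \<exists>\<B> d. finite \<B> \<and> \<B> \<subseteq> sets M \<and> 0 < d \<and>
        (\<forall>u v. sq_integrable M u \<longrightarrow> sq_integrable M v \<longrightarrow> l2norm M u \<le> \<rho> \<longrightarrow> l2norm M v \<le> \<rho> \<longrightarrow>
           weakly_close M \<B> d u v \<longrightarrow> l2_kernel M (\<lambda>\<xi> s. G (\<xi>, s) *v (u s - v s)) \<eta>))"

lemma weak_to_strongE:
  assumes "weak_to_strong M \<rho> G" "0 < \<eta>"
  obtains \<B> d where "finite \<B>" "\<B> \<subseteq> sets M" "0 < d"
    "\<And>u v. sq_integrable M u \<Longrightarrow> sq_integrable M v \<Longrightarrow> l2norm M u \<le> \<rho> \<Longrightarrow> l2norm M v \<le> \<rho> \<Longrightarrow>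
       weakly_close M \<B> d u v \<Longrightarrow> l2_kernel M (\<lambda>\<xi> s. G (\<xi>, s) *v (u s - v s)) \<eta>"
proof -
  have "\<exists>\<B> d. finite \<B> \<and> \<B> \<subseteq> sets M \<and> 0 < d \<and>
        (\<forall>u v. sq_integrable M u \<longrightarrow> sq_integrable M v \<longrightarrow> l2norm M u \<le> \<rho> \<longrightarrow> l2norm M v \<le> \<rho> \<longrightarrow>
           weakly_close M \<B> d u v \<longrightarrow> l2_kernel M (\<lambda>\<xi> s. G (\<xi>, s) *v (u s - v s)) \<eta>)"
    using assms by (simp add: weak_to_strong_def)
  then show thesis by (elim exE conjE) (rule that, assumption+, blast)
qed

lemma weak_to_strong_sq: "weak_to_strong M \<rho> G \<Longrightarrow> sq_integrable (M \<Otimes>\<^sub>M M) G"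
  by (simp add: weak_to_strong_def)

context finite_measure
begin

lemma finite_measure_pair: "finite_measure (M \<Otimes>\<^sub>M M)"
  by (rule finite_measure_pair_measure) unfold_locales

lemma weak_to_strong_add:
  fixes G H :: "'a \<times> 'a \<Rightarrow> real ^ 'm ^ 'n"
  assumes G: "weak_to_strong M \<rho> G" and H: "weak_to_strong M \<rho> H"
  shows "weak_to_strong M \<rho> (\<lambda>p. G p + H p)"
  unfolding weak_to_strong_def
proof (intro conjI allI impI)
  show "sq_integrable (M \<Otimes>\<^sub>M M) (\<lambda>p. G p + H p)"
    by (intro sq_integrable_add weak_to_strong_sq[OF G] weak_to_strong_sq[OF H])
  fix \<eta> :: real assume "0 < \<eta>"
  then have h: "0 < \<eta> / 2" by simp
  obtain \<A> c where A: "finite \<A>" "\<A> \<subseteq> sets M" "0 < c"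
    "\<And>u v. sq_integrable M u \<Longrightarrow> sq_integrable M v \<Longrightarrow> l2norm M u \<le> \<rho> \<Longrightarrow> l2norm M v \<le> \<rho> \<Longrightarrow>
       weakly_close M \<A> c u v \<Longrightarrow> l2_kernel M (\<lambda>\<xi> s. G (\<xi>, s) *v (u s - v s)) (\<eta> / 2)"
    by (rule weak_to_strongE[OF G h]) blast
  obtain \<B> d where B: "finite \<B>" "\<B> \<subseteq> sets M" "0 < d"
    "\<And>u v. sq_integrable M u \<Longrightarrow> sq_integrable M v \<Longrightarrow> l2norm M u \<le> \<rho> \<Longrightarrow> l2norm M v \<le> \<rho> \<Longrightarrow>
       weakly_close M \<B> d u v \<Longrightarrow> l2_kernel M (\<lambda>\<xi> s. H (\<xi>, s) *v (u s - v s)) (\<eta> / 2)"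
    by (rule weak_to_strongE[OF H h]) blast
  show "\<exists>\<B> d. finite \<B> \<and> \<B> \<subseteq> sets M \<and> 0 < d \<and>
        (\<forall>u v. sq_integrable M u \<longrightarrow> sq_integrable M v \<longrightarrow> l2norm M u \<le> \<rho> \<longrightarrow> l2norm M v \<le> \<rho> \<longrightarrow>
           weakly_close M \<B> d u v \<longrightarrow> l2_kernel M (\<lambda>\<xi> s. (G (\<xi>, s) + H (\<xi>, s)) *v (u s - v s)) \<eta>)"
  proof (intro exI conjI allI impI)
    show "finite (\<A> \<union> \<B>)" "\<A> \<union> \<B> \<subseteq> sets M" "0 < min c d" using A B by auto
    fix u v :: "'a \<Rightarrow> real ^ 'm"
    assume uv: "sq_integrable M u" "sq_integrable M v" "l2norm M u \<le> \<rho>" "l2norm M v \<le> \<rho>"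
      and cl: "weakly_close M (\<A> \<union> \<B>) (min c d) u v"
    have "weakly_close M \<A> c u v" "weakly_close M \<B> d u v"
      by (rule weakly_close_mono[OF cl]; simp)+
    then have "l2_kernel M (\<lambda>\<xi> s. G (\<xi>, s) *v (u s - v s)) (\<eta> / 2)"
      "l2_kernel M (\<lambda>\<xi> s. H (\<xi>, s) *v (u s - v s)) (\<eta> / 2)"
      using A(4) B(4) uv by auto
    from l2_kernel_add[OF this]
    show "l2_kernel M (\<lambda>\<xi> s. (G (\<xi>, s) + H (\<xi>, s)) *v (u s - v s)) \<eta>"
      by (simp add: matrix_vector_mult_add_rdistrib)
  qed
qed

text \<open>The error \<open>G - H\<close> acts on \<open>u - v\<close>, whose norm is at most \<open>2 * \<rho>\<close>.\<close>

lemma weak_to_strong_limit: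
  fixes G :: "'a \<times> 'a \<Rightarrow> real ^ 'm ^ 'n"
  assumes G: "sq_integrable (M \<Otimes>\<^sub>M M) G"
    and approx: "\<And>\<eta>. 0 < \<eta> \<Longrightarrow> \<exists>H. weak_to_strong M \<rho> H \<and> l2norm (M \<Otimes>\<^sub>M M) (\<lambda>p. G p - H p) \<le> \<eta>"
    and \<rho>: "0 \<le> \<rho>"
  shows "weak_to_strong M \<rho> G"
  unfolding weak_to_strong_def
proof (intro conjI allI impI G)
  fix \<eta> :: real assume \<eta>: "0 < \<eta>"
  \<comment> \<open>Half of \<open>\<eta>\<close> is left for the error term, which is at most \<open>e * (2 * \<rho>)\<close>.\<close>
  define e where "e = \<eta> / (4 * (\<rho> + 1))"
  have e: "0 < e" using \<eta> \<rho> by (simp add: e_def)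
  obtain H where H: "weak_to_strong M \<rho> H" and le: "l2norm (M \<Otimes>\<^sub>M M) (\<lambda>p. G p - H p) \<le> e"
    using approx[OF e] by blast
  have h: "0 < \<eta> / 2" using \<eta> by simp
  obtain \<B> d where B: "finite \<B>" "\<B> \<subseteq> sets M" "0 < d"
    "\<And>u v. sq_integrable M u \<Longrightarrow> sq_integrable M v \<Longrightarrow> l2norm M u \<le> \<rho> \<Longrightarrow> l2norm M v \<le> \<rho> \<Longrightarrow>
       weakly_close M \<B> d u v \<Longrightarrow> l2_kernel M (\<lambda>\<xi> s. H (\<xi>, s) *v (u s - v s)) (\<eta> / 2)"
    by (rule weak_to_strongE[OF H h]) blast
  have D: "sq_integrable (M \<Otimes>\<^sub>M M) (\<lambda>p. G p - H p)"
    by (intro sq_integrable_diff G weak_to_strong_sq[OF H])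
  show "\<exists>\<B> d. finite \<B> \<and> \<B> \<subseteq> sets M \<and> 0 < d \<and>
        (\<forall>u v. sq_integrable M u \<longrightarrow> sq_integrable M v \<longrightarrow> l2norm M u \<le> \<rho> \<longrightarrow> l2norm M v \<le> \<rho> \<longrightarrow>
           weakly_close M \<B> d u v \<longrightarrow> l2_kernel M (\<lambda>\<xi> s. G (\<xi>, s) *v (u s - v s)) \<eta>)"
  proof (intro exI conjI allI impI)
    show "finite \<B>" "\<B> \<subseteq> sets M" "0 < d" by (fact B)+
    fix u v :: "'a \<Rightarrow> real ^ 'm"
    assume uv: "sq_integrable M u" "sq_integrable M v" "l2norm M u \<le> \<rho>" "l2norm M v \<le> \<rho>"
      and cl: "weakly_close M \<B> d u v"
    note 1 = B(4)[OF uv cl]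
    have "l2norm (M \<Otimes>\<^sub>M M) (\<lambda>p. G p - H p) * l2norm M (\<lambda>s. u s - v s) \<le> e * (2 * \<rho>)"
      using l2norm_triangle_diff[OF uv(1,2)] uv e by (intro mult_mono le) auto
    also have "\<dots> \<le> \<eta> / 2" using \<rho> \<eta> by (simp add: e_def field_simps)
    finally have le2: "l2norm (M \<Otimes>\<^sub>M M) (\<lambda>p. G p - H p) * l2norm M (\<lambda>s. u s - v s) \<le> \<eta> / 2" .
    have "l2_kernel M (\<lambda>\<xi> s. (G (\<xi>, s) - H (\<xi>, s)) *v (u s - v s))
        (l2norm (M \<Otimes>\<^sub>M M) (\<lambda>p. G p - H p) * l2norm M (\<lambda>s. u s - v s))"
      using matrix_kernel[of "\<lambda>\<xi> s. G (\<xi>, s) - H (\<xi>, s)", OF _ sq_integrable_diff[OF uv(1,2)]] D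
      by simp
    then have "l2_kernel M (\<lambda>\<xi> s. (G (\<xi>, s) - H (\<xi>, s)) *v (u s - v s)) (\<eta> / 2)"
      by (rule l2_kernel_mono[OF _ le2])
    from l2_kernel_add[OF 1 this]
    show "l2_kernel M (\<lambda>\<xi> s. G (\<xi>, s) *v (u s - v s)) \<eta>"
      by (simp flip: matrix_vector_mult_add_rdistrib)
  qed
qed

lemma weak_to_strong_cong:
  assumes H: "weak_to_strong M \<rho> H" and eq: "\<And>p. p \<in> space (M \<Otimes>\<^sub>M M) \<Longrightarrow> G p = H p" and \<rho>: "0 \<le> \<rho>"
  shows "weak_to_strong M \<rho> G"
proof (rule weak_to_strong_limit[OF _ _ \<rho>])
  note [measurable] = sq_integrable_measurable[OF weak_to_strong_sq[OF H]]
  have m: "G \<in> borel_measurable (M \<Otimes>\<^sub>M M)" using measurable_cong[of "M \<Otimes>\<^sub>M M" G H borel] eq by simp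
  have ae: "AE p in M \<Otimes>\<^sub>M M. norm (G p) \<le> norm (H p)" using AE_space by eventually_elim (simp add: eq)
  show G: "sq_integrable (M \<Otimes>\<^sub>M M) G" by (rule sq_integrable_bound[OF weak_to_strong_sq[OF H] m ae])
  have "l2norm (M \<Otimes>\<^sub>M M) (\<lambda>p. G p - H p) = l2norm (M \<Otimes>\<^sub>M M) (\<lambda>p. 0 :: real)"
    unfolding l2norm_def by (rule arg_cong[where f = sqrt], rule Bochner_Integration.integral_cong) (auto simp: eq)
  then have "l2norm (M \<Otimes>\<^sub>M M) (\<lambda>p. G p - H p) = 0" by (simp add: l2norm_def)
  then show "\<exists>H. weak_to_strong M \<rho> H \<and> l2norm (M \<Otimes>\<^sub>M M) (\<lambda>p. G p - H p) \<le> \<eta>" if "0 < \<eta>" for \<eta>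
    using H that by (intro exI[of _ H]) simp
qed

lemma sq_integrable_indicator:
  assumes "A \<in> sets (M \<Otimes>\<^sub>M M)"
  shows "sq_integrable (M \<Otimes>\<^sub>M M) (\<lambda>p. indicator A p *\<^sub>R c)"
proof (rule sq_integrable_bound(1)[OF sq_integrable_const[OF finite_measure_pair, of c]])
  show "(\<lambda>p. indicator A p *\<^sub>R c) \<in> borel_measurable (M \<Otimes>\<^sub>M M)" using assms by measurable
qed (simp add: indicator_def)

lemma l2norm_indicator:
  assumes "A \<in> sets (M \<Otimes>\<^sub>M M)"
  shows "l2norm (M \<Otimes>\<^sub>M M) (\<lambda>p. indicator A p *\<^sub>R c) = norm c * sqrt (measure (M \<Otimes>\<^sub>M M) A)"
proof -
  have "(\<lambda>p. (norm (indicator A p *\<^sub>R c))\<^sup>2) = (\<lambda>p. indicator A p *\<^sub>R (norm c)\<^sup>2)"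
    by (auto simp: indicator_def)
  then show ?thesis using sets.sets_into_space[OF assms] assms
    by (simp add: l2norm_def real_sqrt_mult Int_absorb2)
qed

lemma weak_to_strong_zero: "weak_to_strong M \<rho> (\<lambda>p. 0 :: real ^ 'm ^ 'n)"
proof -
  have "sq_integrable (M \<Otimes>\<^sub>M M) (\<lambda>p. 0 :: real ^ 'm ^ 'n)"
    by (rule sq_integrable_const[OF finite_measure_pair])
  moreover have "l2_kernel M (\<lambda>\<xi> s. 0 :: real ^ 'n) \<eta>" if "0 < \<eta>" for \<eta>
    using that by (simp add: l2_kernel_def kint_def[abs_def] l2norm_def sq_integrable_def)
  ultimately show ?thesis
    unfolding weak_to_strong_def by (auto intro!: exI[of _ "{}"] exI[of _ "1::real"])
qed

lemma weak_to_strong_sum: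
  assumes "finite I" "\<And>i. i \<in> I \<Longrightarrow> weak_to_strong M \<rho> (G i)"
  shows "weak_to_strong M \<rho> (\<lambda>p. \<Sum>i\<in>I. G i p)"
  using assms
proof (induction I rule: finite_induct)
  case empty then show ?case by (simp add: weak_to_strong_zero)
next
  case (insert i I)
  then have "weak_to_strong M \<rho> (\<lambda>p. G i p + (\<Sum>i\<in>I. G i p))" by (intro weak_to_strong_add) auto
  then show ?case using insert by simp
qed

text \<open>The kernel integrates \<open>u - v\<close> over \<open>B\<close>, so \<open>B\<close> itself is the only test set needed.\<close>

lemma weak_to_strong_rectangle:
  fixes c :: "real ^ 'm ^ 'n"
  assumes A: "A \<in> sets M" and B: "B \<in> sets M"
  shows "weak_to_strong M \<rho> (\<lambda>p. indicator (A \<times> B) p *\<^sub>R c)"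
  unfolding weak_to_strong_def
proof (intro conjI allI impI)
  have AB: "A \<times> B \<in> sets (M \<Otimes>\<^sub>M M)" using A B by simp
  show sq: "sq_integrable (M \<Otimes>\<^sub>M M) (\<lambda>p. indicator (A \<times> B) p *\<^sub>R c)" by (rule sq_integrable_indicator[OF AB])
  fix \<eta> :: real assume \<eta>: "0 < \<eta>"
  define C where "C = norm c * sqrt (measure M (space M))"
  have C: "0 \<le> C" by (simp add: C_def)
  show "\<exists>\<B> d. finite \<B> \<and> \<B> \<subseteq> sets M \<and> 0 < d \<and>
        (\<forall>u v. sq_integrable M u \<longrightarrow> sq_integrable M v \<longrightarrow> l2norm M u \<le> \<rho> \<longrightarrow> l2norm M v \<le> \<rho> \<longrightarrow>
           weakly_close M \<B> d u v \<longrightarrow>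
           l2_kernel M (\<lambda>\<xi> s. (indicator (A \<times> B) (\<xi>, s) *\<^sub>R c) *v (u s - v s)) \<eta>)"
  proof (intro exI conjI allI impI)
    show "finite {B}" "{B} \<subseteq> sets M" "0 < \<eta> / (C + 1)" using B C \<eta> by auto
    fix u v :: "'a \<Rightarrow> real ^ 'm"
    assume uv: "sq_integrable M u" "sq_integrable M v" "l2norm M u \<le> \<rho>" "l2norm M v \<le> \<rho>"
      and cl: "weakly_close M {B} (\<eta> / (C + 1)) u v"
    let ?k = "\<lambda>\<xi> s. (indicator (A \<times> B) (\<xi>, s) *\<^sub>R c) *v (u s - v s)"
    have k: "l2_kernel M ?k (l2norm (M \<Otimes>\<^sub>M M) (\<lambda>p. indicator (A \<times> B) p *\<^sub>R c) * l2norm M (\<lambda>s. u s - v s))"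
      using matrix_kernel[of "\<lambda>\<xi> s. indicator (A \<times> B) (\<xi>, s) *\<^sub>R c" "\<lambda>s. u s - v s"] sq
        sq_integrable_diff[OF uv(1,2)] by simp
    define w where "w = (LINT s:B|M. u s) - (LINT s:B|M. v s)"
    have iu: "set_integrable M B u" "set_integrable M B v"
      using integrable_mult_indicator[OF B sq_integrable_integrable(1)] uv
      unfolding set_integrable_def by auto
    then have iw: "set_integrable M B (\<lambda>s. u s - v s)" and w: "(LINT s:B|M. u s - v s) = w"
      by (simp_all add: w_def)
    have bl: "bounded_linear (\<lambda>x :: real ^ 'm. c *v x)" by (rule matrix_vector_mul_bounded_linear)
    have "kint M ?k \<xi> = indicator A \<xi> *\<^sub>R (c *v w)" for \<xi>
    proof -
      have "?k \<xi> = (\<lambda>s. indicator A \<xi> *\<^sub>R (c *v (indicator B s *\<^sub>R (u s - v s))))"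
        by (rule ext) (auto simp: indicator_def)
      then have "kint M ?k \<xi> = (LINT s|M. indicator A \<xi> *\<^sub>R (c *v (indicator B s *\<^sub>R (u s - v s))))"
        by (simp add: kint_def)
      also have "\<dots> = indicator A \<xi> *\<^sub>R (LINT s|M. c *v (indicator B s *\<^sub>R (u s - v s)))"
        by simp
      also have "(LINT s|M. c *v (indicator B s *\<^sub>R (u s - v s))) = c *v w"
        using integral_bounded_linear[OF bl, of M "\<lambda>s. indicator B s *\<^sub>R (u s - v s)"] iw w
        unfolding set_integrable_def set_lebesgue_integral_def by simp
      finally show ?thesis .
    qed
    then have "norm (kint M ?k \<xi>) \<le> norm (norm c * norm w)" for \<xi>
      using norm_matrix_vector_mult_le[of c w] by (simp add: indicator_def)
    then have "l2norm M (kint M ?k) \<le> l2norm M (\<lambda>_. norm c * norm w)"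
      using l2_kernelD(3)[OF k]
      by (intro sq_integrable_bound(2) sq_integrable_const) (auto intro: sq_integrable_measurable, unfold_locales)
    also have "\<dots> = C * norm w" by (simp add: l2norm_const C_def mult_ac)
    also have "\<dots> \<le> C * (\<eta> / (C + 1))"
      using cl C by (intro mult_left_mono) (auto simp: weakly_close_def w_def)
    also have "\<dots> \<le> \<eta>" using C \<eta> by (simp add: field_simps)
    finally show "l2_kernel M ?k \<eta>" using k by (simp add: l2_kernel_def)
  qed
qed

text \<open>The sets with this property form a Dynkin system containing the rectangles. The matrix \<open>c\<close> has to vary
in the induction, because the complement of \<open>S\<close> uses \<open>- c\<close>.\<close>

lemma weak_to_strong_indicator:
  fixes c :: "real ^ 'm ^ 'n"
  assumes S: "S \<in> sets (M \<Otimes>\<^sub>M M)" and \<rho>: "0 \<le> \<rho>"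
  shows "weak_to_strong M \<rho> (\<lambda>p. indicator S p *\<^sub>R c)"
proof -
  let ?E = "{a \<times> b |a b. a \<in> sets M \<and> b \<in> sets M}"
  interpret P: finite_measure "M \<Otimes>\<^sub>M M" by (rule finite_measure_pair)
  have E: "sigma_sets (space M \<times> space M) ?E = sets (M \<Otimes>\<^sub>M M)" by (simp add: sets_pair_measure)
  have sp: "space M \<times> space M = space (M \<Otimes>\<^sub>M M)" by (simp add: space_pair_measure)
  have "S \<in> sigma_sets (space M \<times> space M) ?E" using S by (simp add: E)
  with Int_stable_pair_measure_generator[of M M] pair_measure_closed[of M M] show ?thesis
  proof (induction S arbitrary: c rule: sigma_sets_induct_disjoint)
    case (basic S)
    then show ?case by (auto intro: weak_to_strong_rectangle)
  next
    case empty
    then show ?case by (simp add: weak_to_strong_zero)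
  next
    case (compl S)
    have "weak_to_strong M \<rho> (\<lambda>p. indicator (space M \<times> space M) p *\<^sub>R c + indicator S p *\<^sub>R (- c))"
      by (intro weak_to_strong_add weak_to_strong_rectangle compl.IH) auto
    then show ?case
    proof (rule weak_to_strong_cong[OF _ _ \<rho>])
      fix p assume "p \<in> space (M \<Otimes>\<^sub>M M)"
      then show "indicator (space M \<times> space M - S) p *\<^sub>R c
          = indicator (space M \<times> space M) p *\<^sub>R c + indicator S p *\<^sub>R (- c)"
        by (auto simp: indicator_def space_pair_measure)
    qed
  next
    case (union A)
    then have Am: "A i \<in> sets (M \<Otimes>\<^sub>M M)" for i by (auto simp: E)
    show ?case
    proof (rule weak_to_strong_limit[OF _ _ \<rho>])
      show "sq_integrable (M \<Otimes>\<^sub>M M) (\<lambda>p. indicator (\<Union> (range A)) p *\<^sub>R c)"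
        by (rule sq_integrable_indicator) (use Am in auto)
      fix \<eta> :: real assume \<eta>: "0 < \<eta>"
      define R where "R n = (\<Union>i. A i) - (\<Union>i<n. A i)" for n
      have Rm: "R n \<in> sets (M \<Otimes>\<^sub>M M)" for n unfolding R_def using Am by auto
      have "(\<lambda>n. measure (M \<Otimes>\<^sub>M M) (R n)) \<longlonglongrightarrow> measure (M \<Otimes>\<^sub>M M) (\<Inter>n. R n)"
        by (rule P.finite_Lim_measure_decseq) (use Rm in \<open>auto simp: decseq_def R_def\<close>)
      moreover have "(\<Inter>n. R n) = {}" by (auto simp: R_def)
      ultimately have "(\<lambda>n. norm c * sqrt (measure (M \<Otimes>\<^sub>M M) (R n))) \<longlonglongrightarrow> norm c * sqrt 0"
        by (intro tendsto_intros) simp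
      then have "eventually (\<lambda>n. norm c * sqrt (measure (M \<Otimes>\<^sub>M M) (R n)) < \<eta>) sequentially"
        using \<eta> by (intro order_tendstoD(2)) auto
      then obtain n where n: "norm c * sqrt (measure (M \<Otimes>\<^sub>M M) (R n)) < \<eta>"
        by (auto simp: eventually_sequentially)
      let ?H = "\<lambda>p. \<Sum>i<n. indicator (A i) p *\<^sub>R c"
      have H: "weak_to_strong M \<rho> ?H" by (rule weak_to_strong_sum) (use union in auto)
      have "indicator (\<Union> (range A)) p *\<^sub>R c - ?H p = indicator (R n) p *\<^sub>R c" for p
      proof -
        have "(\<Sum>i<n. indicator (A i) p :: real) = indicator (\<Union>i<n. A i) p"
          using union(1) by (subst indicator_UN_disjoint) (auto simp: disjoint_family_on_def)
        then have "?H p = indicator (\<Union>i<n. A i) p *\<^sub>R c" by (simp flip: scaleR_sum_left)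
        then show ?thesis by (auto simp: R_def indicator_def)
      qed
      then have "l2norm (M \<Otimes>\<^sub>M M) (\<lambda>p. indicator (\<Union> (range A)) p *\<^sub>R c - ?H p) \<le> \<eta>"
        using l2norm_indicator[OF Rm, of n c] n by simp
      with H show "\<exists>H. weak_to_strong M \<rho> H \<and>
          l2norm (M \<Otimes>\<^sub>M M) (\<lambda>p. indicator (\<Union> (range A)) p *\<^sub>R c - H p) \<le> \<eta>" by blast
    qed
  qed
qed

text \<open>Every square-integrable kernel is an $L_2$ limit of simple functions.\<close>

lemma weak_to_strong_sq_integrable:
  fixes G :: "'a \<times> 'a \<Rightarrow> real ^ 'm ^ 'n"
  assumes G: "sq_integrable (M \<Otimes>\<^sub>M M) G" and \<rho>: "0 \<le> \<rho>"
  shows "weak_to_strong M \<rho> G"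
proof (rule weak_to_strong_limit[OF G _ \<rho>])
  let ?P = "M \<Otimes>\<^sub>M M"
  note [measurable] = sq_integrable_measurable[OF G]
  obtain S where S3: "(\<forall>i. simple_function ?P (S i)) \<and> (\<forall>p\<in>space ?P. (\<lambda>i. S i p) \<longlonglongrightarrow> G p) \<and>
      (\<forall>i. \<forall>p\<in>space ?P. dist (S i p) 0 \<le> 2 * dist (G p) 0)"
    using borel_measurable_implies_sequence_metric[OF sq_integrable_measurable[OF G], of 0] by (rule exE)
  then have S: "\<And>i. simple_function ?P (S i)"
    and lim: "\<And>p. p \<in> space ?P \<Longrightarrow> (\<lambda>i. S i p) \<longlonglongrightarrow> G p"
    and bd: "\<And>i p. p \<in> space ?P \<Longrightarrow> norm (S i p) \<le> 2 * norm (G p)"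
    by (simp_all only: dist_norm diff_zero)
  have ws: "weak_to_strong M \<rho> (S i)" for i
  proof (rule weak_to_strong_cong[OF _ _ \<rho>])
    show "weak_to_strong M \<rho> (\<lambda>p. \<Sum>y\<in>S i ` space ?P. indicator (S i -` {y} \<inter> space ?P) p *\<^sub>R y)"
      using S[of i] by (intro weak_to_strong_sum weak_to_strong_indicator \<rho>) (auto simp: simple_function_def)
    fix p assume p: "p \<in> space ?P"
    have "(\<Sum>y\<in>S i ` space ?P. indicator (S i -` {y} \<inter> space ?P) p *\<^sub>R y)
        = (\<Sum>y\<in>S i ` space ?P. if y = S i p then S i p else 0)"
      by (rule sum.cong) (use p in \<open>auto simp: indicator_def\<close>)
    also have "\<dots> = S i p" using S[of i] p by (simp add: simple_function_def)
    finally show "S i p = (\<Sum>y\<in>S i ` space ?P. indicator (S i -` {y} \<inter> space ?P) p *\<^sub>R y)" by simp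
  qed
  have [measurable]: "S i \<in> borel_measurable ?P" for i using S by (rule borel_measurable_simple_function)
  have "(\<lambda>i. LINT p|?P. (norm (G p - S i p))\<^sup>2) \<longlonglongrightarrow> (LINT p|?P. 0)"
  \<comment> \<open>The approximants are bounded by \<open>2 * norm (G p)\<close>, so the differences are bounded by three times
    \<open>norm (G p)\<close>.\<close>
  proof (rule integral_dominated_convergence[where w = "\<lambda>p. 9 * (norm (G p))\<^sup>2"])
    show "integrable ?P (\<lambda>p. 9 * (norm (G p))\<^sup>2)" using sq_integrableD[OF G] by simp
    show "AE p in ?P. (\<lambda>i. (norm (G p - S i p))\<^sup>2) \<longlonglongrightarrow> 0"
      using AE_space
    proof eventually_elim
      case (elim p)
      have "(\<lambda>i. (norm (G p - S i p))\<^sup>2) \<longlonglongrightarrow> (norm (G p - G p))\<^sup>2"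
        by (intro tendsto_intros lim elim)
      then show ?case by simp
    qed
    show "AE p in ?P. norm ((norm (G p - S i p))\<^sup>2) \<le> 9 * (norm (G p))\<^sup>2" for i
      using AE_space
    proof eventually_elim
      case (elim p)
      have "norm (G p - S i p) \<le> 3 * norm (G p)"
        using norm_triangle_ineq4[of "G p" "S i p"] bd[OF elim, of i] by simp
      from power_mono[OF this, of 2] show ?case by (simp add: power_mult_distrib)
    qed
  qed measurable
  from tendsto_real_sqrt[OF this]
  have t: "(\<lambda>i. l2norm ?P (\<lambda>p. G p - S i p)) \<longlonglongrightarrow> 0" by (simp add: l2norm_def)
  fix \<eta> :: real assume "0 < \<eta>"
  from order_tendstoD(2)[OF t this] obtain i where "l2norm ?P (\<lambda>p. G p - S i p) < \<eta>"
    by (auto simp: eventually_sequentially)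
  with ws[of i] show "\<exists>H. weak_to_strong M \<rho> H \<and> l2norm ?P (\<lambda>p. G p - H p) \<le> \<eta>"
    by (intro exI[of _ "S i"]) auto
qed

end

section \<open>Weak-to-strong continuity of the trajectory map\<close>

text \<open>Cover the ball of radius \<open>C\<close> by finitely many small balls and classify the points \<open>p\<close> by the balls that
contain the values \<open>\<phi> i p\<close>: there are finitely many classes, and one representative of each suffices.\<close>

lemma finite_representatives:
  fixes \<phi> :: "'i \<Rightarrow> 'p \<Rightarrow> 'v::euclidean_space"
  assumes I: "finite I" and bd: "\<And>i p. i \<in> I \<Longrightarrow> p \<in> P \<Longrightarrow> norm (\<phi> i p) \<le> C" and d: "0 < d"
  shows "\<exists>F. finite F \<and> F \<subseteq> P \<and> (\<forall>p\<in>P. \<exists>r\<in>F. \<forall>i\<in>I. norm (\<phi> i p - \<phi> i r) \<le> d)"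
proof -
  obtain Z where Z: "finite Z" and cov: "cball (0::'v) C \<subseteq> (\<Union>z\<in>Z. ball z (d / 2))"
    using compact_cball[of "0::'v" C] d unfolding compact_eq_totally_bounded by (meson half_gt_zero)
  define cell where "cell p i = (SOME z. z \<in> Z \<and> dist z (\<phi> i p) < d / 2)" for p i
  define code where "code p = restrict (cell p) I" for p
  have cell: "cell p i \<in> Z \<and> dist (cell p i) (\<phi> i p) < d / 2" if "i \<in> I" "p \<in> P" for i p
  proof -
    have "\<phi> i p \<in> cball 0 C" using bd[OF that] by simp
    then have "\<exists>z. z \<in> Z \<and> dist z (\<phi> i p) < d / 2" using cov by (auto simp: subset_iff)
    then show ?thesis unfolding cell_def by (rule someI_ex)
  qed
  have "code ` P \<subseteq> Pi\<^sub>E I (\<lambda>_. Z)" using cell by (auto simp: code_def)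
  then have fin: "finite (code ` P)" using finite_PiE[OF I, of "\<lambda>_. Z"] Z by (auto intro: finite_subset)
  show ?thesis
  proof (intro exI conjI ballI)
    show "finite (inv_into P code ` code ` P)" using fin by simp
    show "inv_into P code ` code ` P \<subseteq> P" by (auto intro: inv_into_into)
    fix p assume p: "p \<in> P"
    let ?r = "inv_into P code (code p)"
    have r: "?r \<in> P" "code ?r = code p" using p by (auto intro: inv_into_into f_inv_into_f)
    have "norm (\<phi> i p - \<phi> i ?r) \<le> d" if i: "i \<in> I" for i
    proof -
      have "cell ?r i = cell p i" using r(2) i by (metis code_def restrict_apply')
      then show ?thesis
        using cell[OF i p] cell[OF i r(1)] dist_triangle_half_r[of "cell p i" "\<phi> i p" d "\<phi> i ?r"]
        by (simp add: dist_norm)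
    qed
    then show "\<exists>r\<in>inv_into P code ` code ` P. \<forall>i\<in>I. norm (\<phi> i p - \<phi> i r) \<le> d" using p by blast
  qed
qed

lemma (in finite_measure) norm_set_integral_le_l2norm:
  fixes u :: "'a \<Rightarrow> 'b::euclidean_space"
  assumes u: "sq_integrable M u" and B: "B \<in> sets M"
  shows "norm (LINT s:B|M. u s) \<le> l2norm M u * sqrt (measure M (space M))"
proof -
  note i = sq_integrable_integrable[OF u]
  have "norm (LINT s:B|M. u s) \<le> (LINT s|M. norm (indicator B s *\<^sub>R u s))"
    unfolding set_lebesgue_integral_def by (rule integral_norm_bound)
  also have "\<dots> \<le> (LINT s|M. norm (u s))"
    by (rule integral_mono[OF integrable_norm[OF integrable_mult_indicator[OF B i(1)]] integrable_norm[OF i(1)]])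
       (simp add: indicator_def)
  also have "\<dots> \<le> l2norm M u * sqrt (measure M (space M))" by (rule i)
  finally show ?thesis .
qed

context lipschitz_system
begin

text \<open>A modulus of weak-to-strong continuity of the trajectory map at the single precision \<open>\<eta>\<close>.
The map is treated as a relation, by quantifying over all solutions for the two controls.\<close>

definition traj_modulus :: "real \<Rightarrow> 'a set set \<Rightarrow> real \<Rightarrow> bool" where
  "traj_modulus \<eta> \<B> d \<longleftrightarrow> finite \<B> \<and> \<B> \<subseteq> sets M \<and> 0 < d \<and>
     (\<forall>u v x y. ctrl u \<longrightarrow> ctrl v \<longrightarrow> sol u x \<longrightarrow> sol v y \<longrightarrow> weakly_close M \<B> d u v \<longrightarrow>
        l2norm M (\<lambda>s. x s - y s) \<le> \<eta>)"

lemma traj_modulusD: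
  "traj_modulus \<eta> \<B> d \<Longrightarrow> ctrl u \<Longrightarrow> ctrl v \<Longrightarrow> sol u x \<Longrightarrow> sol v y \<Longrightarrow> weakly_close M \<B> d u v \<Longrightarrow>
     l2norm M (\<lambda>s. x s - y s) \<le> \<eta>"
  unfolding traj_modulus_def by blast

text \<open>The representatives come with solutions, since their trajectories are the points at which the kernel
is frozen.\<close>

lemma finite_weak_net:
  assumes \<B>: "finite \<B>" "\<B> \<subseteq> sets M" and d: "0 < d"
  obtains F where "finite F" "\<And>w z. (w, z) \<in> F \<Longrightarrow> ctrl w \<and> sol w z"
    "\<And>u x. ctrl u \<Longrightarrow> sol u x \<Longrightarrow> \<exists>w z. (w, z) \<in> F \<and> weakly_close M \<B> d u w"
proof -
  let ?P = "{(u, x). ctrl u \<and> sol u x}"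
  have bd: "norm (LINT s:B|M. fst p s) \<le> \<rho> * sqrt (measure M (space M))" if "B \<in> \<B>" "p \<in> ?P" for B p
  proof -
    have p: "sq_integrable M (fst p)" "l2norm M (fst p) \<le> \<rho>" using that by (auto simp: ctrl_def)
    have "norm (LINT s:B|M. fst p s) \<le> l2norm M (fst p) * sqrt (measure M (space M))"
      using \<B> that by (intro norm_set_integral_le_l2norm p) auto
    also have "\<dots> \<le> \<rho> * sqrt (measure M (space M))" by (intro mult_right_mono p) simp
    finally show ?thesis .
  qed
  have "\<exists>F. finite F \<and> F \<subseteq> ?P \<and>
      (\<forall>p\<in>?P. \<exists>r\<in>F. \<forall>B\<in>\<B>. norm ((LINT s:B|M. fst p s) - (LINT s:B|M. fst r s)) \<le> d)"
    by (rule finite_representatives[OF \<B>(1) _ d]) (rule bd)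
  then obtain F where F: "finite F" "F \<subseteq> ?P"
    "\<forall>p\<in>?P. \<exists>r\<in>F. \<forall>B\<in>\<B>. norm ((LINT s:B|M. fst p s) - (LINT s:B|M. fst r s)) \<le> d"
    by (elim exE conjE)
  show thesis
  proof
    show "finite F" by fact
    show "ctrl w \<and> sol w z" if "(w, z) \<in> F" for w z using that F(2) by auto
    show "\<exists>w z. (w, z) \<in> F \<and> weakly_close M \<B> d u w" if "ctrl u" "sol u x" for u x
      using bspec[OF F(3), of "(u, x)"] that unfolding weakly_close_def by fastforce
  qed
qed

text \<open>The right-hand side \<open>K2 \<xi> s (x s) *v u s - K2 \<xi> s (y s) *v v s\<close> is compared through the frozen
trajectory \<open>z\<close>: moving \<open>x\<close> to \<open>z\<close> and \<open>z\<close> to \<open>y\<close> costs the Lipschitz constant twice, and what remains is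
linear in \<open>u - v\<close> with a kernel that depends on \<open>z\<close> only.\<close>

lemma kern_decomposition:
  assumes u: "ctrl u" and v: "ctrl v"
    and x: "sq_integrable M x" and y: "sq_integrable M y" and z: "sq_integrable M z"
    and G: "l2_kernel M (\<lambda>\<xi> s. K2 \<xi> s (z s) *v (u s - v s)) t"
    and le: "l2norm M (\<lambda>s. x s - y s) \<le> \<eta>" "l2norm M (\<lambda>s. x s - z s) \<le> \<eta>" "l2norm M (\<lambda>s. z s - y s) \<le> \<eta>"
  shows "l2_kernel M (\<lambda>\<xi> s. kern u x \<xi> s - kern v y \<xi> s) (\<kappa>1 * \<eta> + 2 * (lip_control * \<eta>) + t)"
proof -
  have 1: "l2_kernel M (\<lambda>\<xi> s. K1 \<xi> s (x s) - K1 \<xi> s (y s)) (\<kappa>1 * \<eta>)"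
    by (rule l2_kernel_mono[OF K1_diff_kernel[OF x y]]) (intro mult_left_mono le \<kappa>)
  have 2: "l2_kernel M (\<lambda>\<xi> s. K2 \<xi> s (x s) *v u s - K2 \<xi> s (z s) *v u s) (lip_control * \<eta>)"
    by (rule l2_kernel_mono[OF K2_diff_kernel[OF x z u]]) (intro mult_left_mono le lip_control_nonneg)
  have 3: "l2_kernel M (\<lambda>\<xi> s. K2 \<xi> s (z s) *v v s - K2 \<xi> s (y s) *v v s) (lip_control * \<eta>)"
    by (rule l2_kernel_mono[OF K2_diff_kernel[OF z y v]]) (intro mult_left_mono le lip_control_nonneg)
  have eq: "(\<lambda>\<xi> s. kern u x \<xi> s - kern v y \<xi> s) =
    (\<lambda>\<xi> s. ((K1 \<xi> s (x s) - K1 \<xi> s (y s)) + (K2 \<xi> s (x s) *v u s - K2 \<xi> s (z s) *v u s))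
      + (K2 \<xi> s (z s) *v v s - K2 \<xi> s (y s) *v v s) + K2 \<xi> s (z s) *v (u s - v s))"
    by (intro ext) (simp add: kern_def matrix_vector_mult_diff_distrib)
  show ?thesis
    unfolding eq by (rule l2_kernel_mono[OF l2_kernel_add[OF l2_kernel_add[OF l2_kernel_add[OF 1 2] 3] G]]) simp
qed

text \<open>The self-improvement behind the theorem. A modulus at precision \<open>\<eta>\<close> provides finitely many
trajectories that approximate all others up to \<open>\<eta>\<close>; the kernels frozen along them turn weak into
strong closeness, and finitely many such kernels need only finitely many further test sets.\<close>

lemma traj_modulus_improve:
  assumes mod: "traj_modulus \<eta> \<B> d" and t: "0 < t"
  obtains \<B>' d' where "traj_modulus ((\<kappa>0 + lam * \<kappa>1 + 2 * (lam * lip_control)) * \<eta> + t) \<B>' d'"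
proof -
  have \<B>: "finite \<B>" "\<B> \<subseteq> sets M" and d: "0 < d" using mod by (auto simp: traj_modulus_def)
  \<comment> \<open>Half of \<open>d\<close>: the representative of \<open>u\<close> must be \<open>d\<close>-close to \<open>v\<close> as well, through \<open>u\<close>.\<close>
  have d2: "0 < d / 2" using d by simp
  obtain F where F: "finite F" "\<And>w z. (w, z) \<in> F \<Longrightarrow> ctrl w \<and> sol w z"
    "\<And>u x. ctrl u \<Longrightarrow> sol u x \<Longrightarrow> \<exists>w z. (w, z) \<in> F \<and> weakly_close M \<B> (d / 2) u w"
    by (rule finite_weak_net[OF \<B> d2]) blast
  have tl: "0 < t / lam" using t lam by simp
  define good where "good r \<A> c \<longleftrightarrow> finite \<A> \<and> \<A> \<subseteq> sets M \<and> 0 < c \<and>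
      (\<forall>u v. ctrl u \<longrightarrow> ctrl v \<longrightarrow> weakly_close M \<A> c u v \<longrightarrow>
         l2_kernel M (\<lambda>\<xi> s. K2 \<xi> s (snd r s) *v (u s - v s)) (t / lam))"
    for r :: "('a \<Rightarrow> real ^ 'm) \<times> ('a \<Rightarrow> real ^ 'n)" and \<A> c
  have ex: "\<exists>\<A> c. good r \<A> c" if "r \<in> F" for r
  proof -
    have z: "sq_integrable M (snd r)" using F(2)[of "fst r" "snd r"] that by (simp add: sol_def)
    obtain \<A> c where A: "finite \<A>" "\<A> \<subseteq> sets M" "0 < c"
      "\<And>u v. sq_integrable M u \<Longrightarrow> sq_integrable M v \<Longrightarrow> l2norm M u \<le> \<rho> \<Longrightarrow> l2norm M v \<le> \<rho> \<Longrightarrow>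
         weakly_close M \<A> c u v \<Longrightarrow>
         l2_kernel M (\<lambda>\<xi> s. K2 (fst (\<xi>, s)) (snd (\<xi>, s)) (snd r (snd (\<xi>, s))) *v (u s - v s)) (t / lam)"
      by (rule weak_to_strongE[OF weak_to_strong_sq_integrable[OF K2_comp_sq_integrable[OF z] \<rho>] tl]) blast
    then have "good r \<A> c" by (simp add: good_def ctrl_def)
    then show ?thesis by blast
  qed
  obtain \<A> c where Ac: "\<And>r. r \<in> F \<Longrightarrow> good r (\<A> r) (c r)" using ex by metis
  define \<B>' where "\<B>' = \<B> \<union> (\<Union>r\<in>F. \<A> r)"
  define d' where "d' = Min (insert (d / 2) (c ` F))"
  have d'_le: "d' \<le> d / 2" "\<And>r. r \<in> F \<Longrightarrow> d' \<le> c r" unfolding d'_def by (rule Min_le; use F(1) in simp)+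
  have "traj_modulus ((\<kappa>0 + lam * \<kappa>1 + 2 * (lam * lip_control)) * \<eta> + t) \<B>' d'"
    unfolding traj_modulus_def
  proof (intro conjI allI impI)
    show "finite \<B>'" using \<B> F(1) Ac by (auto simp: \<B>'_def good_def)
    have "\<A> r \<subseteq> sets M" if "r \<in> F" for r using Ac[OF that] by (simp add: good_def)
    then show "\<B>' \<subseteq> sets M" using \<B> unfolding \<B>'_def by blast
    show "0 < d'" using F(1) d Ac by (auto simp: d'_def good_def)
    fix u v x y assume u: "ctrl u" and v: "ctrl v" and x: "sol u x" and y: "sol v y"
      and cl: "weakly_close M \<B>' d' u v"
    obtain w z where wz: "(w, z) \<in> F" and uw: "weakly_close M \<B> (d / 2) u w" using F(3)[OF u x] by blast
    have w: "ctrl w" and z: "sol w z" using F(2)[OF wz] by auto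
    have uv: "weakly_close M \<B> (d / 2) u v"
      by (rule weakly_close_mono[OF cl]) (use d'_le in \<open>auto simp: \<B>'_def\<close>)
    have "weakly_close M \<B> (d / 2 + d / 2) w v"
      by (rule weakly_close_trans[OF weakly_close_sym[OF uw] uv])
    then have wv: "weakly_close M \<B> d w v" by simp
    have xz: "l2norm M (\<lambda>s. x s - z s) \<le> \<eta>"
      by (rule traj_modulusD[OF mod u w x z], rule weakly_close_mono[OF uw]) (use d in auto)
    have zy: "l2norm M (\<lambda>s. z s - y s) \<le> \<eta>" by (rule traj_modulusD[OF mod w v z y wv])
    have xy: "l2norm M (\<lambda>s. x s - y s) \<le> \<eta>"
      by (rule traj_modulusD[OF mod u v x y], rule weakly_close_mono[OF uv]) (use d in auto)
    have "weakly_close M (\<A> (w, z)) (c (w, z)) u v"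
      by (rule weakly_close_mono[OF cl]) (use wz d'_le in \<open>auto simp: \<B>'_def\<close>)
    then have G: "l2_kernel M (\<lambda>\<xi> s. K2 \<xi> s (z s) *v (u s - v s)) (t / lam)"
      using Ac[OF wz] u v by (simp add: good_def)
    have sq: "sq_integrable M x" "sq_integrable M y" "sq_integrable M z" using x y z by (auto simp: sol_def)
    have "l2norm M (\<lambda>s. x s - y s) = l2norm M (\<lambda>\<xi>. traj_map u x \<xi> - traj_map v y \<xi>)"
      by (rule sol_diff_eq[OF x y u v])
    also have "\<dots> \<le> \<kappa>0 * l2norm M (\<lambda>s. x s - y s) + lam * (\<kappa>1 * \<eta> + 2 * (lip_control * \<eta>) + t / lam)"
      by (rule traj_map_diff_le[OF sq(1,2) u v kern_decomposition[OF u v sq G xy xz zy]])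
    also have "\<dots> \<le> \<kappa>0 * \<eta> + lam * (\<kappa>1 * \<eta> + 2 * (lip_control * \<eta>) + t / lam)"
      using xy \<kappa> by (intro add_right_mono mult_left_mono) auto
    also have "\<dots> = (\<kappa>0 + lam * \<kappa>1 + 2 * (lam * lip_control)) * \<eta> + t"
      using lam by (simp add: field_simps)
    finally show "l2norm M (\<lambda>s. x s - y s) \<le> (\<kappa>0 + lam * \<kappa>1 + 2 * (lam * lip_control)) * \<eta> + t" .
  qed
  then show thesis by (rule that)
qed

text \<open>Boundedness of trajectories is a modulus at precision \<open>2 * R\<close> without test sets. Iterating the
improvement with fixed error \<open>(1 - p) * t\<close> moves the precision geometrically towards \<open>t\<close>.\<close>

lemma traj_modulus_exists:
  assumes \<eta>: "0 < \<eta>"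
  obtains \<B> d where "traj_modulus \<eta> \<B> d"
proof -
  obtain R where R: "0 \<le> R" "\<And>u x. ctrl u \<Longrightarrow> sol u x \<Longrightarrow> l2norm M x \<le> R" by (rule sol_bounded) blast
  define p where "p = \<kappa>0 + lam * \<kappa>1 + 2 * (lam * lip_control)"
  have p: "0 \<le> p" "p < 1" using weighted_sum_less_1 \<kappa> lam lip_control_nonneg by (auto simp: p_def)
  define t where "t = \<eta> / 2"
  have t: "0 < (1 - p) * t" using \<eta> p by (simp add: t_def)
  have it: "\<exists>\<B> d. traj_modulus (t + p ^ n * (2 * R)) \<B> d" for n
  proof (induction n)
    case 0
    have "traj_modulus (t + p ^ 0 * (2 * R)) {} 1"
      unfolding traj_modulus_def
    proof (intro conjI allI impI)
      fix u v x y assume a: "ctrl u" "ctrl v" "sol u x" "sol v y"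
      have "l2norm M (\<lambda>s. x s - y s) \<le> l2norm M x + l2norm M y"
        by (rule l2norm_triangle_diff) (use a in \<open>auto simp: sol_def\<close>)
      then show "l2norm M (\<lambda>s. x s - y s) \<le> t + p ^ 0 * (2 * R)"
        using R(2)[OF a(1,3)] R(2)[OF a(2,4)] \<eta> by (simp add: t_def)
    qed auto
    then show ?case by blast
  next
    case (Suc n)
    then obtain \<B> d where "traj_modulus (t + p ^ n * (2 * R)) \<B> d" by blast
    from traj_modulus_improve[OF this t, folded p_def]
    obtain \<B>' d' where "traj_modulus (p * (t + p ^ n * (2 * R)) + (1 - p) * t) \<B>' d'" by blast
    then have "traj_modulus (t + p ^ Suc n * (2 * R)) \<B>' d'" by (simp add: algebra_simps)
    then show ?case by blast
  qed
  have "(\<lambda>n. t + p ^ n * (2 * R)) \<longlonglongrightarrow> t + 0 * (2 * R)"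
    using p by (intro tendsto_intros LIMSEQ_power_zero) auto
  moreover have "t + 0 * (2 * R) < \<eta>" using \<eta> by (simp add: t_def)
  ultimately have "eventually (\<lambda>n. t + p ^ n * (2 * R) < \<eta>) sequentially" by (rule order_tendstoD)
  then obtain n where n: "t + p ^ n * (2 * R) < \<eta>" by (auto simp: eventually_sequentially)
  obtain \<B> d where "traj_modulus (t + p ^ n * (2 * R)) \<B> d" using it by blast
  then have "traj_modulus \<eta> \<B> d" using n unfolding traj_modulus_def by fastforce
  then show thesis by (rule that)
qed

end

section \<open>Discretising a control on a finite partition\<close>

lemma uniform_partition_round:
  assumes L: "uniform_partition \<delta> \<alpha> \<Lambda>" and \<delta>: "0 < \<delta>" and t: "0 \<le> t" "t \<le> \<alpha>"
  obtains r where "r \<in> \<Lambda>" "0 \<le> r" "r \<le> t" "t - r \<le> \<delta>"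
proof -
  obtain p :: "nat \<Rightarrow> real" and n where \<Lambda>: "\<Lambda> = p ` {..n}" and p0: "p 0 = 0" and pn: "p n = \<alpha>"
    and step: "\<And>j. j < n \<Longrightarrow> p (Suc j) - p j = \<delta>"
    using L unfolding uniform_partition_def by blast
  have p: "p j = real j * \<delta>" if "j \<le> n" for j
    using that
  proof (induction j)
    case 0 then show ?case by (simp add: p0)
  next
    case (Suc j) then show ?case using step[of j] by (simp add: algebra_simps)
  qed
  define j where "j = nat \<lfloor>t / \<delta>\<rfloor>"
  have j: "real j \<le> t / \<delta>" "t / \<delta> < real j + 1" using t \<delta> by (auto simp: j_def of_nat_nat)
  have "t / \<delta> \<le> real n" using t \<delta> p[of n] pn by (simp add: field_simps)
  then have "j \<le> n" using j by linarith
  show thesis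
  proof
    show "p j \<in> \<Lambda>" using \<Lambda> \<open>j \<le> n\<close> by auto
    show "0 \<le> p j" "p j \<le> t" "t - p j \<le> \<delta>" using p[OF \<open>j \<le> n\<close>] j \<delta> by (auto simp: field_simps)
  qed
qed

text \<open>Write \<open>y\<close> in polar form and round the radius down and the direction to the net. Rounding down keeps the
norm of the discrete control below \<open>\<rho>\<close>.\<close>

lemma polar_round:
  fixes y :: "real ^ 'm"
  assumes L: "uniform_partition \<delta> \<alpha> \<Lambda>" and \<delta>: "0 < \<delta>" and B: "finite_sphere_net \<sigma> B"
    and y: "norm y \<le> \<alpha>" and \<sigma>: "0 \<le> \<sigma>"
  shows "\<exists>r b. r \<in> \<Lambda> \<and> b \<in> B \<and> 0 \<le> r \<and> r \<le> norm y \<and> norm (y - r *\<^sub>R b) \<le> \<delta> + \<alpha> * \<sigma>"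
proof -
  obtain r where r: "r \<in> \<Lambda>" "0 \<le> r" "r \<le> norm y" "norm y - r \<le> \<delta>"
    by (rule uniform_partition_round[OF L \<delta> norm_ge_zero y])
  obtain g where g: "norm g = 1" "y = norm y *\<^sub>R g"
  proof (cases "y = 0")
    case True
    obtain e :: "real ^ 'm" where "norm e = 1" using vector_choose_size[of 1] by auto
    then show thesis using True by (intro that) auto
  next
    case False
    then show thesis by (intro that[of "y /\<^sub>R norm y"]) auto
  qed
  have "g \<in> sphere 0 1" using g(1) by simp
  then obtain b where b: "b \<in> B" "norm (g - b) \<le> \<sigma>"
    using B unfolding finite_sphere_net_def by blast
  have "y - r *\<^sub>R b = (norm y - r) *\<^sub>R g + r *\<^sub>R (g - b)"
    using g(2) by (simp add: algebra_simps)
  then have "norm (y - r *\<^sub>R b) \<le> norm ((norm y - r) *\<^sub>R g) + norm (r *\<^sub>R (g - b))"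
    by (metis norm_triangle_ineq)
  also have "\<dots> \<le> \<delta> + \<alpha> * \<sigma>"
    using r g(1) y \<sigma> b by (auto intro!: add_mono mult_mono)
  finally show ?thesis using r b by blast
qed

definition step_fun :: "'a set set \<Rightarrow> ('a set \<Rightarrow> 'b::real_vector) \<Rightarrow> 'a \<Rightarrow> 'b" where
  "step_fun \<Gamma> c s = (\<Sum>A\<in>\<Gamma>. indicator A s *\<^sub>R c A)"

lemma step_fun_eq:
  assumes "finite \<Gamma>" "disjoint \<Gamma>" "A \<in> \<Gamma>" "s \<in> A"
  shows "step_fun \<Gamma> c s = c A"
proof -
  have "step_fun \<Gamma> c s = (\<Sum>A'\<in>\<Gamma>. if A' = A then c A' else 0)"
    unfolding step_fun_def
  proof (rule sum.cong[OF refl])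
    fix A' assume "A' \<in> \<Gamma>"
    then have "s \<in> A' \<longleftrightarrow> A' = A" using assms by (auto simp: disjoint_def)
    then show "indicator A' s *\<^sub>R c A' = (if A' = A then c A' else 0)" by (simp add: indicator_def)
  qed
  also have "\<dots> = c A" using assms by simp
  finally show ?thesis .
qed

lemma step_fun_measurable:
  fixes c :: "'a set \<Rightarrow> 'b::euclidean_space"
  assumes "\<Gamma> \<subseteq> sets M" shows "step_fun \<Gamma> c \<in> borel_measurable M"
proof -
  have "(\<lambda>s. indicator A s *\<^sub>R c A) \<in> borel_measurable M" if "A \<in> \<Gamma>" for A
    using that assms by (intro borel_measurable_scaleR borel_measurable_indicator) auto
  then show ?thesis unfolding step_fun_def[abs_def] by (rule borel_measurable_sum)
qed

context finite_measure
begin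

lemma bounded_integrable:
  fixes w :: "'a \<Rightarrow> 'b::euclidean_space"
  assumes "w \<in> borel_measurable M" "\<And>s. s \<in> space M \<Longrightarrow> norm (w s) \<le> C"
  shows "integrable M w"
  by (rule integrable_const_bound[where B = C]) (use assms AE_space[of M] in auto)

lemma integrable_indicator:
  assumes "S \<in> sets M" shows "integrable M (indicator S :: 'a \<Rightarrow> real)"
  by (rule bounded_integrable[where C = 1]) (use assms in \<open>auto simp: indicator_def\<close>)

lemma norm_set_integral_le:
  fixes w :: "'a \<Rightarrow> 'b::euclidean_space"
  assumes w: "w \<in> borel_measurable M" "\<And>s. s \<in> space M \<Longrightarrow> norm (w s) \<le> C" and S: "S \<in> sets M"
  shows "norm (LINT s:S|M. w s) \<le> C * measure M S"
proof -
  have i: "integrable M w" by (rule bounded_integrable[OF w])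
  have "norm (LINT s:S|M. w s) \<le> (LINT s|M. norm (indicator S s *\<^sub>R w s))"
    unfolding set_lebesgue_integral_def by (rule integral_norm_bound)
  also have "\<dots> \<le> (LINT s|M. indicator S s * C)"
  proof (rule integral_mono)
    show "integrable M (\<lambda>s. norm (indicator S s *\<^sub>R w s))"
      by (rule integrable_norm[OF integrable_mult_indicator[OF S i]])
    show "integrable M (\<lambda>s. indicator S s * C)" using integrable_indicator[OF S] by simp
  qed (use w in \<open>auto simp: indicator_def\<close>)
  also have "\<dots> = C * measure M S" using sets.sets_into_space[OF S] by (simp add: Int_absorb2)
  finally show ?thesis .
qed

text \<open>Jensen's inequality for the square, on a cell. On a null cell the mean is zero by the convention
for division.\<close>

lemma mean_sq_le:
  fixes w :: "'a \<Rightarrow> 'b::euclidean_space"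
  assumes w: "sq_integrable M w" and A: "A \<in> sets M"
  shows "measure M A * (norm ((1 / measure M A) *\<^sub>R (LINT s:A|M. w s)))\<^sup>2 \<le> (LINT s:A|M. (norm (w s))\<^sup>2)"
proof (cases "measure M A = 0")
  case True
  then show ?thesis unfolding set_lebesgue_integral_def by simp
next
  case False
  then have pos: "0 < measure M A" by (simp add: zero_less_measure_iff)
  let ?w = "\<lambda>s. indicator A s *\<^sub>R w s"
  have one: "sq_integrable M (indicator A :: 'a \<Rightarrow> real)"
  proof (rule sq_integrable_bound(1))
    show "sq_integrable M (\<lambda>_. 1 :: real)" by (rule sq_integrable_const) unfold_locales
  qed (use A in \<open>auto simp: indicator_def\<close>)
  have wA: "sq_integrable M ?w"
    by (rule sq_integrable_bound(1)[OF w]) (use A sq_integrable_measurable[OF w] in \<open>auto simp: indicator_def\<close>)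
  have n1: "(l2norm M (indicator A :: 'a \<Rightarrow> real))\<^sup>2 = measure M A"
  proof -
    have "(\<lambda>s. (norm (indicator A s :: real))\<^sup>2) = indicator A" by (auto simp: indicator_def)
    then show ?thesis using sets.sets_into_space[OF A] by (simp add: l2norm_power2 Int_absorb2)
  qed
  have n2: "(l2norm M ?w)\<^sup>2 = (LINT s:A|M. (norm (w s))\<^sup>2)"
    unfolding l2norm_power2 set_lebesgue_integral_def
    by (rule Bochner_Integration.integral_cong) (auto simp: indicator_def)
  have "norm (LINT s:A|M. w s) \<le> (LINT s|M. norm (?w s))"
    unfolding set_lebesgue_integral_def by (rule integral_norm_bound)
  also have "\<dots> = (LINT s|M. norm (indicator A s :: real) * norm (?w s))"
    by (rule Bochner_Integration.integral_cong) (auto simp: indicator_def)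
  also have "\<dots> \<le> l2norm M (indicator A :: 'a \<Rightarrow> real) * l2norm M ?w" by (rule cauchy_schwarz_l2[OF one wA])
  finally have "(norm (LINT s:A|M. w s))\<^sup>2 \<le> (l2norm M (indicator A :: 'a \<Rightarrow> real) * l2norm M ?w)\<^sup>2"
    by (rule power_mono) simp
  then have "(norm (LINT s:A|M. w s))\<^sup>2 \<le> measure M A * (LINT s:A|M. (norm (w s))\<^sup>2)"
    by (simp add: power_mult_distrib n1 n2)
  then show ?thesis using pos by (simp add: power_divide field_simps power2_eq_square)
qed

lemma set_integral_sum_partition:
  fixes w :: "'a \<Rightarrow> 'b::euclidean_space"
  assumes G: "finite G" "disjoint G" "G \<subseteq> sets M" and w: "integrable M w"
  shows "(LINT s:\<Union>G|M. w s) = (\<Sum>A\<in>G. (LINT s:A|M. w s))"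
proof -
  have "indicator (\<Union>G) s *\<^sub>R w s = (\<Sum>A\<in>G. indicator A s *\<^sub>R w s)" for s
  proof (cases "s \<in> \<Union>G")
    case True
    then obtain A where "A \<in> G" "s \<in> A" by blast
    with step_fun_eq[OF G(1,2) this, of "\<lambda>_. w s"] True show ?thesis by (simp add: step_fun_def)
  next
    case False
    then have "indicator A s = (0::real)" if "A \<in> G" for A using that by (auto simp: indicator_def)
    then show ?thesis using False by simp
  qed
  then have "(LINT s:\<Union>G|M. w s) = (LINT s|M. (\<Sum>A\<in>G. indicator A s *\<^sub>R w s))"
    by (simp add: set_lebesgue_integral_def)
  also have "\<dots> = (\<Sum>A\<in>G. (LINT s|M. indicator A s *\<^sub>R w s))"
    by (rule Bochner_Integration.integral_sum) (use G integrable_mult_indicator[OF _ w] in auto)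
  finally show ?thesis by (simp add: set_lebesgue_integral_def)
qed

text \<open>The three errors are those of truncating at \<open>\<alpha>\<close>, averaging over the cells, and rounding the means.
The averaging error vanishes on the union of any subfamily \<open>G\<close> of cells, so it is governed by how well
such a union approximates \<open>S\<close>.\<close>

lemma discretise_control:
  fixes u :: "'a \<Rightarrow> real ^ 'm"
  assumes \<Gamma>: "finite \<Gamma>" "disjoint \<Gamma>" "\<Gamma> \<subseteq> sets M" "\<Union>\<Gamma> = space M"
    and L: "uniform_partition \<delta> \<alpha> \<Lambda>" and \<delta>: "0 < \<delta>" and \<alpha>: "0 < \<alpha>"
    and B: "finite_sphere_net \<sigma> B" and \<sigma>: "0 \<le> \<sigma>"
    and u: "sq_integrable M u" "l2norm M u \<le> \<rho>"
  obtains r b where "\<And>A. A \<in> \<Gamma> \<Longrightarrow> r A \<in> \<Lambda> \<and> b A \<in> B"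
    and "(\<Sum>A\<in>\<Gamma>. measure M A * (r A)\<^sup>2) \<le> \<rho>\<^sup>2"
    and "\<And>S G. S \<in> sets M \<Longrightarrow> G \<subseteq> \<Gamma> \<Longrightarrow>
      norm ((LINT s:S|M. u s) - (LINT s:S|M. step_fun \<Gamma> (\<lambda>A. r A *\<^sub>R b A) s))
        \<le> \<rho>\<^sup>2 / \<alpha> + 2 * \<alpha> * measure M ((S - \<Union>G) \<union> (\<Union>G - S)) + (\<delta> + \<alpha> * \<sigma>) * measure M (space M)"
proof -
  define w where "w s = (if norm (u s) \<le> \<alpha> then u s else 0)" for s
  define m where "m A = (1 / measure M A) *\<^sub>R (LINT s:A|M. w s)" for A
  have [measurable]: "u \<in> borel_measurable M" using u(1) by (rule sq_integrable_measurable)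
  have wm [measurable]: "w \<in> borel_measurable M" unfolding w_def by measurable
  have w\<alpha>: "norm (w s) \<le> \<alpha>" for s using \<alpha> by (simp add: w_def)
  have iu: "integrable M u" by (rule sq_integrable_integrable[OF u(1)])
  have iw: "integrable M w" by (rule bounded_integrable[OF wm w\<alpha>])
  have wu: "AE s in M. norm (w s) \<le> norm (u s)" by (simp add: w_def)
  have sw: "sq_integrable M w" and nw: "l2norm M w \<le> l2norm M u"
    by (rule sq_integrable_bound[OF u(1) wm wu])+
  have int_w: "(LINT s:A|M. w s) = measure M A *\<^sub>R m A" if "A \<in> \<Gamma>" for A
    using norm_set_integral_le[OF wm w\<alpha>, of A] that \<Gamma>(3) by (auto simp: m_def)
  have m\<alpha>: "norm (m A) \<le> \<alpha>" if "A \<in> \<Gamma>" for A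
  proof (cases "measure M A = 0")
    case True then show ?thesis using \<alpha> by (simp add: m_def)
  next
    case False
    then have "0 < measure M A" by (simp add: zero_less_measure_iff)
    then show ?thesis
      using norm_set_integral_le[OF wm w\<alpha>, of A] that \<Gamma>(3) by (auto simp: m_def field_simps)
  qed
  have "\<forall>A\<in>\<Gamma>. \<exists>r b. r \<in> \<Lambda> \<and> b \<in> B \<and> 0 \<le> r \<and> r \<le> norm (m A) \<and> norm (m A - r *\<^sub>R b) \<le> \<delta> + \<alpha> * \<sigma>"
    using polar_round[OF L \<delta> B m\<alpha> \<sigma>] by blast
  then obtain r b where rb: "\<And>A. A \<in> \<Gamma> \<Longrightarrow> r A \<in> \<Lambda> \<and> b A \<in> B \<and> 0 \<le> r A \<and> r A \<le> norm (m A) \<and>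
      norm (m A - r A *\<^sub>R b A) \<le> \<delta> + \<alpha> * \<sigma>"
    by metis
  define v where "v = step_fun \<Gamma> (\<lambda>A. r A *\<^sub>R b A)"
  define mb where "mb = step_fun \<Gamma> m"
  have vm: "v \<in> borel_measurable M" and mm: "mb \<in> borel_measurable M"
    unfolding v_def mb_def by (rule step_fun_measurable[OF \<Gamma>(3)])+
  have v_eq: "v s = r A *\<^sub>R b A" and mb_eq: "mb s = m A" if "A \<in> \<Gamma>" "s \<in> A" for s A
    unfolding v_def mb_def using that by (intro step_fun_eq[OF \<Gamma>(1,2)]; simp)+
  have b1: "norm (mb s) \<le> \<alpha>" and b2: "norm (mb s - v s) \<le> \<delta> + \<alpha> * \<sigma>" if "s \<in> space M" for s
  proof -
    have "s \<in> \<Union>\<Gamma>" using that by (simp add: \<Gamma>(4))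
    then obtain A where A: "A \<in> \<Gamma>" "s \<in> A" by (rule UnionE) blast
    show "norm (mb s) \<le> \<alpha>" "norm (mb s - v s) \<le> \<delta> + \<alpha> * \<sigma>"
      using m\<alpha>[OF A(1)] rb[OF A(1)] by (simp_all add: v_eq[OF A] mb_eq[OF A])
  qed
  have b3: "norm (w s - mb s) \<le> 2 * \<alpha>" if "s \<in> space M" for s
    using b1[OF that] w\<alpha>[of s] norm_triangle_ineq4[of "w s" "mb s"] by simp
  have im: "integrable M mb" by (rule bounded_integrable[OF mm b1])
  have imv: "integrable M (\<lambda>s. mb s - v s)" by (rule bounded_integrable[OF _ b2]) (use mm vm in measurable)
  have iv: "integrable M v" using Bochner_Integration.integrable_diff[OF im imv] by simp
  have zero: "(LINT s:\<Union>G|M. w s - mb s) = 0" if "G \<subseteq> \<Gamma>" for G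
  proof -
    have G: "finite G" "disjoint G" "G \<subseteq> sets M"
      using finite_subset[OF that \<Gamma>(1)] pairwise_subset[OF \<Gamma>(2) that] that \<Gamma>(3) by auto
    have "(LINT s:A|M. w s - mb s) = 0" if "A \<in> G" for A
    proof -
      have A: "A \<in> \<Gamma>" "A \<in> sets M" using that \<open>G \<subseteq> \<Gamma>\<close> \<Gamma> by auto
      have "(LINT s:A|M. mb s) = (LINT s:A|M. m A)"
        unfolding set_lebesgue_integral_def
        by (rule Bochner_Integration.integral_cong)
           (use mb_eq[OF A(1)] in \<open>auto simp: indicator_def\<close>)
      also have "\<dots> = measure M A *\<^sub>R m A"
        using sets.sets_into_space[OF A(2)] integrable_indicator[OF A(2)]
        by (simp add: set_lebesgue_integral_def Int_absorb2)
      finally have "(LINT s:A|M. mb s) = (LINT s:A|M. w s)" using int_w[OF A(1)] by simp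
      then show ?thesis
        using integrable_mult_indicator[OF A(2) iw] integrable_mult_indicator[OF A(2) im]
        by (simp add: set_lebesgue_integral_def scaleR_diff_right)
    qed
    then show ?thesis
      using set_integral_sum_partition[OF G, of "\<lambda>s. w s - mb s"] iw im by simp
  qed
  show thesis
  proof
    show "r A \<in> \<Lambda> \<and> b A \<in> B" if "A \<in> \<Gamma>" for A using rb[OF that] by blast
    have "(\<Sum>A\<in>\<Gamma>. measure M A * (r A)\<^sup>2) \<le> (\<Sum>A\<in>\<Gamma>. (LINT s:A|M. (norm (w s))\<^sup>2))"
    proof (rule sum_mono)
      fix A assume A: "A \<in> \<Gamma>"
      have "measure M A * (r A)\<^sup>2 \<le> measure M A * (norm (m A))\<^sup>2"
        using rb[OF A] by (intro mult_left_mono power_mono) auto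
      also have "\<dots> \<le> (LINT s:A|M. (norm (w s))\<^sup>2)"
        unfolding m_def by (rule mean_sq_le[OF sw]) (use A \<Gamma> in auto)
      finally show "measure M A * (r A)\<^sup>2 \<le> (LINT s:A|M. (norm (w s))\<^sup>2)" .
    qed
    also have "\<dots> = (LINT s:space M|M. (norm (w s))\<^sup>2)"
      using set_integral_sum_partition[OF \<Gamma>(1-3) sq_integrableD[OF sw]] \<Gamma>(4) by simp
    also have "\<dots> = (l2norm M w)\<^sup>2"
      unfolding l2norm_power2 set_lebesgue_integral_def
      by (rule Bochner_Integration.integral_cong) auto
    also have "\<dots> \<le> \<rho>\<^sup>2" using nw u(2) by (intro power_mono) auto
    finally show "(\<Sum>A\<in>\<Gamma>. measure M A * (r A)\<^sup>2) \<le> \<rho>\<^sup>2" .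
    fix S G assume S: "S \<in> sets M" and G: "G \<subseteq> \<Gamma>"
    let ?D = "(S - \<Union>G) \<union> (\<Union>G - S)"
    have UG: "\<Union>G \<in> sets M" using G \<Gamma> by (intro sets.finite_Union) (auto intro: finite_subset)
    note ind = integrable_mult_indicator[OF S]
    have split: "(LINT s:S|M. u s) - (LINT s:S|M. v s)
        = (LINT s:S|M. u s - w s) + (LINT s:S|M. w s - mb s) + (LINT s:S|M. mb s - v s)"
      using ind[OF iu] ind[OF iw] ind[OF im] ind[OF iv]
      by (simp add: set_lebesgue_integral_def scaleR_diff_right)
    \<comment> \<open>Chebyshev: the truncation removes \<open>u\<close> only where \<open>norm (u s) > \<alpha>\<close>, and there
      \<open>norm (u s) \<le> (norm (u s))\<^sup>2 / \<alpha>\<close>.\<close>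
    have 1: "norm (LINT s:S|M. u s - w s) \<le> \<rho>\<^sup>2 / \<alpha>"
    proof -
      have "norm (LINT s:S|M. u s - w s) \<le> (LINT s|M. norm (indicator S s *\<^sub>R (u s - w s)))"
        unfolding set_lebesgue_integral_def by (rule integral_norm_bound)
      also have "\<dots> \<le> (LINT s|M. (norm (u s))\<^sup>2 / \<alpha>)"
      proof (rule integral_mono)
        show "integrable M (\<lambda>s. norm (indicator S s *\<^sub>R (u s - w s)))"
          by (intro integrable_norm ind Bochner_Integration.integrable_diff iu iw)
        show "integrable M (\<lambda>s. (norm (u s))\<^sup>2 / \<alpha>)" using sq_integrableD[OF u(1)] by simp
        show "norm (indicator S s *\<^sub>R (u s - w s)) \<le> (norm (u s))\<^sup>2 / \<alpha>" for s
        proof (cases "norm (u s) \<le> \<alpha>")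
          case True then show ?thesis using \<alpha> by (simp add: w_def)
        next
          case False
          then have "norm (u s) * \<alpha> \<le> norm (u s) * norm (u s)" by (intro mult_left_mono) auto
          then show ?thesis using \<alpha> False by (simp add: w_def indicator_def field_simps power2_eq_square)
        qed
      qed
      also have "\<dots> = (l2norm M u)\<^sup>2 / \<alpha>" by (simp add: l2norm_power2)
      also have "\<dots> \<le> \<rho>\<^sup>2 / \<alpha>" using u(2) \<alpha> by (intro divide_right_mono power_mono) auto
      finally show ?thesis .
    qed
    have 2: "norm (LINT s:S|M. w s - mb s) \<le> 2 * \<alpha> * measure M ?D"
    proof -
      let ?g = "\<lambda>s. w s - mb s"
      have ig: "integrable M ?g" using iw im by simp
      have gm: "?g \<in> borel_measurable M" using ig by (rule borel_measurable_integrable)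
      have D: "?D \<in> sets M" using S UG by auto
      have "(LINT s:S|M. ?g s) = (LINT s:S|M. ?g s) - (LINT s:\<Union>G|M. ?g s)" using zero[OF G] by simp
      also have "\<dots> = (LINT s|M. (indicator S s - indicator (\<Union>G) s) *\<^sub>R ?g s)"
        using ind[OF ig] integrable_mult_indicator[OF UG ig]
        by (simp add: set_lebesgue_integral_def scaleR_diff_left)
      also have "norm \<dots> \<le> (LINT s|M. norm ((indicator S s - indicator (\<Union>G) s) *\<^sub>R ?g s))"
        by (rule integral_norm_bound)
      also have "\<dots> \<le> (LINT s|M. indicator ?D s * (2 * \<alpha>))"
      proof (rule integral_mono)
        show "integrable M (\<lambda>s. norm ((indicator S s - indicator (\<Union>G) s) *\<^sub>R ?g s))"
          using ind[OF ig] integrable_mult_indicator[OF UG ig]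
          by (intro integrable_norm) (simp add: scaleR_diff_left)
        show "integrable M (\<lambda>s. indicator ?D s * (2 * \<alpha>))" using integrable_indicator[OF D] by simp
        show "norm ((indicator S s - indicator (\<Union>G) s) *\<^sub>R ?g s) \<le> indicator ?D s * (2 * \<alpha>)"
          if "s \<in> space M" for s
          using b3[OF that] \<alpha> by (auto simp: indicator_def split: if_splits)
      qed
      also have "\<dots> = 2 * \<alpha> * measure M ?D" using sets.sets_into_space[OF D] by (simp add: Int_absorb2)
      finally show ?thesis .
    qed
    have 3: "norm (LINT s:S|M. mb s - v s) \<le> (\<delta> + \<alpha> * \<sigma>) * measure M (space M)"
    proof -
      have "norm (LINT s:S|M. mb s - v s) \<le> (\<delta> + \<alpha> * \<sigma>) * measure M S"
        by (rule norm_set_integral_le[OF _ b2 S]) (use mm vm in measurable)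
      also have "\<dots> \<le> (\<delta> + \<alpha> * \<sigma>) * measure M (space M)"
        using \<delta> \<alpha> \<sigma> by (intro mult_left_mono bounded_measure) auto
      finally show ?thesis .
    qed
    show "norm ((LINT s:S|M. u s) - (LINT s:S|M. step_fun \<Gamma> (\<lambda>A. r A *\<^sub>R b A) s))
        \<le> \<rho>\<^sup>2 / \<alpha> + 2 * \<alpha> * measure M ?D + (\<delta> + \<alpha> * \<sigma>) * measure M (space M)"
      unfolding v_def[symmetric] split by (intro norm_triangle_mono add_mono 1 2 3)
  qed
qed

end

section \<open>Discrete controls are weakly dense\<close>

lemma L2_iff: "u \<in> L2 D \<longleftrightarrow> sq_integrable (lebesgue_on D) u"
  by (simp add: L2_def sq_integrable_def)

lemma L2_norm_eq: "L2_norm D u = l2norm (lebesgue_on D) u"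
  by (simp add: L2_norm_def l2norm_def)

lemma sets_lebesgue_on_iff:
  "E \<in> sets lebesgue \<Longrightarrow> A \<in> sets (lebesgue_on E) \<longleftrightarrow> A \<in> sets lebesgue \<and> A \<subseteq> E"
  by (subst sets_restrict_space_iff) auto

text \<open>Choose a compact \<open>C\<close> inside \<open>B\<close> and an open \<open>U\<close> around \<open>B\<close> with little measure in between. Cells
smaller than the distance from \<open>C\<close> to the complement of \<open>U\<close> that meet \<open>C\<close> stay in \<open>U\<close>, so their union lies
between \<open>C\<close> and \<open>U\<close>.\<close>

lemma cells_approximate_set:
  fixes E :: "(real ^ 'k) set"
  assumes E: "compact E" and B: "B \<in> sets lebesgue" "B \<subseteq> E" and e: "0 < e"
  shows "\<exists>\<Delta>0>0. \<forall>\<Delta> \<Gamma>. \<Delta> \<le> \<Delta>0 \<longrightarrow> finite_partition \<Delta> E \<Gamma> \<longrightarrow>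
    (\<exists>G\<subseteq>\<Gamma>. measure lebesgue ((B - \<Union>G) \<union> (\<Union>G - B)) \<le> e)"
proof -
  have e2: "0 < e / 2" using e by simp
  obtain C where C: "closed C" "C \<subseteq> B" "B - C \<in> lmeasurable" "emeasure lebesgue (B - C) < ennreal (e / 2)"
    by (rule sets_lebesgue_inner_closed[OF B(1) e2])
  obtain U where U: "open U" "B \<subseteq> U" "U - B \<in> lmeasurable" "emeasure lebesgue (U - B) < ennreal (e / 2)"
    by (rule sets_lebesgue_outer_open[OF B(1) e2])
  have mC: "measure lebesgue (B - C) \<le> e / 2" and mU: "measure lebesgue (U - B) \<le> e / 2"
    using C(3,4) U(3,4) e by (auto simp: emeasure_eq_measure2 ennreal_less_iff)
  have "compact C"
    using E B(2) C by (meson bounded_subset compact_eq_bounded_closed compact_imp_bounded order_trans)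
  moreover have "closed (- U)" "C \<inter> - U = {}" using U C by auto
  ultimately obtain d where d: "0 < d" "\<And>x y. x \<in> C \<Longrightarrow> y \<in> - U \<Longrightarrow> d \<le> dist x y"
    using separate_compact_closed[of C "- U"] by blast
  have "\<exists>G\<subseteq>\<Gamma>. measure lebesgue ((B - \<Union>G) \<union> (\<Union>G - B)) \<le> e"
    if \<Delta>: "\<Delta> \<le> d / 2" and P: "finite_partition \<Delta> E \<Gamma>" for \<Delta> \<Gamma>
  proof (intro exI conjI)
    define G where "G = {A \<in> \<Gamma>. A \<inter> C \<noteq> {}}"
    show "G \<subseteq> \<Gamma>" by (auto simp: G_def)
    have \<Gamma>: "finite \<Gamma>" "\<Union>\<Gamma> = E" "\<And>A. A \<in> \<Gamma> \<Longrightarrow> A \<in> sets lebesgue \<and> diameter A \<le> \<Delta>"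
      using P by (auto simp: finite_partition_def)
    have UG: "\<Union>G \<in> sets lebesgue"
      using \<Gamma> \<open>G \<subseteq> \<Gamma>\<close> by (intro sets.finite_Union) (auto intro: finite_subset)
    have "C \<subseteq> E" using C B by blast
    then have CG: "C \<subseteq> \<Union>G" using \<Gamma>(2) by (auto simp: G_def)
    have GU: "\<Union>G \<subseteq> U"
    proof
      fix y assume "y \<in> \<Union>G"
      then obtain A x where A: "A \<in> \<Gamma>" "y \<in> A" "x \<in> A" "x \<in> C" by (auto simp: G_def)
      have "bounded A"
        using A(1) \<Gamma>(2) compact_imp_bounded[OF E] by (meson Union_upper bounded_subset)
      then have "dist x y \<le> diameter A" using A by (intro diameter_bounded_bound)
      then have "dist x y < d" using \<Gamma>(3)[OF A(1)] \<Delta> d(1) by simp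
      then show "y \<in> U" using d(2)[OF A(4), of y] by force
    qed
    have "measure lebesgue ((B - \<Union>G) \<union> (\<Union>G - B)) \<le> measure lebesgue ((B - C) \<union> (U - B))"
      by (rule measure_mono_fmeasurable) (use CG GU C U UG B in \<open>auto intro: fmeasurable.Un\<close>)
    also have "\<dots> \<le> measure lebesgue (B - C) + measure lebesgue (U - B)"
      by (rule measure_Un_le) (use C U in \<open>auto simp: fmeasurableD\<close>)
    also have "\<dots> \<le> e" using mC mU by simp
    finally show "measure lebesgue ((B - \<Union>G) \<union> (\<Union>G - B)) \<le> e" .
  qed
  then show ?thesis using d(1) by (intro exI[of _ "d / 2"]) auto
qed

lemma finite_measure_lebesgue_on_compact: "compact E \<Longrightarrow> finite_measure (lebesgue_on E)"
  by (intro finite_measure_lebesgue_on lmeasurable_compact)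

lemma finite_partition_measurable:
  assumes "compact E" "finite_partition \<Delta> E \<Gamma>"
  shows "finite \<Gamma>" "disjoint \<Gamma>" "\<Gamma> \<subseteq> sets (lebesgue_on E)" "\<Union>\<Gamma> = space (lebesgue_on E)"
  using assms lmeasurable_compact[OF assms(1)]
  by (auto simp: finite_partition_def sets_lebesgue_on_iff fmeasurableD)

lemma measure_lebesgue_on:
  assumes "compact E" "A \<subseteq> E" shows "measure (lebesgue_on E) A = measure lebesgue A"
  using assms lmeasurable_compact[OF assms(1)] by (intro measure_restrict_space) (auto simp: fmeasurableD)

lemma discrete_controls_admissible:
  fixes E :: "(real ^ 'k) set"
  assumes E: "compact E" and P: "finite_partition \<Delta> E \<Gamma>" and B: "finite_sphere_net \<sigma> B" and \<rho>: "0 \<le> \<rho>"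
  shows "discrete_controls E \<rho> \<Gamma> \<Lambda> B \<subseteq> admissible_controls E \<rho>"
proof
  fix u assume "u \<in> discrete_controls E \<rho> \<Gamma> \<Lambda> B"
  then obtain r b where u: "sq_integrable (lebesgue_on E) u"
    and rb: "\<And>A. A \<in> \<Gamma> \<Longrightarrow> b A \<in> B \<and> (\<forall>s\<in>A. u s = r A *\<^sub>R b A)"
    and le: "(\<Sum>A\<in>\<Gamma>. measure lebesgue A * (r A)\<^sup>2) \<le> \<rho>\<^sup>2"
    unfolding discrete_controls_def L2_iff by blast
  interpret finite_measure "lebesgue_on E" by (rule finite_measure_lebesgue_on_compact[OF E])
  note \<Gamma> = finite_partition_measurable[OF E P]
  have "(LINT s|lebesgue_on E. (norm (u s))\<^sup>2) = (LINT s:\<Union>\<Gamma>|lebesgue_on E. (norm (u s))\<^sup>2)"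
    unfolding set_lebesgue_integral_def \<Gamma>(4)
    by (rule Bochner_Integration.integral_cong) auto
  also have "\<dots> = (\<Sum>A\<in>\<Gamma>. (LINT s:A|lebesgue_on E. (norm (u s))\<^sup>2))"
    by (rule set_integral_sum_partition[OF \<Gamma>(1-3) sq_integrableD[OF u]])
  also have "\<dots> = (\<Sum>A\<in>\<Gamma>. measure lebesgue A * (r A)\<^sup>2)"
  proof (rule sum.cong[OF refl])
    fix A assume A: "A \<in> \<Gamma>"
    have "norm (b A) = 1" using rb[OF A] B by (auto simp: finite_sphere_net_def)
    then have "(LINT s:A|lebesgue_on E. (norm (u s))\<^sup>2) = (LINT s|lebesgue_on E. indicator A s *\<^sub>R (r A)\<^sup>2)"
      unfolding set_lebesgue_integral_def
      by (intro Bochner_Integration.integral_cong) (use rb[OF A] in \<open>auto simp: indicator_def\<close>)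
    also have "\<dots> = measure lebesgue A * (r A)\<^sup>2"
    proof -
      have "A \<subseteq> E" using A \<Gamma>(4) by auto
      then show ?thesis using measure_lebesgue_on[OF E] by (simp add: Int_absorb2)
    qed
    finally show "(LINT s:A|lebesgue_on E. (norm (u s))\<^sup>2) = measure lebesgue A * (r A)\<^sup>2" .
  qed
  finally have "l2norm (lebesgue_on E) u \<le> \<rho>" using le \<rho> by (intro l2norm_leI) auto
  then show "u \<in> admissible_controls E \<rho>" using u by (simp add: admissible_controls_def L2_iff L2_norm_eq)
qed

lemma (in finite_measure) step_fun_sq_integrable:
  fixes c :: "'a set \<Rightarrow> 'b::euclidean_space"
  assumes "\<Gamma> \<subseteq> sets M" shows "sq_integrable M (step_fun \<Gamma> c)"
proof (rule sq_integrable_bound(1))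
  show "sq_integrable M (\<lambda>_. \<Sum>A\<in>\<Gamma>. norm (c A))" by (rule sq_integrable_const) unfold_locales
  show "step_fun \<Gamma> c \<in> borel_measurable M" by (rule step_fun_measurable[OF assms])
  have "norm (step_fun \<Gamma> c s) \<le> (\<Sum>A\<in>\<Gamma>. norm (c A))" for s
    unfolding step_fun_def by (rule sum_norm_le) (simp add: indicator_def)
  then show "AE s in M. norm (step_fun \<Gamma> c s) \<le> norm (\<Sum>A\<in>\<Gamma>. norm (c A))"
    by (intro AE_I2) (simp add: sum_nonneg)
qed

text \<open>The level \<open>\<alpha>\<close> is fixed first, from \<open>\<eta>\<close> alone; the fineness of the partitions and the net may then
depend on it. The parameters are independent of \<open>u\<close>, which is what makes the final estimate uniform.\<close>

lemma discrete_controls_weakly_dense: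
  fixes E :: "(real ^ 'k) set" and \<B> :: "(real ^ 'k) set set"
  assumes E: "compact E" and \<B>: "finite \<B>" "\<B> \<subseteq> sets (lebesgue_on E)" and \<eta>: "0 < \<eta>"
  shows "\<exists>\<alpha>>0. \<exists>\<Delta>s>0. \<exists>\<delta>s>0. \<exists>\<sigma>s>0. \<forall>\<Delta>\<in>{0<..\<Delta>s}. \<forall>\<delta>\<in>{0<..\<delta>s}. \<forall>\<sigma>\<in>{0<..\<sigma>s}.
    \<forall>\<Gamma> \<Lambda> (B :: (real ^ 'm) set).
      finite_partition \<Delta> E \<Gamma> \<longrightarrow> uniform_partition \<delta> \<alpha> \<Lambda> \<longrightarrow> finite_sphere_net \<sigma> B \<longrightarrow>
      (\<forall>u. sq_integrable (lebesgue_on E) u \<longrightarrow> l2norm (lebesgue_on E) u \<le> \<rho> \<longrightarrow>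
        (\<exists>v\<in>discrete_controls E \<rho> \<Gamma> \<Lambda> B. weakly_close (lebesgue_on E) \<B> \<eta> u v))"
proof -
  let ?M = "lebesgue_on E"
  interpret finite_measure ?M by (rule finite_measure_lebesgue_on_compact[OF E])
  have Es: "E \<in> sets lebesgue" using lmeasurable_compact[OF E] by (rule fmeasurableD)
  define m where "m = measure ?M (space ?M) + 1"
  have m: "0 < m" "measure ?M (space ?M) \<le> m"
    using measure_nonneg[of ?M "space ?M"] by (simp_all add: m_def add_pos_nonneg add.commute del: measure_nonneg)
  \<comment> \<open>The budget is \<open>\<eta> / 4\<close> for truncation, \<open>\<eta> / 4\<close> for averaging and \<open>\<eta> / 2\<close> for rounding. Adding 1
    here and in \<open>m\<close> keeps the denominators positive.\<close>
  define \<alpha> where "\<alpha> = 4 * \<rho>\<^sup>2 / \<eta> + 1"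
  have \<alpha>: "0 < \<alpha>" using \<eta> by (simp add: \<alpha>_def add_nonneg_pos)
  have \<alpha>_le: "\<rho>\<^sup>2 / \<alpha> \<le> \<eta> / 4" using \<eta> \<alpha> by (simp add: \<alpha>_def field_simps)
  define e where "e = \<eta> / (8 * \<alpha>)"
  have e: "0 < e" using \<eta> \<alpha> by (simp add: e_def)
  define \<delta>s where "\<delta>s = \<eta> / (4 * m)"
  define \<sigma>s where "\<sigma>s = \<eta> / (4 * \<alpha> * m)"
  have \<delta>s: "0 < \<delta>s" and \<sigma>s: "0 < \<sigma>s" using \<eta> \<alpha> m by (auto simp: \<delta>s_def \<sigma>s_def)
  have "\<forall>B\<in>\<B>. \<exists>\<Delta>0>0. \<forall>\<Delta> \<Gamma>. \<Delta> \<le> \<Delta>0 \<longrightarrow> finite_partition \<Delta> E \<Gamma> \<longrightarrow>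
      (\<exists>G\<subseteq>\<Gamma>. measure lebesgue ((B - \<Union>G) \<union> (\<Union>G - B)) \<le> e)"
    using \<B> sets_lebesgue_on_iff[OF Es] by (intro ballI cells_approximate_set[OF E _ _ e]) auto
  then obtain D where D: "\<And>B. B \<in> \<B> \<Longrightarrow> 0 < D B"
    and cells: "\<And>B \<Delta> \<Gamma>. B \<in> \<B> \<Longrightarrow> \<Delta> \<le> D B \<Longrightarrow> finite_partition \<Delta> E \<Gamma> \<Longrightarrow>
      \<exists>G\<subseteq>\<Gamma>. measure lebesgue ((B - \<Union>G) \<union> (\<Union>G - B)) \<le> e"
    by metis
  define \<Delta>s where "\<Delta>s = Min (insert 1 (D ` \<B>))"
  have \<Delta>s: "0 < \<Delta>s" using \<B>(1) D by (auto simp: \<Delta>s_def)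
  have \<Delta>s_le: "\<Delta>s \<le> D B" if "B \<in> \<B>" for B
    unfolding \<Delta>s_def by (rule Min_le) (use \<B>(1) that in auto)
  have main: "\<exists>v\<in>discrete_controls E \<rho> \<Gamma> \<Lambda> N. weakly_close ?M \<B> \<eta> u v"
    if \<Delta>: "\<Delta> \<in> {0<..\<Delta>s}" and \<delta>: "\<delta> \<in> {0<..\<delta>s}" and \<sigma>: "\<sigma> \<in> {0<..\<sigma>s}"
      and P: "finite_partition \<Delta> E \<Gamma>" and L: "uniform_partition \<delta> \<alpha> \<Lambda>" and N: "finite_sphere_net \<sigma> N"
      and u: "sq_integrable ?M u" "l2norm ?M u \<le> \<rho>"
    for \<Delta> \<delta> \<sigma> \<Gamma> \<Lambda> and N :: "(real ^ 'm) set" and u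
  proof -
    note \<Gamma> = finite_partition_measurable[OF E P]
    have \<delta>0: "0 < \<delta>" "\<delta> \<le> \<delta>s" and \<sigma>0: "0 \<le> \<sigma>" "\<sigma> \<le> \<sigma>s" using \<delta> \<sigma> by auto
    obtain r b where rb: "\<And>A. A \<in> \<Gamma> \<Longrightarrow> r A \<in> \<Lambda> \<and> b A \<in> N"
      and le: "(\<Sum>A\<in>\<Gamma>. measure ?M A * (r A)\<^sup>2) \<le> \<rho>\<^sup>2"
      and est: "\<And>S G. S \<in> sets ?M \<Longrightarrow> G \<subseteq> \<Gamma> \<Longrightarrow>
        norm ((LINT s:S|?M. u s) - (LINT s:S|?M. step_fun \<Gamma> (\<lambda>A. r A *\<^sub>R b A) s))
          \<le> \<rho>\<^sup>2 / \<alpha> + 2 * \<alpha> * measure ?M ((S - \<Union>G) \<union> (\<Union>G - S)) + (\<delta> + \<alpha> * \<sigma>) * measure ?M (space ?M)"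
      by (rule discretise_control[OF \<Gamma> L \<delta>0(1) \<alpha> N \<sigma>0(1) u]) blast
    let ?v = "step_fun \<Gamma> (\<lambda>A. r A *\<^sub>R b A)"
    have "(\<Sum>A\<in>\<Gamma>. measure lebesgue A * (r A)\<^sup>2) = (\<Sum>A\<in>\<Gamma>. measure ?M A * (r A)\<^sup>2)"
    proof (rule sum.cong[OF refl])
      fix A assume "A \<in> \<Gamma>"
      then have "A \<subseteq> E" using \<Gamma>(4) by auto
      from measure_lebesgue_on[OF E this]
      show "measure lebesgue A * (r A)\<^sup>2 = measure ?M A * (r A)\<^sup>2" by simp
    qed
    then have le': "(\<Sum>A\<in>\<Gamma>. measure lebesgue A * (r A)\<^sup>2) \<le> \<rho>\<^sup>2" using le by simp
    have "\<forall>A\<in>\<Gamma>. r A \<in> \<Lambda> \<and> b A \<in> N \<and> (\<forall>s\<in>A. ?v s = r A *\<^sub>R b A)"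
    proof
      fix A assume A: "A \<in> \<Gamma>"
      show "r A \<in> \<Lambda> \<and> b A \<in> N \<and> (\<forall>s\<in>A. ?v s = r A *\<^sub>R b A)"
        using rb[OF A] step_fun_eq[OF \<Gamma>(1,2) A, of _ "\<lambda>A. r A *\<^sub>R b A"] by simp
    qed
    then have "?v \<in> discrete_controls E \<rho> \<Gamma> \<Lambda> N"
      unfolding discrete_controls_def L2_iff
      using step_fun_sq_integrable[OF \<Gamma>(3), of "\<lambda>A. r A *\<^sub>R b A"] le' by blast
    moreover have "weakly_close ?M \<B> \<eta> u ?v"
      unfolding weakly_close_def
    proof
      fix B assume B: "B \<in> \<B>"
      have "\<Delta> \<le> D B" using \<Delta> \<Delta>s_le[OF B] by simp
      from cells[OF B this P] obtain G where G: "G \<subseteq> \<Gamma>"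
        and "measure lebesgue ((B - \<Union>G) \<union> (\<Union>G - B)) \<le> e" by (elim exE conjE)
      moreover have "(B - \<Union>G) \<union> (\<Union>G - B) \<subseteq> E"
      proof -
        have "B \<subseteq> E" using B \<B>(2) sets_lebesgue_on_iff[OF Es] by blast
        moreover have "\<Union>G \<subseteq> E" using Union_mono[OF G] \<Gamma>(4) by simp
        ultimately show ?thesis by blast
      qed
      ultimately have Ge: "measure ?M ((B - \<Union>G) \<union> (\<Union>G - B)) \<le> e"
        using measure_lebesgue_on[OF E] by simp
      have "norm ((LINT s:B|?M. u s) - (LINT s:B|?M. ?v s))
          \<le> \<rho>\<^sup>2 / \<alpha> + 2 * \<alpha> * measure ?M ((B - \<Union>G) \<union> (\<Union>G - B)) + (\<delta> + \<alpha> * \<sigma>) * measure ?M (space ?M)"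
        by (rule est) (use B \<B>(2) G in auto)
      also have "\<dots> \<le> \<eta> / 4 + 2 * \<alpha> * e + (\<delta>s + \<alpha> * \<sigma>s) * m"
      proof (intro add_mono \<alpha>_le)
        show "2 * \<alpha> * measure ?M ((B - \<Union>G) \<union> (\<Union>G - B)) \<le> 2 * \<alpha> * e"
          by (rule mult_left_mono[OF Ge]) (use \<alpha> in simp)
        have "\<delta> + \<alpha> * \<sigma> \<le> \<delta>s + \<alpha> * \<sigma>s" by (intro add_mono \<delta>0 mult_left_mono \<sigma>0) (use \<alpha> in simp)
        moreover have "0 \<le> \<delta>s + \<alpha> * \<sigma>s" using \<alpha> \<delta>s \<sigma>s by simp
        ultimately show "(\<delta> + \<alpha> * \<sigma>) * measure ?M (space ?M) \<le> (\<delta>s + \<alpha> * \<sigma>s) * m"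
          by (intro mult_mono m measure_nonneg)
      qed
      also have "\<dots> = \<eta>" using \<alpha> m \<eta> by (simp add: e_def \<delta>s_def \<sigma>s_def field_simps)
      finally show "norm ((LINT s:B|?M. u s) - (LINT s:B|?M. ?v s)) \<le> \<eta>" .
    qed
    ultimately show ?thesis by blast
  qed
  show ?thesis
    by (rule exI[of _ \<alpha>], rule conjI[OF \<alpha>], rule exI[of _ \<Delta>s], rule conjI[OF \<Delta>s],
        rule exI[of _ \<delta>s], rule conjI[OF \<delta>s], rule exI[of _ \<sigma>s], rule conjI[OF \<sigma>s])
       (intro ballI allI impI, rule main)
qed

section \<open>Lebesgue measure on a product and regular representatives\<close>

text \<open>By completeness of Lebesgue measure the second function is automatically measurable.\<close>

lemma lebesgue_on_AE_cong:
  fixes g h :: "'a::euclidean_space \<Rightarrow> 'b::euclidean_space"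
  assumes E: "E \<in> sets lebesgue" and g: "integrable (lebesgue_on E) g" and eq: "AE s in lebesgue_on E. g s = h s"
  shows "integrable (lebesgue_on E) h" "integral\<^sup>L (lebesgue_on E) h = integral\<^sup>L (lebesgue_on E) g"
proof -
  let ?g = "\<lambda>s. if s \<in> E then g s else 0" and ?h = "\<lambda>s. if s \<in> E then h s else 0"
  have gm: "g \<in> borel_measurable (lebesgue_on E)" using g by (rule borel_measurable_integrable)
  have g0: "?g \<in> borel_measurable lebesgue" by (rule borel_measurable_if_I[OF gm E])
  have ae: "AE s in lebesgue. ?g s = ?h s"
    using eq E by (subst (asm) AE_restrict_space_iff) auto
  have "?h \<in> borel_measurable lebesgue"
  proof (rule measurableI)
    fix A :: "'b set" assume A: "A \<in> sets borel"
    show "?h -` A \<inter> space lebesgue \<in> sets lebesgue"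
    proof (rule completion.in_sets_AE)
      show "?g -` A \<inter> space lebesgue \<in> sets lebesgue" using g0 A by (rule measurable_sets)
      show "AE x in lebesgue. x \<in> ?g -` A \<inter> space lebesgue \<longleftrightarrow> x \<in> ?h -` A \<inter> space lebesgue"
        using ae by eventually_elim simp
    qed simp
  qed simp
  then have hm: "h \<in> borel_measurable (lebesgue_on E)" by (rule borel_measurable_if_D)
  show "integrable (lebesgue_on E) h" by (rule integrable_cong_AE_imp[OF g hm]) (use eq in auto)
  show "integral\<^sup>L (lebesgue_on E) h = integral\<^sup>L (lebesgue_on E) g"
    by (rule integral_cong_AE[OF hm gm]) (use eq in auto)
qed

lemma AE_lebesgue_on_null:
  assumes "E \<in> sets lebesgue" "AE s in lebesgue_on E. P s"
  obtains N where "N \<in> null_sets lborel" "\<And>s. s \<in> E \<Longrightarrow> s \<notin> N \<Longrightarrow> P s"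
proof -
  have "AE s in lebesgue. s \<in> E \<longrightarrow> P s"
    using assms by (subst (asm) AE_restrict_space_iff) auto
  then have "AE s in lborel. s \<in> E \<longrightarrow> P s" by (simp add: AE_completion_iff)
  then obtain N where "N \<in> null_sets lborel" "{s \<in> space lborel. \<not> (s \<in> E \<longrightarrow> P s)} \<subseteq> N"
    unfolding eventually_ae_filter by blast
  then show thesis by (intro that[of N]) auto
qed

lemma AE_lebesgue_on_notin:
  assumes "E \<in> sets lebesgue" "N \<in> null_sets lborel"
  shows "AE s in lebesgue_on E. s \<notin> N"
proof -
  have "AE s in lebesgue. s \<notin> N" using assms(2) by (intro AE_completion AE_not_in)
  then show ?thesis using assms(1) by (subst AE_restrict_space_iff) auto
qed

lemma AE_lebesgue_on_sections_notin:
  fixes N :: "('a::euclidean_space \<times> 'b::euclidean_space) set"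
  assumes E: "E \<in> sets lebesgue" "F \<in> sets lebesgue" and N: "N \<in> null_sets lborel"
  shows "AE \<xi> in lebesgue_on E. AE s in lebesgue_on F. (\<xi>, s) \<notin> N"
proof -
  have "AE p in lborel \<Otimes>\<^sub>M lborel. p \<notin> N" using N by (simp add: lborel_prod AE_not_in)
  from lborel_pair.AE_pair[OF this]
  have "AE \<xi> in lborel. AE s in lborel. (\<xi>, s) \<notin> N" .
  then have "AE \<xi> in lebesgue. AE s in lborel. (\<xi>, s) \<notin> N" by (rule AE_completion)
  then have "AE \<xi> in lebesgue. AE s in lebesgue_on F. (\<xi>, s) \<notin> N"
  proof eventually_elim
    case (elim \<xi>)
    then have "AE s in lebesgue. (\<xi>, s) \<notin> N" by (rule AE_completion)
    then show ?case using E by (subst AE_restrict_space_iff) auto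
  qed
  then show ?thesis using E by (subst AE_restrict_space_iff) auto
qed

lemma borel_measurable_pair_lebesgue_on:
  fixes g :: "'a::euclidean_space \<times> 'b::euclidean_space \<Rightarrow> 'c::euclidean_space"
  assumes "g \<in> borel_measurable borel"
  shows "g \<in> borel_measurable (lebesgue_on E \<Otimes>\<^sub>M lebesgue_on F)"
proof -
  have id: "(\<lambda>x. x) \<in> borel_measurable (lebesgue_on D)" for D :: "'d::euclidean_space set"
    using id_borel_measurable_lebesgue_on[of D] by (simp add: id_def)
  have 1: "fst \<in> borel_measurable (lebesgue_on E \<Otimes>\<^sub>M lebesgue_on F)"
    by (rule measurable_compose[OF measurable_fst id])
  have 2: "snd \<in> borel_measurable (lebesgue_on E \<Otimes>\<^sub>M lebesgue_on F)"
    by (rule measurable_compose[OF measurable_snd id])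
  from measurable_compose[OF borel_measurable_Pair[OF 1 2] assms] show ?thesis by simp
qed

text \<open>Split both sets into a Borel part and a part of a null set; the product differs from the product of
the Borel parts by a subset of two null strips.\<close>

lemma times_lebesgue:
  fixes A :: "'a::euclidean_space set" and B :: "'b::euclidean_space set"
  assumes A: "A \<in> sets lebesgue" and B: "B \<in> sets lebesgue"
  shows "A \<times> B \<in> sets lebesgue" "emeasure lebesgue (A \<times> B) = emeasure lebesgue A * emeasure lebesgue B"
proof -
  obtain S N N' where S: "A = S \<union> N" "N \<subseteq> N'" "N' \<in> null_sets lborel" "S \<in> sets lborel"
    by (rule sets_completionE[OF A])
  obtain T K K' where T: "B = T \<union> K" "K \<subseteq> K'" "K' \<in> null_sets lborel" "T \<in> sets lborel"
    by (rule sets_completionE[OF B])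
  have "N' \<times> UNIV \<in> null_sets (lborel \<Otimes>\<^sub>M lborel)" 
    using S(3) by (auto simp: null_sets_def lborel.emeasure_pair_measure_Times)
  moreover have "UNIV \<times> K' \<in> null_sets (lborel \<Otimes>\<^sub>M lborel)"
    using T(3) by (auto simp: null_sets_def lborel.emeasure_pair_measure_Times)
  ultimately have "N' \<times> UNIV \<union> UNIV \<times> K' \<in> null_sets (lborel \<Otimes>\<^sub>M lborel)"
    by (rule null_sets.Un)
  then have "N' \<times> (UNIV :: 'b set) \<union> (UNIV :: 'a set) \<times> K' \<in> null_sets lborel"
    by (simp only: lborel_prod)
  moreover have "A \<times> B - S \<times> T \<subseteq> N' \<times> UNIV \<union> UNIV \<times> K'" using S T by auto
  ultimately have R: "A \<times> B - S \<times> T \<in> null_sets lebesgue" unfolding null_sets_completion_iff2 by blast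
  have ST: "S \<times> T \<in> sets (lborel \<Otimes>\<^sub>M lborel)" using S T by (intro pair_measureI)
  then have ST': "S \<times> T \<in> sets lborel" by (simp only: lborel_prod)
  have eq: "A \<times> B = S \<times> T \<union> (A \<times> B - S \<times> T)" using S T by auto
  show "A \<times> B \<in> sets lebesgue"
    by (subst eq, rule sets.Un[OF sets_completionI_sets[OF ST'] null_setsD2[OF R]])
  have "emeasure lebesgue (A \<times> B) = emeasure lebesgue (S \<times> T)"
    by (subst eq, rule emeasure_Un_null_set[OF sets_completionI_sets[OF ST'] R])
  also have "\<dots> = emeasure lborel (S \<times> T)" using ST' by simp
  also have "\<dots> = emeasure (lborel \<Otimes>\<^sub>M lborel) (S \<times> T)" by (simp add: lborel_prod)
  also have "\<dots> = emeasure lborel S * emeasure lborel T"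
    by (rule lborel.emeasure_pair_measure_Times[OF S(4) T(4)])
  also have "\<dots> = emeasure lebesgue A * emeasure lebesgue B"
  proof -
    have "N \<in> null_sets lebesgue" "K \<in> null_sets lebesgue"
      unfolding null_sets_completion_iff2 using S T by auto
    then show ?thesis using S T by (simp add: emeasure_Un_null_set)
  qed
  finally show "emeasure lebesgue (A \<times> B) = emeasure lebesgue A * emeasure lebesgue B" .
qed

text \<open>The product measure is the restriction of Lebesgue measure on the product to a smaller sigma-algebra.
Integrals of functions measurable for the latter therefore agree.\<close>

lemma pair_lebesgue_on_subalgebra:
  fixes E :: "'a::euclidean_space set" and F :: "'b::euclidean_space set"
  assumes E: "E \<in> lmeasurable" and F: "F \<in> lmeasurable"
  shows "sets (lebesgue_on E \<Otimes>\<^sub>M lebesgue_on F) \<subseteq> sets (lebesgue_on (E \<times> F))"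
    and "space (lebesgue_on E \<Otimes>\<^sub>M lebesgue_on F) = space (lebesgue_on (E \<times> F))"
    and "A \<in> sets (lebesgue_on E \<Otimes>\<^sub>M lebesgue_on F) \<Longrightarrow>
      emeasure (lebesgue_on E \<Otimes>\<^sub>M lebesgue_on F) A = emeasure (lebesgue_on (E \<times> F)) A"
proof -
  let ?P = "lebesgue_on E \<Otimes>\<^sub>M lebesgue_on F" and ?L = "lebesgue_on (E \<times> F)"
  have Es: "E \<in> sets lebesgue" and Fs: "F \<in> sets lebesgue" using E F by (auto simp: fmeasurableD)
  have EF: "E \<times> F \<in> sets lebesgue" by (rule times_lebesgue[OF Es Fs])
  have iff: "C \<in> sets (lebesgue_on D) \<longleftrightarrow> C \<in> sets lebesgue \<and> C \<subseteq> D" if "D \<in> sets lebesgue"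
    for C D :: "'c::euclidean_space set"
    using that by (subst sets_restrict_space_iff) auto
  have rect: "X \<times> Y \<in> sets ?L" if "X \<in> sets (lebesgue_on E)" "Y \<in> sets (lebesgue_on F)" for X Y
    using that times_lebesgue[of X Y] Es Fs EF by (auto simp: iff)
  show sp: "space ?P = space ?L" by (simp add: space_pair_measure)
  show sub: "sets ?P \<subseteq> sets ?L"
    unfolding sets_pair_measure by (rule sets.sigma_sets_subset'[of _ ?L, simplified]) (use rect in auto)
  then have sa: "subalgebra ?L ?P" using sp by (simp add: subalgebra_def)
  interpret E: finite_measure "lebesgue_on E" by (rule finite_measure_lebesgue_on[OF E])
  interpret F: finite_measure "lebesgue_on F" by (rule finite_measure_lebesgue_on[OF F])
  have "?P = restr_to_subalg ?L ?P"
  proof (rule pair_measure_eqI)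
    show "sigma_finite_measure (lebesgue_on E)" "sigma_finite_measure (lebesgue_on F)" by unfold_locales
    show "sets ?P = sets (restr_to_subalg ?L ?P)" by (simp add: sets_restr_to_subalg[OF sa])
    fix X Y assume X: "X \<in> sets (lebesgue_on E)" and Y: "Y \<in> sets (lebesgue_on F)"
    have "emeasure (restr_to_subalg ?L ?P) (X \<times> Y) = emeasure ?L (X \<times> Y)"
      using X Y by (intro emeasure_restr_to_subalg[OF sa]) auto
    also have "\<dots> = emeasure lebesgue (X \<times> Y)"
      using X Y EF Es Fs by (intro emeasure_restrict_space) (auto simp: iff)
    also have "\<dots> = emeasure lebesgue X * emeasure lebesgue Y"
      using X Y Es Fs by (intro times_lebesgue) (auto simp: iff)
    also have "\<dots> = emeasure (lebesgue_on E) X * emeasure (lebesgue_on F) Y"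
      using X Y Es Fs by (simp add: emeasure_restrict_space iff)
    finally show "emeasure (lebesgue_on E) X * emeasure (lebesgue_on F) Y
        = emeasure (restr_to_subalg ?L ?P) (X \<times> Y)" by simp
  qed
  then show "A \<in> sets ?P \<Longrightarrow> emeasure ?P A = emeasure ?L A"
    using emeasure_restr_to_subalg[OF sa, of A] by simp
qed

lemma sq_integrable_pair_lebesgue_on:
  fixes g :: "'a::euclidean_space \<times> 'b::euclidean_space \<Rightarrow> 'c::euclidean_space"
  assumes E: "E \<in> lmeasurable" and F: "F \<in> lmeasurable"
    and g: "g \<in> borel_measurable (lebesgue_on E \<Otimes>\<^sub>M lebesgue_on F)"
    and h: "sq_integrable (lebesgue_on (E \<times> F)) h"
    and eq: "AE p in lebesgue_on (E \<times> F). g p = h p"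
  shows "sq_integrable (lebesgue_on E \<Otimes>\<^sub>M lebesgue_on F) g"
    and "l2norm (lebesgue_on E \<Otimes>\<^sub>M lebesgue_on F) g = l2norm (lebesgue_on (E \<times> F)) h"
proof -
  let ?P = "lebesgue_on E \<Otimes>\<^sub>M lebesgue_on F" and ?L = "lebesgue_on (E \<times> F)"
  note sub = pair_lebesgue_on_subalgebra[OF E F]
  have gL: "g \<in> borel_measurable ?L"
    using g sub(1,2) by (auto simp: measurable_def)
  have g2: "(\<lambda>p. (norm (g p))\<^sup>2) \<in> borel_measurable ?P" using g by measurable
  have "AE p in ?L. norm (g p) \<le> norm (h p)" using eq by eventually_elim simp
  from sq_integrable_bound(1)[OF h gL this] have gsq: "sq_integrable ?L g" .
  then show "sq_integrable ?P g"
    unfolding sq_integrable_def using g integrable_subalgebra[OF g2 sub] by simp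
  have "l2norm ?P g = l2norm ?L g"
    unfolding l2norm_def using integral_subalgebra[OF g2 sub] by simp
  also have "\<dots> = l2norm ?L h" by (rule l2norm_cong_AE[OF gL sq_integrable_measurable[OF h] eq])
  finally show "l2norm ?P g = l2norm ?L h" .
qed

lemma lebesgue_on_ex_borel:
  fixes g :: "'a::euclidean_space \<Rightarrow> 'b::euclidean_space"
  assumes E: "E \<in> sets lebesgue" and g: "g \<in> borel_measurable (lebesgue_on E)"
  obtains h where "h \<in> borel_measurable borel" "AE s in lebesgue_on E. g s = h s"
proof -
  let ?g = "\<lambda>s. if s \<in> E then g s else 0"
  have g0: "?g \<in> borel_measurable lebesgue" by (rule borel_measurable_if_I[OF g E])
  have "\<exists>h\<in>borel_measurable lborel. AE s in lborel. ?g s \<bullet> i = h s" for i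
    by (rule completion_ex_borel_measurable_real) (use g0 in measurable)
  then obtain H where H: "\<And>i. H i \<in> borel_measurable lborel" "\<And>i. AE s in lborel. ?g s \<bullet> i = H i s" by metis
  define h where "h s = (\<Sum>i\<in>Basis. H i s *\<^sub>R i)" for s
  have "AE s in lborel. \<forall>i\<in>Basis. ?g s \<bullet> i = H i s" using H(2) by (intro AE_finite_allI) auto
  then have "AE s in lborel. ?g s = h s"
  proof eventually_elim
    case (elim s)
    have "?g s = (\<Sum>i\<in>Basis. (?g s \<bullet> i) *\<^sub>R i)" by (simp only: euclidean_representation)
    also have "\<dots> = h s" unfolding h_def using elim by (intro sum.cong) auto
    finally show ?case .
  qed
  then have "AE s in lebesgue. ?g s = h s" by (rule AE_completion)
  then have "AE s in lebesgue_on E. g s = h s" using E by (subst AE_restrict_space_iff) auto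
  moreover have "h \<in> borel_measurable borel" unfolding h_def using H(1) by simp
  ultimately show thesis by (intro that)
qed

text \<open>Fubini's theorem needs a kernel that is measurable for the product sigma-algebra for every \<open>x\<close>, with
one exceptional null set for all \<open>x\<close>. For countably many \<open>x\<close> in a dense set the kernel has Borel
representatives off a common Borel null set \<open>N\<close>; setting the kernel to zero on \<open>N\<close> makes the Lipschitz
estimate valid everywhere, and this estimate transfers measurability from the dense set to all \<open>x\<close>.\<close>

lemma lipschitz_kernel_representative:
  fixes K :: "'a::euclidean_space \<Rightarrow> 'a \<Rightarrow> 'x::euclidean_space \<Rightarrow> 'c::euclidean_space"
    and \<gamma> :: "'a \<times> 'a \<Rightarrow> real"
  assumes E: "compact E"
    and K: "\<And>x. (\<lambda>(\<xi>, s). K \<xi> s x) \<in> borel_measurable (lebesgue_on (E \<times> E))"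
    and \<gamma>: "\<gamma> \<in> borel_measurable (lebesgue_on (E \<times> E))"
    and lip: "AE (\<xi>, s) in lebesgue_on (E \<times> E). \<forall>x y. norm (K \<xi> s x - K \<xi> s y) \<le> \<gamma> (\<xi>, s) * norm (x - y)"
  obtains K' \<gamma>' N where
    "\<And>x. (\<lambda>p. K' (fst p) (snd p) x) \<in> borel_measurable (lebesgue_on E \<Otimes>\<^sub>M lebesgue_on E)"
    "(\<lambda>p. \<gamma>' (fst p) (snd p)) \<in> borel_measurable (lebesgue_on E \<Otimes>\<^sub>M lebesgue_on E)"
    "\<And>\<xi> s x y. norm (K' \<xi> s x - K' \<xi> s y) \<le> \<gamma>' \<xi> s * norm (x - y)"
    "N \<in> null_sets lborel"
    "\<And>\<xi> s. \<xi> \<in> E \<Longrightarrow> s \<in> E \<Longrightarrow> (\<xi>, s) \<notin> N \<Longrightarrow> K' \<xi> s = K \<xi> s \<and> \<gamma>' \<xi> s = \<gamma> (\<xi>, s)"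
    "\<And>\<xi> s. (\<xi>, s) \<in> N \<Longrightarrow> \<gamma>' \<xi> s = 0"
proof -
  let ?L = "lebesgue_on (E \<times> E)"
  have EE: "compact (E \<times> E)" using E by (intro compact_Times)
  then have EEs: "E \<times> E \<in> sets lebesgue" using lmeasurable_compact fmeasurableD by blast
  obtain D :: "'x set" where D: "countable D" "\<And>X. open X \<Longrightarrow> X \<noteq> {} \<Longrightarrow> \<exists>d\<in>D. d \<in> X"
    by (erule countable_dense_setE)
  have "\<exists>h. h \<in> borel_measurable borel \<and> (AE p in ?L. K (fst p) (snd p) x = h p)" for x
  proof -
    have m: "(\<lambda>p. K (fst p) (snd p) x) \<in> borel_measurable ?L" using K[of x] by (simp add: split_beta')
    show ?thesis by (rule lebesgue_on_ex_borel[OF EEs m]) blast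
  qed
  then have "\<exists>H. \<forall>x. H x \<in> borel_measurable borel \<and> (AE p in ?L. K (fst p) (snd p) x = H x p)"
    by (intro choice allI)
  then obtain H where H: "\<And>x. H x \<in> borel_measurable borel" "\<And>x. AE p in ?L. K (fst p) (snd p) x = H x p"
    by blast
  obtain g where g: "g \<in> borel_measurable borel" "AE p in ?L. \<gamma> p = g p"
    by (rule lebesgue_on_ex_borel[OF EEs \<gamma>])
  have "AE p in ?L. \<forall>x\<in>D. K (fst p) (snd p) x = H x p"
    using H(2) D(1) by (simp add: AE_ball_countable)
  moreover have "AE p in ?L. \<forall>x y. norm (K (fst p) (snd p) x - K (fst p) (snd p) y) \<le> \<gamma> p * norm (x - y)"
    using lip by (simp add: split_beta')
  ultimately have "AE p in ?L. (\<forall>x\<in>D. K (fst p) (snd p) x = H x p) \<and> \<gamma> p = g p \<and>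
      (\<forall>x y. norm (K (fst p) (snd p) x - K (fst p) (snd p) y) \<le> \<gamma> p * norm (x - y))"
    using g(2) by eventually_elim simp
  then obtain N where N: "N \<in> null_sets lborel" and good: "\<And>p. p \<in> E \<times> E \<Longrightarrow> p \<notin> N \<Longrightarrow>
      (\<forall>x\<in>D. K (fst p) (snd p) x = H x p) \<and> \<gamma> p = g p \<and>
      (\<forall>x y. norm (K (fst p) (snd p) x - K (fst p) (snd p) y) \<le> \<gamma> p * norm (x - y))"
    by (rule AE_lebesgue_on_null[OF EEs]) blast
  define R where "R = E \<times> E - N"
  have R: "R \<in> sets borel" using N EE by (auto simp: R_def null_sets_def intro: borel_compact)
  define K' where "K' \<xi> s x = (if (\<xi>, s) \<in> R then K \<xi> s x else 0)" for \<xi> s x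
  define \<gamma>' where "\<gamma>' \<xi> s = (if (\<xi>, s) \<in> R then g (\<xi>, s) else 0)" for \<xi> s
  have lip': "norm (K' \<xi> s x - K' \<xi> s y) \<le> \<gamma>' \<xi> s * norm (x - y)" for \<xi> s x y
    using good[of "(\<xi>, s)"] by (auto simp: K'_def \<gamma>'_def R_def)
  have KD: "(\<lambda>p. K' (fst p) (snd p) x) \<in> borel_measurable borel" if x: "x \<in> D" for x
  proof -
    have "(\<lambda>p. K' (fst p) (snd p) x) = (\<lambda>p. if p \<in> R then H x p else 0)"
      using good x by (auto simp: K'_def R_def)
    moreover have "(\<lambda>p. if p \<in> R then H x p else 0) \<in> borel_measurable borel"
      using H(1)[of x] R by (intro measurable_If_set) auto
    ultimately show ?thesis by simp
  qed
  have Kx: "(\<lambda>p. K' (fst p) (snd p) x) \<in> borel_measurable borel" for x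
  proof -
    have "\<exists>d\<in>D. dist d x < inverse (real (Suc n))" for n
      using D(2)[of "ball x (inverse (real (Suc n)))"] by (auto simp: dist_commute)
    then obtain d where d: "\<And>n. d n \<in> D" "\<And>n. dist (d n) x < inverse (real (Suc n))" by metis
    have "(\<lambda>n. dist (d n) x) \<longlonglongrightarrow> 0"
      by (rule tendsto_sandwich[OF _ _ tendsto_const LIMSEQ_inverse_real_of_nat])
         (use d(2) in \<open>auto intro!: always_eventually less_imp_le\<close>)
    then have lim: "d \<longlonglongrightarrow> x" by (rule iffD2[OF tendsto_dist_iff])
    show ?thesis
    proof (rule borel_measurable_LIMSEQ_metric)
      show "(\<lambda>p. K' (fst p) (snd p) (d n)) \<in> borel_measurable borel" for n by (rule KD[OF d(1)])
      show "(\<lambda>n. K' (fst p) (snd p) (d n)) \<longlonglongrightarrow> K' (fst p) (snd p) x" for p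
        by (rule continuous_on_tendsto_compose[OF lipschitz_continuous_on_UNIV[OF lip'] lim]) auto
    qed
  qed
  have "(\<lambda>p. \<gamma>' (fst p) (snd p)) = (\<lambda>p. if p \<in> R then g p else 0)" by (auto simp: \<gamma>'_def)
  moreover have "(\<lambda>p. if p \<in> R then g p else 0) \<in> borel_measurable borel"
    using g(1) R by (intro measurable_If_set) auto
  ultimately have \<gamma>m: "(\<lambda>p. \<gamma>' (fst p) (snd p)) \<in> borel_measurable borel" by simp
  show thesis
  proof
    show "(\<lambda>p. K' (fst p) (snd p) x) \<in> borel_measurable (lebesgue_on E \<Otimes>\<^sub>M lebesgue_on E)" for x
      by (rule borel_measurable_pair_lebesgue_on[OF Kx])
    show "(\<lambda>p. \<gamma>' (fst p) (snd p)) \<in> borel_measurable (lebesgue_on E \<Otimes>\<^sub>M lebesgue_on E)"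
      by (rule borel_measurable_pair_lebesgue_on[OF \<gamma>m])
    show "norm (K' \<xi> s x - K' \<xi> s y) \<le> \<gamma>' \<xi> s * norm (x - y)" for \<xi> s x y by (rule lip')
    show "N \<in> null_sets lborel" by (rule N)
    show "K' \<xi> s = K \<xi> s \<and> \<gamma>' \<xi> s = \<gamma> (\<xi>, s)" if "\<xi> \<in> E" "s \<in> E" "(\<xi>, s) \<notin> N" for \<xi> s
      using that good[of "(\<xi>, s)"] by (auto simp: K'_def \<gamma>'_def R_def)
    show "\<gamma>' \<xi> s = 0" if "(\<xi>, s) \<in> N" for \<xi> s using that by (simp add: \<gamma>'_def R_def)
  qed
qed

lemma Linf_AE_le:
  assumes "g \<in> Linf D" shows "AE s in lebesgue_on D. \<bar>g s\<bar> \<le> Linf_norm D g"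
proof -
  let ?e = "esssup (lebesgue_on D) (\<lambda>s. ennreal \<bar>g s\<bar>)"
  have fin: "?e < \<infinity>" using assms by (simp add: Linf_def)
  have "AE s in lebesgue_on D. ennreal \<bar>g s\<bar> \<le> ?e" by (rule esssup_AE)
  then show ?thesis
  proof eventually_elim
    case (elim s)
    have "ennreal \<bar>g s\<bar> \<le> ennreal (enn2real ?e)" using elim fin by simp
    then show ?case by (simp add: Linf_norm_def)
  qed
qed

lemma Linf_norm_nonneg: "0 \<le> Linf_norm D g"
  by (simp add: Linf_norm_def)

section \<open>The approximation theorem\<close>

text \<open>Altering the data on null sets affects neither side of the integral equation, by Fubini for null sets.\<close>

lemma is_trajectory_iff_sol:
  fixes f f' :: "real ^ 'k \<Rightarrow> real ^ 'n \<Rightarrow> real ^ 'n"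
    and K1 K1' :: "real ^ 'k \<Rightarrow> real ^ 'k \<Rightarrow> real ^ 'n \<Rightarrow> real ^ 'n"
    and K2 K2' :: "real ^ 'k \<Rightarrow> real ^ 'k \<Rightarrow> real ^ 'n \<Rightarrow> real ^ 'm ^ 'n"
  assumes E: "E \<in> sets lebesgue"
    and sys: "lipschitz_system (lebesgue_on E) f' K1' K2' \<gamma>1 lam \<rho> \<kappa>0 \<kappa>1 \<kappa>2"
    and f: "AE \<xi> in lebesgue_on E. f' \<xi> = f \<xi>"
    and K: "AE \<xi> in lebesgue_on E. AE s in lebesgue_on E. K1' \<xi> s = K1 \<xi> s \<and> K2' \<xi> s = K2 \<xi> s"
    and u: "u \<in> admissible_controls E \<rho>"
  shows "is_trajectory E f K1 K2 lam u x \<longleftrightarrow> lipschitz_system.sol (lebesgue_on E) f' K1' K2' lam u x"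
proof -
  interpret lipschitz_system "lebesgue_on E" f' K1' K2' \<gamma>1 lam \<rho> \<kappa>0 \<kappa>1 \<kappa>2 by (rule sys)
  have ctrl: "ctrl u" using u by (simp add: ctrl_def admissible_controls_def L2_iff L2_norm_eq)
  let ?k = "\<lambda>\<xi> s. K1 \<xi> s (x s) + K2 \<xi> s (x s) *v u s"
  have "(AE \<xi> in lebesgue_on E. integrable (lebesgue_on E) (?k \<xi>) \<and>
        x \<xi> = f \<xi> (x \<xi>) + lam *\<^sub>R (LINT s|lebesgue_on E. ?k \<xi> s))
      \<longleftrightarrow> (AE \<xi> in lebesgue_on E. x \<xi> = traj_map u x \<xi>)" if x: "sq_integrable (lebesgue_on E) x"
  proof -
    obtain c where c: "l2_kernel (lebesgue_on E) (kern u x) c" by (rule kern_kernel[OF x ctrl])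
    have "AE \<xi> in lebesgue_on E. (integrable (lebesgue_on E) (?k \<xi>) \<and>
        x \<xi> = f \<xi> (x \<xi>) + lam *\<^sub>R (LINT s|lebesgue_on E. ?k \<xi> s)) \<longleftrightarrow> x \<xi> = traj_map u x \<xi>"
      using f K l2_kernelD(2)[OF c]
    proof eventually_elim
      case (elim \<xi>)
      have "AE s in lebesgue_on E. kern u x \<xi> s = ?k \<xi> s"
        using elim(2) by eventually_elim (simp add: kern_def)
      from lebesgue_on_AE_cong[OF E elim(3) this] elim(1)
      show ?case by (simp add: traj_map_def kint_def)
    qed
    then show ?thesis by (rule eventually_subst)
  qed
  then show ?thesis unfolding is_trajectory_def sol_def L2_iff by blast
qed


text \<open>The hypothesis \<open>condition_D\<close> makes the denominator of \<open>c_star\<close> nonnegative; otherwise the square root could be negative,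
as \<open>sqrt\<close> is odd.\<close>

lemma c_star_nonneg:
  assumes D: "condition_D M lam \<rho> \<kappa>0 \<kappa>1 \<kappa>2" and M: "0 \<le> M"
  shows "0 \<le> c_star M lam \<rho> \<kappa>0 \<kappa>1 \<kappa>2"
proof -
  define t where "t = lam\<^sup>2 * (\<kappa>1\<^sup>2 + \<rho>\<^sup>2 * \<kappa>2\<^sup>2 * M)"
  have "6 * (\<kappa>0\<^sup>2 + t) < 1" using D by (simp add: condition_D_def t_def algebra_simps)
  \<comment> \<open>With \<open>t < 1 / 6 - \<kappa>0\<^sup>2\<close> the denominator exceeds
    \<open>1 / 3 - 2 * \<kappa>0 + 5 * \<kappa>0\<^sup>2 = 5 * (\<kappa>0 - 1 / 5)\<^sup>2 + 2 / 15\<close>.\<close>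
  moreover have "0 \<le> 15 * (\<kappa>0 - 1 / 5)\<^sup>2" by simp
  ultimately have "0 \<le> (1 - \<kappa>0)\<^sup>2 - 4 * t" by (simp add: power2_eq_square algebra_simps)
  then have "0 \<le> (1 - \<kappa>0)\<^sup>2 - 4 * lam\<^sup>2 * (\<kappa>1\<^sup>2 + \<rho>\<^sup>2 * \<kappa>2\<^sup>2 * M)" by (simp add: t_def mult.assoc)
  then show ?thesis unfolding c_star_def using M by (intro real_sqrt_ge_zero divide_nonneg_nonneg) auto
qed

text \<open>For a subset, the second supremum in the Hausdorff distance vanishes.\<close>

lemma hausdorff_L2_le:
  assumes sub: "Y \<subseteq> X" and near: "\<And>x. x \<in> X \<Longrightarrow> \<exists>y\<in>Y. L2_norm D (\<lambda>s. x s - y s) \<le> \<epsilon>"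
  shows "hausdorff_L2 D X Y \<le> ennreal \<epsilon>"
  unfolding hausdorff_L2_def
proof (rule max.boundedI)
  show "(SUP x\<in>X. INF y\<in>Y. ennreal (L2_norm D (\<lambda>s. x s - y s))) \<le> ennreal \<epsilon>"
  proof (rule SUP_least)
    fix x assume "x \<in> X"
    then obtain y where "y \<in> Y" "L2_norm D (\<lambda>s. x s - y s) \<le> \<epsilon>" using near by blast
    then show "(INF y\<in>Y. ennreal (L2_norm D (\<lambda>s. x s - y s))) \<le> ennreal \<epsilon>"
      by (intro INF_lower2[of y] ennreal_leI)
  qed
  show "(SUP y\<in>Y. INF x\<in>X. ennreal (L2_norm D (\<lambda>s. x s - y s))) \<le> ennreal \<epsilon>"
  proof (rule SUP_least)
    fix y assume "y \<in> Y"
    then have "y \<in> X" using sub by blast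
    moreover have "ennreal (L2_norm D (\<lambda>s. y s - y s)) \<le> ennreal \<epsilon>" by (simp add: L2_norm_def)
    ultimately show "(INF x\<in>X. ennreal (L2_norm D (\<lambda>s. x s - y s))) \<le> ennreal \<epsilon>"
      by (intro INF_lower2[of y])
  qed
qed

text \<open>The Lipschitz factors of \<open>f\<close> and \<open>K2\<close> are first replaced by their essential bounds; only \<open>K1\<close> needs a
variable factor, since \<open>\<gamma>1\<close> is merely square-integrable.\<close>

lemma regular_representative:
  fixes E :: "(real ^ 'k) set"
    and f :: "real ^ 'k \<Rightarrow> real ^ 'n \<Rightarrow> real ^ 'n"
    and K1 :: "real ^ 'k \<Rightarrow> real ^ 'k \<Rightarrow> real ^ 'n \<Rightarrow> real ^ 'n"
    and K2 :: "real ^ 'k \<Rightarrow> real ^ 'k \<Rightarrow> real ^ 'n \<Rightarrow> real ^ 'm ^ 'n"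
  assumes E: "compact E" and lam: "0 < lam" and \<rho>: "0 < \<rho>"
    and A: "condition_A E f \<gamma>0" and B: "condition_B E K1 \<gamma>1" and C: "condition_C E K2 \<gamma>2"
    and D: "condition_D (measure lebesgue E) lam \<rho> (Linf_norm E \<gamma>0) (L2_norm (E \<times> E) \<gamma>1) (Linf_norm (E \<times> E) \<gamma>2)"
  obtains f' and K1' and K2' :: "real ^ 'k \<Rightarrow> real ^ 'k \<Rightarrow> real ^ 'n \<Rightarrow> real ^ 'm ^ 'n" and \<gamma>1' where
    "lipschitz_system (lebesgue_on E) f' K1' K2' \<gamma>1' lam \<rho>
       (Linf_norm E \<gamma>0) (L2_norm (E \<times> E) \<gamma>1) (Linf_norm (E \<times> E) \<gamma>2)"
    "AE \<xi> in lebesgue_on E. f' \<xi> = f \<xi>"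
    "AE \<xi> in lebesgue_on E. AE s in lebesgue_on E. K1' \<xi> s = K1 \<xi> s \<and> K2' \<xi> s = K2 \<xi> s"
proof -
  let ?M = "lebesgue_on E" and ?L = "lebesgue_on (E \<times> E)"
  let ?\<kappa>0 = "Linf_norm E \<gamma>0" and ?\<kappa>1 = "L2_norm (E \<times> E) \<gamma>1" and ?\<kappa>2 = "Linf_norm (E \<times> E) \<gamma>2"
  have El: "E \<in> lmeasurable" by (rule lmeasurable_compact[OF E])
  then have Es: "E \<in> sets lebesgue" by (rule fmeasurableD)
  have EEs: "E \<times> E \<in> sets lebesgue" by (rule times_lebesgue[OF Es Es])
  have "AE \<xi> in ?M. \<bar>\<gamma>0 \<xi>\<bar> \<le> ?\<kappa>0" using A by (intro Linf_AE_le) (simp add: condition_A_def)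
  moreover have "AE \<xi> in ?M. \<forall>x y. norm (f \<xi> x - f \<xi> y) \<le> \<gamma>0 \<xi> * norm (x - y)"
    using A by (simp add: condition_A_def)
  ultimately have "AE \<xi> in ?M. \<forall>x y. norm (f \<xi> x - f \<xi> y) \<le> ?\<kappa>0 * norm (x - y)"
  proof eventually_elim
    case (elim \<xi>)
    then have "\<gamma>0 \<xi> * norm (x - y) \<le> ?\<kappa>0 * norm (x - y)" for x y :: "real ^ 'n"
      by (intro mult_right_mono) auto
    then show ?case using elim(2) order_trans by blast
  qed
  then obtain N0 where N0: "N0 \<in> null_sets lborel"
    and f_good: "\<And>\<xi>. \<xi> \<in> E \<Longrightarrow> \<xi> \<notin> N0 \<Longrightarrow> \<forall>x y. norm (f \<xi> x - f \<xi> y) \<le> ?\<kappa>0 * norm (x - y)"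
    by (rule AE_lebesgue_on_null[OF Es]) blast
  define f' where "f' \<xi> x = (if \<xi> \<in> N0 then 0 else f \<xi> x)" for \<xi> x
  have f'_eq: "AE \<xi> in ?M. f' \<xi> = f \<xi>"
    using AE_lebesgue_on_notin[OF Es N0] by eventually_elim (simp add: f'_def[abs_def])
  have N0s: "N0 \<inter> space ?M \<in> sets ?M" using N0 Es by (auto simp: sets_lebesgue_on_iff null_sets_def)
  have f'_meas: "(\<lambda>\<xi>. f' \<xi> x) \<in> borel_measurable ?M" for x
    unfolding f'_def using A N0s by (intro measurable_If_set) (auto simp: condition_A_def)
  have f0: "sq_integrable ?M (\<lambda>\<xi>. f \<xi> 0)" using A by (simp add: condition_A_def L2_iff)
  have f'_0: "sq_integrable ?M (\<lambda>\<xi>. f' \<xi> 0)"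
    by (rule sq_integrable_bound(1)[OF f0 f'_meas]) (simp add: f'_def)
  have K1m: "\<And>x. (\<lambda>(\<xi>, s). K1 \<xi> s x) \<in> borel_measurable ?L" and \<gamma>1m: "\<gamma>1 \<in> borel_measurable ?L"
    and K1l: "AE (\<xi>, s) in ?L. \<forall>x y. norm (K1 \<xi> s x - K1 \<xi> s y) \<le> \<gamma>1 (\<xi>, s) * norm (x - y)"
    using B by (auto simp: condition_B_def L2_def)
  obtain K1' \<gamma>1' N1 where K1': "\<And>x. (\<lambda>p. K1' (fst p) (snd p) x) \<in> borel_measurable (?M \<Otimes>\<^sub>M ?M)"
    "(\<lambda>p. \<gamma>1' (fst p) (snd p)) \<in> borel_measurable (?M \<Otimes>\<^sub>M ?M)"
    "\<And>\<xi> s x y. norm (K1' \<xi> s x - K1' \<xi> s y) \<le> \<gamma>1' \<xi> s * norm (x - y)"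
    and N1: "N1 \<in> null_sets lborel"
    and K1'_eq: "\<And>\<xi> s. \<xi> \<in> E \<Longrightarrow> s \<in> E \<Longrightarrow> (\<xi>, s) \<notin> N1 \<Longrightarrow> K1' \<xi> s = K1 \<xi> s \<and> \<gamma>1' \<xi> s = \<gamma>1 (\<xi>, s)"
    by (rule lipschitz_kernel_representative[OF E K1m \<gamma>1m K1l]) blast
  have K2m: "\<And>x. (\<lambda>(\<xi>, s). K2 \<xi> s x) \<in> borel_measurable ?L"
    using C by (auto simp: condition_C_def)
  have "AE p in ?L. \<bar>\<gamma>2 p\<bar> \<le> ?\<kappa>2" using C by (intro Linf_AE_le) (simp add: condition_C_def)
  moreover have "AE p in ?L. \<forall>x y. norm (K2 (fst p) (snd p) x - K2 (fst p) (snd p) y) \<le> \<gamma>2 p * norm (x - y)"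
    using C by (simp add: condition_C_def split_beta')
  ultimately have "AE p in ?L. \<forall>x y. norm (K2 (fst p) (snd p) x - K2 (fst p) (snd p) y) \<le> ?\<kappa>2 * norm (x - y)"
  proof eventually_elim
    case (elim p)
    then have "\<gamma>2 p * norm (x - y) \<le> ?\<kappa>2 * norm (x - y)" for x y :: "real ^ 'n"
      by (intro mult_right_mono) auto
    then show ?case using elim(2) order_trans by blast
  qed
  then have K2l: "AE (\<xi>, s) in ?L. \<forall>x y. norm (K2 \<xi> s x - K2 \<xi> s y) \<le> (\<lambda>_. ?\<kappa>2) (\<xi>, s) * norm (x - y)"
    by (simp add: split_beta')
  have \<kappa>2m: "(\<lambda>_. ?\<kappa>2) \<in> borel_measurable ?L" by simp
  obtain K2' \<gamma>2' N2 where K2': "\<And>x. (\<lambda>p. K2' (fst p) (snd p) x) \<in> borel_measurable (?M \<Otimes>\<^sub>M ?M)"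
    "\<And>\<xi> s x y. norm (K2' \<xi> s x - K2' \<xi> s y) \<le> \<gamma>2' \<xi> s * norm (x - y)"
    and N2: "N2 \<in> null_sets lborel"
    and K2'_eq: "\<And>\<xi> s. \<xi> \<in> E \<Longrightarrow> s \<in> E \<Longrightarrow> (\<xi>, s) \<notin> N2 \<Longrightarrow> K2' \<xi> s = K2 \<xi> s \<and> \<gamma>2' \<xi> s = ?\<kappa>2"
    and \<gamma>2'_0: "\<And>\<xi> s. (\<xi>, s) \<in> N2 \<Longrightarrow> \<gamma>2' \<xi> s = 0"
    by (rule lipschitz_kernel_representative[OF E K2m \<kappa>2m K2l]) blast
  have K2'_lip: "norm (K2' \<xi> s x - K2' \<xi> s y) \<le> ?\<kappa>2 * norm (x - y)" if "\<xi> \<in> E" "s \<in> E" for \<xi> s x y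
  proof -
    \<comment> \<open>On the exceptional set the factor is zero, elsewhere it equals the essential bound.\<close>
    have "\<gamma>2' \<xi> s \<le> ?\<kappa>2"
      using K2'_eq[OF that] \<gamma>2'_0[of \<xi> s] Linf_norm_nonneg[of "E \<times> E" \<gamma>2] by (cases "(\<xi>, s) \<in> N2") auto
    then show ?thesis by (rule order_trans[OF K2'(2) mult_right_mono]) simp
  qed
  have ae1: "AE p in ?L. K1' (fst p) (snd p) = K1 (fst p) (snd p) \<and> \<gamma>1' (fst p) (snd p) = \<gamma>1 p"
    using AE_lebesgue_on_notin[OF EEs N1] AE_space by eventually_elim (auto simp: K1'_eq)
  have ae2: "AE p in ?L. K2' (fst p) (snd p) = K2 (fst p) (snd p)"
    using AE_lebesgue_on_notin[OF EEs N2] AE_space by eventually_elim (auto simp: K2'_eq)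
  have K1sq: "sq_integrable ?L (\<lambda>p. K1 (fst p) (snd p) 0)" and \<gamma>1sq: "sq_integrable ?L \<gamma>1"
    using B by (auto simp: condition_B_def L2_iff split_beta')
  have K2sq: "sq_integrable ?L (\<lambda>p. K2 (fst p) (snd p) 0)"
    using C by (auto simp: condition_C_def L2_iff split_beta')
  have K1'_0: "sq_integrable (?M \<Otimes>\<^sub>M ?M) (\<lambda>p. K1' (fst p) (snd p) 0)"
    by (rule sq_integrable_pair_lebesgue_on(1)[OF El El K1'(1) K1sq]) (use ae1 in auto)
  have K2'_0: "sq_integrable (?M \<Otimes>\<^sub>M ?M) (\<lambda>p. K2' (fst p) (snd p) 0)"
    by (rule sq_integrable_pair_lebesgue_on(1)[OF El El K2'(1) K2sq]) (use ae2 in auto)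
  have "AE p in ?L. \<gamma>1' (fst p) (snd p) = \<gamma>1 p" using ae1 by auto
  note \<gamma>1' = sq_integrable_pair_lebesgue_on[OF El El K1'(2) \<gamma>1sq this]
  interpret finite_measure ?M by (rule finite_measure_lebesgue_on[OF El])
  have sys: "lipschitz_system ?M f' K1' K2' \<gamma>1' lam \<rho> ?\<kappa>0 ?\<kappa>1 ?\<kappa>2"
  proof
    show "0 < lam" by (rule lam)
    show "0 \<le> \<rho>" using \<rho> by simp
    show "0 \<le> ?\<kappa>0" "0 \<le> ?\<kappa>2" by (rule Linf_norm_nonneg)+
    show "0 \<le> ?\<kappa>1" by (simp add: L2_norm_eq)
    show "(\<lambda>\<xi>. f' \<xi> x) \<in> borel_measurable ?M" for x by (rule f'_meas)
    show "sq_integrable ?M (\<lambda>\<xi>. f' \<xi> 0)" by (rule f'_0)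
    show "norm (f' \<xi> x - f' \<xi> y) \<le> ?\<kappa>0 * norm (x - y)" if "\<xi> \<in> space ?M" for \<xi> x y
      using f_good[of \<xi>] that Linf_norm_nonneg[of E \<gamma>0] by (simp add: f'_def)
    show "(\<lambda>p. K1' (fst p) (snd p) x) \<in> borel_measurable (?M \<Otimes>\<^sub>M ?M)" for x by (rule K1'(1))
    show "sq_integrable (?M \<Otimes>\<^sub>M ?M) (\<lambda>p. K1' (fst p) (snd p) 0)" by (rule K1'_0)
    show "sq_integrable (?M \<Otimes>\<^sub>M ?M) (\<lambda>p. \<gamma>1' (fst p) (snd p))" by (rule \<gamma>1'(1))
    show "l2norm (?M \<Otimes>\<^sub>M ?M) (\<lambda>p. \<gamma>1' (fst p) (snd p)) \<le> ?\<kappa>1" using \<gamma>1'(2) by (simp add: L2_norm_eq)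
    show "norm (K1' \<xi> s x - K1' \<xi> s y) \<le> \<gamma>1' \<xi> s * norm (x - y)" for \<xi> s x y by (rule K1'(3))
    show "(\<lambda>p. K2' (fst p) (snd p) x) \<in> borel_measurable (?M \<Otimes>\<^sub>M ?M)" for x by (rule K2'(1))
    show "sq_integrable (?M \<Otimes>\<^sub>M ?M) (\<lambda>p. K2' (fst p) (snd p) 0)" by (rule K2'_0)
    show "norm (K2' \<xi> s x - K2' \<xi> s y) \<le> ?\<kappa>2 * norm (x - y)" if "\<xi> \<in> space ?M" "s \<in> space ?M" for \<xi> s x y
      using that by (intro K2'_lip) auto
    show "6 * (?\<kappa>0\<^sup>2 + lam\<^sup>2 * ?\<kappa>1\<^sup>2 + lam\<^sup>2 * \<rho>\<^sup>2 * ?\<kappa>2\<^sup>2 * measure ?M (space ?M)) < 1"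
      using D measure_lebesgue_on[OF E order_refl] by (simp add: condition_D_def)
  qed
  have sec: "AE \<xi> in ?M. AE s in ?M. K1' \<xi> s = K1 \<xi> s \<and> K2' \<xi> s = K2 \<xi> s"
    using AE_lebesgue_on_sections_notin[OF Es Es N1] AE_lebesgue_on_sections_notin[OF Es Es N2] AE_space
  proof eventually_elim
    case (elim \<xi>)
    from elim(1,2) AE_space show ?case
      by eventually_elim (use elim(3) K1'_eq K2'_eq in auto)
  qed
  show thesis by (rule that[OF sys f'_eq sec])
qed

theorem theorem3p1:
  fixes E :: "(real ^ 'k) set"
    and f :: "real ^ 'k \<Rightarrow> real ^ 'n \<Rightarrow> real ^ 'n"
    and K1 :: "real ^ 'k \<Rightarrow> real ^ 'k \<Rightarrow> real ^ 'n \<Rightarrow> real ^ 'n"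
    and K2 :: "real ^ 'k \<Rightarrow> real ^ 'k \<Rightarrow> real ^ 'n \<Rightarrow> real ^ 'm ^ 'n"
    and \<gamma>0 :: "real ^ 'k \<Rightarrow> real"
    and \<gamma>1 \<gamma>2 :: "(real ^ 'k) \<times> (real ^ 'k) \<Rightarrow> real"
    and lam \<rho> \<kappa>0 \<kappa>1 \<kappa>2 :: real
  assumes "compact E"
    and "lam > 0"
    and "\<rho> > 0"
    and "condition_A E f \<gamma>0"
    and "condition_B E K1 \<gamma>1"
    and "condition_C E K2 \<gamma>2"
    and "\<kappa>0 = Linf_norm E \<gamma>0"
    and "\<kappa>1 = L2_norm (E \<times> E) \<gamma>1"
    and "\<kappa>2 = Linf_norm (E \<times> E) \<gamma>2"
    and "condition_D (measure lebesgue E) lam \<rho> \<kappa>0 \<kappa>1 \<kappa>2"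
  shows "\<forall>\<epsilon>>0. \<exists>\<alpha>s>0. \<exists>\<Delta>s>0. \<exists>\<delta>s>0. \<exists>\<sigma>s>0.
    \<forall>\<Delta>\<in>{0<..\<Delta>s}. \<forall>\<delta>\<in>{0<..\<delta>s}. \<forall>\<sigma>\<in>{0<..\<sigma>s}. \<forall>\<Gamma> \<Lambda> (B :: (real ^ 'm) set).
      finite_partition \<Delta> E \<Gamma> \<longrightarrow> uniform_partition \<delta> \<alpha>s \<Lambda> \<longrightarrow> finite_sphere_net \<sigma> B \<longrightarrow>
      hausdorff_L2 E
        (trajectories E f K1 K2 lam (admissible_controls E \<rho>))
        (trajectories E f K1 K2 lam (discrete_controls E \<rho> \<Gamma> \<Lambda> B))
      \<le> ennreal ((c_star (measure lebesgue E) lam \<rho> \<kappa>0 \<kappa>1 \<kappa>2 + 1) * \<epsilon>)"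
proof (intro allI impI, goal_cases)
  case (1 \<epsilon>)
  then have \<epsilon>: "0 < \<epsilon>" .
  let ?M = "lebesgue_on E" and ?V = "admissible_controls E \<rho>"
  note \<kappa> = assms(7-9)
  obtain f' and K1' and K2' :: "real ^ 'k \<Rightarrow> real ^ 'k \<Rightarrow> real ^ 'n \<Rightarrow> real ^ 'm ^ 'n" and \<gamma>1' where
    sys: "lipschitz_system ?M f' K1' K2' \<gamma>1' lam \<rho> \<kappa>0 \<kappa>1 \<kappa>2"
    and f': "AE \<xi> in ?M. f' \<xi> = f \<xi>"
    and K': "AE \<xi> in ?M. AE s in ?M. K1' \<xi> s = K1 \<xi> s \<and> K2' \<xi> s = K2 \<xi> s"
    using assms(10) unfolding \<kappa>
    by (rule regular_representative[OF assms(1-6)]) blast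
  interpret lipschitz_system ?M f' K1' K2' \<gamma>1' lam \<rho> \<kappa>0 \<kappa>1 \<kappa>2 by (rule sys)
  have Es: "E \<in> sets lebesgue" using lmeasurable_compact[OF assms(1)] by (rule fmeasurableD)
  have traj: "is_trajectory E f K1 K2 lam u x \<longleftrightarrow> sol u x" if "u \<in> ?V" for u x
    by (rule is_trajectory_iff_sol[OF Es sys f' K' that])
  have ctrl: "ctrl u \<longleftrightarrow> u \<in> ?V" for u
    by (simp add: ctrl_def admissible_controls_def L2_iff L2_norm_eq)
  have c: "\<epsilon> \<le> (c_star (measure lebesgue E) lam \<rho> \<kappa>0 \<kappa>1 \<kappa>2 + 1) * \<epsilon>"
    using c_star_nonneg[OF assms(10)] \<epsilon> by simp
  obtain \<B> d where mod: "traj_modulus \<epsilon> \<B> d" by (rule traj_modulus_exists[OF \<epsilon>])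
  then have \<B>: "finite \<B>" "\<B> \<subseteq> sets ?M" "0 < d" by (auto simp: traj_modulus_def)
  have main: "hausdorff_L2 E (trajectories E f K1 K2 lam ?V)
        (trajectories E f K1 K2 lam (discrete_controls E \<rho> \<Gamma> \<Lambda> B))
      \<le> ennreal ((c_star (measure lebesgue E) lam \<rho> \<kappa>0 \<kappa>1 \<kappa>2 + 1) * \<epsilon>)"
    if P: "finite_partition \<Delta> E \<Gamma>" and N: "finite_sphere_net \<sigma> B"
      and dense: "\<forall>u. sq_integrable ?M u \<longrightarrow> l2norm ?M u \<le> \<rho> \<longrightarrow>
        (\<exists>v\<in>discrete_controls E \<rho> \<Gamma> \<Lambda> B. weakly_close ?M \<B> d u v)"
    for \<Delta> \<sigma> \<Gamma> \<Lambda> and B :: "(real ^ 'm) set"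
  proof -
    let ?W = "discrete_controls E \<rho> \<Gamma> \<Lambda> B"
    have WV: "?W \<subseteq> ?V" using assms(3) by (intro discrete_controls_admissible[OF assms(1) P N]) simp
    have "hausdorff_L2 E (trajectories E f K1 K2 lam ?V) (trajectories E f K1 K2 lam ?W) \<le> ennreal \<epsilon>"
    proof (rule hausdorff_L2_le)
      show "trajectories E f K1 K2 lam ?W \<subseteq> trajectories E f K1 K2 lam ?V"
        using WV unfolding trajectories_def by blast
      fix x assume "x \<in> trajectories E f K1 K2 lam ?V"
      then obtain u where u: "u \<in> ?V" and "is_trajectory E f K1 K2 lam u x"
        unfolding trajectories_def by blast
      then have x: "sol u x" by (simp add: traj)
      have uc: "ctrl u" using u by (simp add: ctrl)
      then obtain v where v: "v \<in> ?W" and cl: "weakly_close ?M \<B> d u v"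
        using dense unfolding ctrl_def by blast
      have vV: "v \<in> ?V" using v WV by blast
      then have vc: "ctrl v" by (simp add: ctrl)
      obtain y where y: "sol v y" by (rule sol_exists[OF vc])
      have "L2_norm E (\<lambda>s. x s - y s) \<le> \<epsilon>"
        unfolding L2_norm_eq by (rule traj_modulusD[OF mod uc vc x y cl])
      moreover have "y \<in> trajectories E f K1 K2 lam ?W"
        unfolding trajectories_def using v traj[OF vV] y by blast
      ultimately show "\<exists>y\<in>trajectories E f K1 K2 lam ?W. L2_norm E (\<lambda>s. x s - y s) \<le> \<epsilon>" by blast
    qed
    also have "\<dots> \<le> ennreal ((c_star (measure lebesgue E) lam \<rho> \<kappa>0 \<kappa>1 \<kappa>2 + 1) * \<epsilon>)"
      by (rule ennreal_leI[OF c])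
    finally show ?thesis .
  qed
  obtain \<alpha>s \<Delta>s \<delta>s \<sigma>s where pos: "0 < \<alpha>s" "0 < \<Delta>s" "0 < \<delta>s" "0 < \<sigma>s"
    and dense: "\<forall>\<Delta>\<in>{0<..\<Delta>s}. \<forall>\<delta>\<in>{0<..\<delta>s}. \<forall>\<sigma>\<in>{0<..\<sigma>s}. \<forall>\<Gamma> \<Lambda> (B :: (real ^ 'm) set).
      finite_partition \<Delta> E \<Gamma> \<longrightarrow> uniform_partition \<delta> \<alpha>s \<Lambda> \<longrightarrow> finite_sphere_net \<sigma> B \<longrightarrow>
      (\<forall>u. sq_integrable ?M u \<longrightarrow> l2norm ?M u \<le> \<rho> \<longrightarrow>
        (\<exists>v\<in>discrete_controls E \<rho> \<Gamma> \<Lambda> B. weakly_close ?M \<B> d u v))"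
    using discrete_controls_weakly_dense[OF assms(1) \<B>, where \<rho> = \<rho>] by (elim exE conjE) (rule that)
  show ?case
  proof (rule exI[of _ \<alpha>s], rule conjI[OF pos(1)], rule exI[of _ \<Delta>s], rule conjI[OF pos(2)],
      rule exI[of _ \<delta>s], rule conjI[OF pos(3)], rule exI[of _ \<sigma>s], rule conjI[OF pos(4)],
      intro ballI allI impI)
    fix \<Delta> \<delta> \<sigma> \<Gamma> \<Lambda> and B :: "(real ^ 'm) set"
    assume "\<Delta> \<in> {0<..\<Delta>s}" "\<delta> \<in> {0<..\<delta>s}" "\<sigma> \<in> {0<..\<sigma>s}"
      and P: "finite_partition \<Delta> E \<Gamma>" and L: "uniform_partition \<delta> \<alpha>s \<Lambda>" and N: "finite_sphere_net \<sigma> B"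
    then have "\<forall>u. sq_integrable ?M u \<longrightarrow> l2norm ?M u \<le> \<rho> \<longrightarrow>
        (\<exists>v\<in>discrete_controls E \<rho> \<Gamma> \<Lambda> B. weakly_close ?M \<B> d u v)"
      using dense by blast
    from main[OF P N this] show "hausdorff_L2 E (trajectories E f K1 K2 lam ?V)
        (trajectories E f K1 K2 lam (discrete_controls E \<rho> \<Gamma> \<Lambda> B))
      \<le> ennreal ((c_star (measure lebesgue E) lam \<rho> \<kappa>0 \<kappa>1 \<kappa>2 + 1) * \<epsilon>)" .
  qed
qed

end
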